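(* Fix $\delta>0$. For all $h>0$, all $E=E(h)>0$ (which may depend on $h$), all $\varepsilon\in[0,1]$, both choices of sign $\pm$, and all $u\in\mathcal D$ with $(|x|+1)^{(1+\delta)/2}(P-E\pm i\varepsilon)u\in L^2(\mathbb R)$, $$\int_{\mathbb R}(|x|+1)^{-1-\delta}\big(E|u|^2+|hu'|^2\big)\,dx\;\le\; C(V,E,h,\delta)\int_{\mathbb R}(|x|+1)^{1+\delta}\,|(P-E\pm i\varepsilon)u|^2\,dx .$$ Here $$C(V,E,h,\delta)= e^{C_1(V,E,h,\delta)}\Big(\frac{4}{h^2}+\frac{2}{h}+\frac{1}{Eh^2}\big(2+2E+\tfrac{\|V\|^2}{h^2}\big)^2\Big)e^{C_1(V,E,h,\delta)},\qquad C_1(V,E,h,\delta)=2\delta^{-1}+E^{-1/2}h^{-1}\|V\|.$$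
   Context: For each $h>0$, $V=V(x;h)$ is a real, finite signed Borel measure on $\mathbb R$, which may depend on $h$. $|V|=V^++V^-$ is its total variation measure ($\{V^+,V^-\}$ the Jordan decomposition) and $\|V\|=|V|(\mathbb R)$. $L^2(\mathbb R)$ is with respect to Lebesgue measure. Each $u\in H^1(\mathbb R)$ has a unique bounded continuous representative $u_c$; the product of $u$ and $V$ is the complex Borel measure $u_cV$, and one defines, in the sense of distributions on $\mathbb R$, $$Pu=P(h)u=-h^2\partial_x^2u+u_cV .$$ The domain of $P$ is $\mathcal D=\{u\in H^1(\mathbb R): u'\in L^\infty(\mathbb R),\ Pu\in L^2(\mathbb R)\}$, where $u'=\partial_xu$ and the condition $Pu\in L^2(\mathbb R)$ means that the distribution $Pu$ is given by an $L^2$ function. *)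

theory Defs
  imports "HOL-Analysis.Analysis"
begin

section \<open>Finite signed Borel measures on the real line\<close>

text \<open>Only the values on Borel sets are relevant. Convergence of the series for every
  enumeration makes it unconditional, hence absolute.\<close>

definition finite_signed_borel_measure :: "(real set \<Rightarrow> real) \<Rightarrow> bool" where
  "finite_signed_borel_measure V \<longleftrightarrow>
     V {} = 0 \<and>
     (\<forall>A :: nat \<Rightarrow> real set. range A \<subseteq> sets borel \<longrightarrow> disjoint_family A \<longrightarrow>
        (\<lambda>n. V (A n)) sums V (\<Union>n. A n))"

definition jordan_decomposition ::
    "(real set \<Rightarrow> real) \<Rightarrow> real measure \<times> real measure \<Rightarrow> bool" where
  "jordan_decomposition V = (\<lambda>(M, N).
     sets M = sets borel \<and> sets N = sets borel \<and>
     finite_measure M \<and> finite_measure N \<and>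
     (\<exists>S\<in>sets borel. emeasure M (- S) = 0 \<and> emeasure N S = 0) \<and>
     (\<forall>A\<in>sets borel. V A = measure M A - measure N A))"

text \<open>The Jordan decomposition of a finite signed Borel measure exists and is unique, so
  that the choice below is determined.\<close>

definition pos_var :: "(real set \<Rightarrow> real) \<Rightarrow> real measure" where
  "pos_var V = fst (SOME p. jordan_decomposition V p)"

definition neg_var :: "(real set \<Rightarrow> real) \<Rightarrow> real measure" where
  "neg_var V = snd (SOME p. jordan_decomposition V p)"

definition total_variation :: "(real set \<Rightarrow> real) \<Rightarrow> real set \<Rightarrow> real" where
  "total_variation V A = measure (pos_var V) A + measure (neg_var V) A"

definition tv_norm :: "(real set \<Rightarrow> real) \<Rightarrow> real" where
  "tv_norm V = total_variation V UNIV"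

definition signed_integral :: "(real set \<Rightarrow> real) \<Rightarrow> (real \<Rightarrow> complex) \<Rightarrow> complex" where
  "signed_integral V f = (LINT x|pos_var V. f x) - (LINT x|neg_var V. f x)"

section \<open>Function spaces\<close>

text \<open>Elements of \<open>L\<^sup>2\<close>, \<open>L\<^sup>\<infinity>\<close> and \<open>H\<^sup>1\<close> are handled through representatives: a set below
  contains all Lebesgue measurable representatives of the classes in the respective space.\<close>

definition L2 :: "(real \<Rightarrow> complex) set" where
  "L2 = {f \<in> borel_measurable lebesgue. integrable lebesgue (\<lambda>x. (norm (f x))\<^sup>2)}"

definition Linf :: "(real \<Rightarrow> complex) set" where
  "Linf = {f \<in> borel_measurable lebesgue. \<exists>C. AE x in lebesgue. norm (f x) \<le> C}"

definition locally_integrable :: "(real \<Rightarrow> complex) \<Rightarrow> bool" where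
  "locally_integrable f \<longleftrightarrow> (\<forall>K. compact K \<longrightarrow> set_integrable lebesgue K f)"

definition vderiv :: "(real \<Rightarrow> complex) \<Rightarrow> real \<Rightarrow> complex" where
  "vderiv f x = vector_derivative f (at x)"

definition test_functions :: "(real \<Rightarrow> complex) set" where
  "test_functions =
     {\<phi>. (\<forall>n x. ((vderiv ^^ n) \<phi>) differentiable (at x)) \<and> compact (closure {x. \<phi> x \<noteq> 0})}"

section \<open>Distributions\<close>

text \<open>A distribution is represented by its pairing with test functions; two distributions
  are equal if these pairings agree on \<^const>\<open>test_functions\<close>. The pairing is bilinear.\<close>

type_synonym distribution = "(real \<Rightarrow> complex) \<Rightarrow> complex"

definition dist_of_fun :: "(real \<Rightarrow> complex) \<Rightarrow> distribution" where
  "dist_of_fun f = (\<lambda>\<phi>. LINT x|lebesgue. f x * \<phi> x)"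

definition dist_deriv :: "distribution \<Rightarrow> distribution" where
  "dist_deriv T = (\<lambda>\<phi>. - T (vderiv \<phi>))"

definition dist_eq :: "distribution \<Rightarrow> distribution \<Rightarrow> bool" where
  "dist_eq S T \<longleftrightarrow> (\<forall>\<phi>\<in>test_functions. S \<phi> = T \<phi>)"

definition has_weak_deriv :: "(real \<Rightarrow> complex) \<Rightarrow> (real \<Rightarrow> complex) \<Rightarrow> bool" where
  "has_weak_deriv u v \<longleftrightarrow>
     locally_integrable u \<and> locally_integrable v \<and>
     dist_eq (dist_deriv (dist_of_fun u)) (dist_of_fun v)"

text \<open>A weak derivative is unique up to null sets; \<open>weak_deriv\<close> picks a representative.\<close>

definition weak_deriv :: "(real \<Rightarrow> complex) \<Rightarrow> real \<Rightarrow> complex" where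
  "weak_deriv u = (SOME v. has_weak_deriv u v)"

definition H1 :: "(real \<Rightarrow> complex) set" where
  "H1 = {u \<in> L2. (\<exists>v. has_weak_deriv u v) \<and> weak_deriv u \<in> L2}"

definition cont_rep :: "(real \<Rightarrow> complex) \<Rightarrow> real \<Rightarrow> complex" where
  "cont_rep u = (THE w. continuous_on UNIV w \<and> bounded (range w) \<and> (AE x in lebesgue. w x = u x))"

section \<open>The operator\<close>

definition P_dist :: "(real set \<Rightarrow> real) \<Rightarrow> real \<Rightarrow> (real \<Rightarrow> complex) \<Rightarrow> distribution" where
  "P_dist V h u = (\<lambda>\<phi>.
     - (of_real h)\<^sup>2 * dist_deriv (dist_deriv (dist_of_fun u)) \<phi>
     + signed_integral V (\<lambda>x. cont_rep u x * \<phi> x))"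

definition P_dom :: "(real set \<Rightarrow> real) \<Rightarrow> real \<Rightarrow> (real \<Rightarrow> complex) set" where
  "P_dom V h = {u \<in> H1. weak_deriv u \<in> Linf \<and>
                        (\<exists>f\<in>L2. dist_eq (P_dist V h u) (dist_of_fun f))}"

text \<open>For \<open>u\<close> in the domain, \<open>P_op V h u\<close> is a representative of the \<open>L\<^sup>2\<close> function that
  gives the distribution \<open>P u\<close>; it is unique up to null sets.\<close>

definition P_op :: "(real set \<Rightarrow> real) \<Rightarrow> real \<Rightarrow> (real \<Rightarrow> complex) \<Rightarrow> real \<Rightarrow> complex" where
  "P_op V h u = (SOME f. f \<in> L2 \<and> dist_eq (P_dist V h u) (dist_of_fun f))"

definition P_shift ::
    "(real set \<Rightarrow> real) \<Rightarrow> real \<Rightarrow> complex \<Rightarrow> (real \<Rightarrow> complex) \<Rightarrow> real \<Rightarrow> complex" where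
  "P_shift V h z u = (\<lambda>x. P_op V h u x - z * u x)"

section \<open>The constants\<close>

definition C1_const :: "(real set \<Rightarrow> real) \<Rightarrow> real \<Rightarrow> real \<Rightarrow> real \<Rightarrow> real" where
  "C1_const V E h \<delta> = 2 * \<delta> powr (-1) + E powr (-1/2) * h powr (-1) * tv_norm V"

definition C_const :: "(real set \<Rightarrow> real) \<Rightarrow> real \<Rightarrow> real \<Rightarrow> real \<Rightarrow> real" where
  "C_const V E h \<delta> =
     exp (C1_const V E h \<delta>)
     * (4 / h\<^sup>2 + 2 / h + 1 / (E * h\<^sup>2) * (2 + 2 * E + (tv_norm V)\<^sup>2 / h\<^sup>2)\<^sup>2)
     * exp (C1_const V E h \<delta>)"

end

theory Submission
  imports Defs "HOL-Computational_Algebra.Polynomial"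
begin

text \<open>Let \<open>w\<close> be the continuous representative of \<open>u\<close>, let \<open>p\<close> be a representative of \<open>hu'\<close>
  that has bounded variation locally, \<open>f = (P - E \<plusminus> i\<epsilon>)u\<close>, and \<open>F = E|w|\<^sup>2 + |p|\<^sup>2\<close>. On a
  short interval \<open>V\<close> acts on \<open>(\<surd>E w, p)\<close> as a shear, which multiplies \<open>F\<close> by at most \<open>e\<^sup>q\<close>,
  where \<open>q\<close> is the mass that \<open>|V| / (h\<surd>E)\<close> gives to the interval; atoms are harmless. Since
  \<open>F\<close> is integrable, it tends to \<open>0\<close> along some sequence going to \<open>-\<infinity>\<close>, and therefore \<open>F \<le>
  e\<^sup>q (2/h) (\<integral>|p||f| + \<epsilon>\<integral>|w||p|)\<close> everywhere, now with the total mass \<open>q\<close>. The imaginary and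
  real parts of \<open>\<langle>(P - E \<plusminus> i\<epsilon>)u, u\<rangle>\<close> control \<open>\<epsilon>\<parallel>w\<parallel>\<^sup>2\<close> and \<open>\<epsilon>\<parallel>p\<parallel>\<^sup>2\<close> by \<open>\<integral>|w||f|\<close>. Integrating
  \<open>F\<close> against the weight, whose integral is \<open>2/\<delta>\<close>, and applying Cauchy--Schwarz gives the
  estimate, because \<open>(2/\<delta>)\<^sup>2 \<le> e\<^sup>4\<^sup>/\<^sup>\<delta> / 4\<close>.\<close> 

section \<open>The Jordan decomposition\<close>

text \<open>The obstacle is that \<open>V\<close> may have atoms. Then \<open>p\<close> jumps, so
  the product of \<open>p\<close> and \<open>V\<close>, and with it a pointwise formula for the
  derivative of \<open>F\<close>, makes no sense, whereas \<open>w\<close> is continuous and its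
  products with \<open>V\<close> and \<open>p\<close> cause no trouble. Hence everything is phrased
  through increments over half-open intervals, and \<open>F\<close> is compared at the two ends of
  short intervals. The weight \<open>E\<close> in \<open>F\<close> makes the main terms cancel; only
  \<open>f\<close>, the \<epsilon>-term and the shear remain. In the pairing with \<open>u\<close>
  the potential contributes the integral of \<open>|w|\<^sup>2\<close> against \<open>V\<close>. It
  is real, so it drops out of the imaginary part; in the real part it is at most
  \<open>R / h * \<parallel>V\<parallel>\<close> with \<open>R = \<integral>|w||p|\<close>, and half
  of \<open>\<integral>|p|\<^sup>2\<close> absorbs it. This produces
  \<open>K = 2 + 2E + \<parallel>V\<parallel>\<^sup>2/h\<^sup>2\<close>. With \<open>J\<close> the
  weighted energy and \<open>N\<close> the weighted integral of \<open>|f|\<^sup>2\<close>,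
  Cauchy--Schwarz bounds both integrals in the estimate of \<open>F\<close> by multiples of
  \<open>sqrt (N * J)\<close>. As \<open>J\<close> is finite, a factor \<open>sqrt J\<close> can be
  divided out; the squaring explains the two factors \<open>exp C1\<close>.\<close>

locale real_signed_measure =
  fixes M :: "'a measure" and V :: "'a set \<Rightarrow> real"
  assumes empty: "V {} = 0"
    and sums_UN: "range A \<subseteq> sets M \<Longrightarrow> disjoint_family A \<Longrightarrow> (\<lambda>n. V (A n)) sums V (\<Union>n. A n)"
begin

lemma Un_disjoint:
  assumes "A \<in> sets M" "B \<in> sets M" "A \<inter> B = {}"
  shows "V (A \<union> B) = V A + V B"
proof -
  let ?A = "binaryset A B"
  have "(\<lambda>n. V (?A n)) sums V (\<Union>n. ?A n)"
    using assms by (intro sums_UN) (auto simp: disjoint_family_on_def binaryset_def)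
  moreover have "(\<lambda>n. V (?A n)) sums (V A + V B)"
    using binaryset_sums[of V A B] empty by simp
  ultimately show ?thesis
    by (metis UN_binaryset_eq sums_unique2)
qed

lemma Diff_subset:
  assumes "A \<in> sets M" "B \<in> sets M" "B \<subseteq> A"
  shows "V (A - B) = V A - V B"
proof -
  have "V (B \<union> (A - B)) = V B + V (A - B)"
    using assms by (intro Un_disjoint) auto
  moreover have "B \<union> (A - B) = A" using assms by auto
  ultimately show ?thesis by simp
qed

lemma uminus: "real_signed_measure M (\<lambda>A. - V A)"
  by unfold_locales (auto simp: empty sums_minus sums_UN)

text \<open>The supremum of \<open>V\<close> over the subsets of \<open>R\<close> is not yet known
  to be finite, hence the cap 1. A finite positive supremum is more than half attained by some
  subset, and \<open>{}\<close> serves if the supremum is at most 0.\<close>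

lemma ex_large_subset:
  assumes "R \<in> sets M"
  shows "\<exists>B\<in>sets M. B \<subseteq> R \<and> (\<forall>C\<in>sets M. C \<subseteq> R \<longrightarrow> min 1 (V C / 2) \<le> V B)"
proof (cases "\<exists>B\<in>sets M. B \<subseteq> R \<and> V B \<ge> 1")
  case True
  then show ?thesis by (meson min.coboundedI1)
next
  case False
  let ?S = "V ` {B \<in> sets M. B \<subseteq> R}"
  have bdd: "bdd_above ?S" using False by (intro bdd_aboveI[of _ 1]) force
  have ne: "?S \<noteq> {}" by auto
  show ?thesis
  proof (cases "Sup ?S \<le> 0")
    case True
    have "V C \<le> 0" if "C \<in> sets M" "C \<subseteq> R" for C
      using that True cSup_upper[OF _ bdd, of "V C"] by force
    then show ?thesis
      by (intro bexI[of _ "{}"]) (force simp: empty min_def)+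
  next
    case False
    then have "Sup ?S / 2 < Sup ?S" by simp
    then obtain B where "B \<in> sets M" "B \<subseteq> R" "Sup ?S / 2 < V B"
      using less_cSup_iff[OF ne bdd] by auto
    moreover have "V C \<le> Sup ?S" if "C \<in> sets M" "C \<subseteq> R" for C
      using that cSup_upper[OF _ bdd, of "V C"] by force
    ultimately show ?thesis
      by (intro bexI[of _ B]) force+
  qed
qed

text \<open>Greedy exhaustion: the \<open>V\<close>-values of the removed sets are summable, so what remains
  contains no set of positive value.\<close> 

lemma exhaustion:
  assumes pick: "\<forall>R\<in>sets M. \<exists>B\<in>sets M. B \<subseteq> R \<and> Q B \<and> (\<forall>C\<in>sets M. C \<subseteq> R \<longrightarrow> min 1 (V C / 2) \<le> V B)"
    and D: "D \<in> sets M"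
  shows "\<exists>B :: nat \<Rightarrow> 'a set. range B \<subseteq> sets M \<and> disjoint_family B \<and>
      (\<forall>n. B n \<subseteq> D \<and> Q (B n) \<and> 0 \<le> V (B n)) \<and>
      (\<forall>C\<in>sets M. C \<subseteq> D - (\<Union>n. B n) \<longrightarrow> V C \<le> 0)"
proof -
  obtain pk where pk: "\<And>R. R \<in> sets M \<Longrightarrow> pk R \<in> sets M \<and> pk R \<subseteq> R \<and> Q (pk R) \<and>
      (\<forall>C\<in>sets M. C \<subseteq> R \<longrightarrow> min 1 (V C / 2) \<le> V (pk R))"
    using pick by metis
  \<comment> \<open>\<open>A n\<close> is what is left of \<open>D\<close> after \<open>n\<close>
    removals, and \<open>B n\<close> is the set removed next.\<close>
  define A where "A = rec_nat D (\<lambda>_ R. R - pk R)"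
  have A_simps: "A 0 = D" "A (Suc n) = A n - pk (A n)" for n by (simp_all add: A_def)
  have A_sets: "A n \<in> sets M" for n
    by (induction n) (use D pk in \<open>auto simp: A_simps\<close>)
  define B where "B n = pk (A n)" for n
  have A_eq: "A n = D - (\<Union>i<n. B i)" for n
    by (induction n) (auto simp: A_simps B_def lessThan_Suc)
  have B_sets: "B n \<in> sets M" and B_sub: "B n \<subseteq> A n" and QB: "Q (B n)"
    and B_large: "\<And>C. C \<in> sets M \<Longrightarrow> C \<subseteq> A n \<Longrightarrow> min 1 (V C / 2) \<le> V (B n)" for n
    using pk[OF A_sets[of n]] by (auto simp: B_def)
  have "B m \<inter> B n = {}" if "m < n" for m n
    using B_sub[of n] that unfolding A_eq by blast
  then have disj: "disjoint_family B"
    unfolding disjoint_family_on_def by (metis Int_commute linorder_neqE_nat)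
  have nonneg: "0 \<le> V (B n)" for n using B_large[of "{}" n] by (simp add: empty)
  have lim: "(\<lambda>n. V (B n)) \<longlonglongrightarrow> 0"
    using sums_UN[OF _ disj] B_sets by (intro summable_LIMSEQ_zero) (auto simp: sums_iff)
  have "V C \<le> 0" if "C \<in> sets M" "C \<subseteq> D - (\<Union>n. B n)" for C
  proof -
    \<comment> \<open>\<open>C\<close> lies in every remainder, so it competed in every round of the
      selection.\<close>
    have "min 1 (V C / 2) \<le> V (B n)" for n
      using that by (intro B_large) (auto simp: A_eq)
    then have "min 1 (V C / 2) \<le> 0"
      using lim by (intro LIMSEQ_le_const) auto
    then show ?thesis by (auto simp: min_def split: if_splits)
  qed
  moreover have "B n \<subseteq> D" for n using B_sub[of n] by (auto simp: A_eq)
  ultimately show ?thesis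
    using B_sets QB disj nonneg by (intro exI[of _ B]) auto
qed

text \<open>Removing sets of nonnegative value can only lower \<open>V\<close>, and by
  \<open>exhaustion\<close>, here with a trivial \<open>Q\<close>, the remainder has no subset of
  positive value.\<close>

lemma ex_negative_subset:
  assumes "D \<in> sets M"
  shows "\<exists>A\<in>sets M. A \<subseteq> D \<and> V A \<le> V D \<and> (\<forall>C\<in>sets M. C \<subseteq> A \<longrightarrow> V C \<le> 0)"
proof -
  have pick: "\<forall>R\<in>sets M. \<exists>B\<in>sets M. B \<subseteq> R \<and> True \<and>
      (\<forall>C\<in>sets M. C \<subseteq> R \<longrightarrow> min 1 (V C / 2) \<le> V B)"
    unfolding simp_thms by (intro ballI ex_large_subset)
  obtain B :: "nat \<Rightarrow> 'a set" where B: "range B \<subseteq> sets M" "disjoint_family B" "\<forall>n. B n \<subseteq> D \<and> True \<and>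
      0 \<le> V (B n)"
      "\<forall>C\<in>sets M. C \<subseteq> D - (\<Union>n. B n) \<longrightarrow> V C \<le> 0"
    using exhaustion[OF pick assms] by (elim exE conjE)
  have UB: "(\<Union>n. B n) \<in> sets M" using B(1) by auto
  have "0 \<le> V (\<Union>n. B n)"
    using sums_le[OF _ sums_zero sums_UN[OF B(1,2)]] B(3) by simp
  then have "V (D - (\<Union>n. B n)) \<le> V D"
    using B(3) UB assms by (subst Diff_subset) auto
  then show ?thesis
    using UB assms B(4) by (intro bexI[of _ "D - (\<Union>n. B n)"]) simp_all
qed

text \<open>\<open>exhaustion\<close> is run for \<open>- V\<close> on the whole space with negative
  sets as the removed pieces; \<open>ex_negative_subset\<close> turns a nearly optimal piece into a
  negative one at no loss. The remainder has no subset of negative value, and its complement is a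
  countable disjoint union of negative sets.\<close>

proposition Hahn_decomposition:
  "\<exists>S\<in>sets M. \<forall>C\<in>sets M. (C \<subseteq> S \<longrightarrow> 0 \<le> V C) \<and> (C \<inter> S = {} \<longrightarrow> V C \<le> 0)"
proof -
  interpret m: real_signed_measure M "\<lambda>A. - V A" by (rule uminus)
  let ?Q = "\<lambda>A. \<forall>C\<in>sets M. C \<subseteq> A \<longrightarrow> V C \<le> 0"
  have pick: "\<forall>R\<in>sets M. \<exists>B\<in>sets M. B \<subseteq> R \<and> ?Q B \<and>
      (\<forall>C\<in>sets M. C \<subseteq> R \<longrightarrow> min 1 (- V C / 2) \<le> - V B)"
  proof
    fix R assume "R \<in> sets M"
    obtain D where D: "D \<in> sets M" "D \<subseteq> R"
      "\<forall>C\<in>sets M. C \<subseteq> R \<longrightarrow> min 1 (- V C / 2) \<le> - V D"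
      using m.ex_large_subset[OF \<open>R \<in> sets M\<close>] by (elim bexE conjE)
    obtain A where A: "A \<in> sets M" "A \<subseteq> D" "V A \<le> V D"
      and neg: "\<forall>C\<in>sets M. C \<subseteq> A \<longrightarrow> V C \<le> 0"
      using ex_negative_subset[OF D(1)] by (elim bexE conjE)
    have "min 1 (- V C / 2) \<le> - V A" if "C \<in> sets M" "C \<subseteq> R" for C
    proof -
      have "min 1 (- V C / 2) \<le> - V D" using D(3) that by simp
      with A(3) show ?thesis by linarith
    qed
    then show "\<exists>B\<in>sets M. B \<subseteq> R \<and> ?Q B \<and> (\<forall>C\<in>sets M. C \<subseteq> R \<longrightarrow> min 1 (- V C / 2) \<le> - V B)"
      using A D(2) neg by (intro bexI[of _ A] conjI ballI impI) blast+
  qed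
  obtain B :: "nat \<Rightarrow> 'a set" where B: "range B \<subseteq> sets M" "disjoint_family B" "\<forall>n. B n \<subseteq> space M \<and>
      ?Q (B n) \<and> 0 \<le> - V (B n)"
      "\<forall>C\<in>sets M. C \<subseteq> space M - (\<Union>n. B n) \<longrightarrow> - V C \<le> 0"
    using m.exhaustion[OF pick sets.top] by (elim exE conjE)
  have UB: "(\<Union>n. B n) \<in> sets M" using B(1) by auto
  have "V C \<le> 0" if "C \<in> sets M" "C \<inter> (space M - (\<Union>n. B n)) = {}" for C
  proof -
    have C_eq: "(\<Union>n. C \<inter> B n) = C" using that sets.sets_into_space[OF that(1)] by auto
    have sums: "(\<lambda>n. V (C \<inter> B n)) sums V (\<Union>n. C \<inter> B n)"
      using B(1,2) that by (intro sums_UN) (auto simp: disjoint_family_on_def)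
    have le: "V (C \<inter> B n) \<le> 0" for n using B(1,3) that by blast
    show ?thesis
      using sums_le[OF le sums sums_zero] unfolding C_eq .
  qed
  moreover have "0 \<le> V C" if "C \<in> sets M" "C \<subseteq> space M - (\<Union>n. B n)" for C
    using B(4) that by force
  ultimately show ?thesis
    using UB by (intro bexI[of _ "space M - (\<Union>n. B n)"] ballI conjI impI) blast+
qed

end

text \<open>\<open>pos_var\<close> and \<open>neg_var\<close> are picked by \<open>SOME\<close>, so
  existence is what gives access to their properties. The two parts are \<open>V\<close> on a Hahn
  set and \<open>- V\<close> on its complement.\<close>

lemma ex_jordan_decomposition:
  assumes "finite_signed_borel_measure V"
  shows "\<exists>p. jordan_decomposition V p"
proof -
  interpret real_signed_measure "borel :: real measure" V
    using assms by unfold_locales (auto simp: finite_signed_borel_measure_def)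
  obtain S where S: "S \<in> sets borel"
    and "\<forall>C\<in>sets borel. (C \<subseteq> S \<longrightarrow> 0 \<le> V C) \<and> (C \<inter> S = {} \<longrightarrow> V C \<le> 0)"
    using Hahn_decomposition by blast
  then have nonneg: "0 \<le> 1 * V (A \<inter> S)" "0 \<le> - 1 * V (A \<inter> - S)" if "A \<in> sets borel" for A
    using that by (auto simp: sets.Int)
  \<comment> \<open>One construction for both parts: \<open>c = 1\<close> with \<open>T = S\<close>,
    and \<open>c = - 1\<close> with \<open>T = - S\<close>.\<close>
  have *: "\<exists>M. sets M = sets borel \<and> finite_measure M \<and>
      (\<forall>A\<in>sets borel. emeasure M A = ennreal (c * V (A \<inter> T)))"
    if T: "T \<in> sets borel" and nonneg: "\<And>A. A \<in> sets borel \<Longrightarrow> 0 \<le> c * V (A \<inter> T)" for c T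
  proof -
    let ?\<mu> = "\<lambda>A. ennreal (c * V (A \<inter> T))"
    let ?M = "measure_of UNIV (sets borel) ?\<mu>"
    have em: "emeasure ?M A = ?\<mu> A" if "A \<in> sets borel" for A
    proof (rule emeasure_measure_of_sigma)
      show "sigma_algebra UNIV (sets (borel :: real measure))"
        using sets.sigma_algebra_axioms[of "borel :: real measure"] by simp
      show "positive (sets borel) ?\<mu>" by (simp add: positive_def empty)
      show "countably_additive (sets borel) ?\<mu>"
        unfolding countably_additive_def
      proof (intro allI impI)
        fix A :: "nat \<Rightarrow> real set"
        assume A: "range A \<subseteq> sets borel" "disjoint_family A" "(\<Union>i. A i) \<in> sets borel"
        have "(\<lambda>n. V (A n \<inter> T)) sums V (\<Union>n. A n \<inter> T)"
          using A T by (intro sums_UN) (auto simp: disjoint_family_on_def)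
        moreover have "(\<Union>n. A n \<inter> T) = (\<Union>n. A n) \<inter> T" by auto
        ultimately have "(\<lambda>n. c * V (A n \<inter> T)) sums (c * V ((\<Union>n. A n) \<inter> T))"
          by (simp only: sums_mult)
        then show "(\<Sum>i. ?\<mu> (A i)) = ?\<mu> (\<Union>i. A i)"
          using A(1) by (subst suminf_ennreal2) (auto intro!: nonneg simp: sums_iff
              image_subset_iff)
      qed
    qed (use that in simp)
    have "sets ?M = sets borel" 
      using sets_measure_of[of "sets borel" "UNIV :: real set" ?\<mu>] 
        sets.sigma_sets_eq[of "borel :: real measure"] by simp
    moreover have "finite_measure ?M" using em[of UNIV] by (intro finite_measureI) simp
    ultimately show ?thesis using em by (intro exI[of _ ?M]) simp
  qed
  obtain M where M: "sets M = sets borel" "finite_measure M"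
      "\<And>A. A \<in> sets borel \<Longrightarrow> emeasure M A = ennreal (1 * V (A \<inter> S))"
    using *[OF S nonneg(1)] by metis
  obtain N where N: "sets N = sets borel" "finite_measure N"
      "\<And>A. A \<in> sets borel \<Longrightarrow> emeasure N A = ennreal (- 1 * V (A \<inter> - S))"
    using *[OF borel_comp[OF S] nonneg(2)] by metis
  have "V A = measure M A - measure N A" if A: "A \<in> sets borel" for A
  proof -
    have "measure M A = V (A \<inter> S)" "measure N A = - V (A \<inter> - S)"
      using M(3)[OF A] N(3)[OF A] nonneg[OF A] by (simp_all add: measure_def)
    moreover have "(A \<inter> S) \<union> (A \<inter> - S) = A" by auto
    then have "V A = V (A \<inter> S) + V (A \<inter> - S)"
      using Un_disjoint[of "A \<inter> S" "A \<inter> - S"] S A by (simp add: sets.Int borel_comp)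
    ultimately show ?thesis by simp
  qed
  moreover have "emeasure M (- S) = 0" "emeasure N S = 0"
    using M(3)[of "- S"] N(3)[of S] S empty by auto
  ultimately show ?thesis
    using M(1,2) N(1,2) S unfolding jordan_decomposition_def
    by (intro exI[of _ "(M, N)"]) (simp; blast)
qed

section \<open>Locally integrable functions on the line\<close>

text \<open>Bounded intervals instead of compact sets, because all local integrals below are over
  intervals; the codomain is general because real norms and complex functions both occur.\<close>

definition loc_int :: "(real \<Rightarrow> 'a::euclidean_space) \<Rightarrow> bool" where
  "loc_int f \<longleftrightarrow> (\<forall>a b. set_integrable lebesgue {a..b} f)"

lemma loc_intD: "loc_int f \<Longrightarrow> set_integrable lebesgue {a..b} f"
  by (simp add: loc_int_def)

lemma loc_int_norm: "loc_int f \<Longrightarrow> loc_int (\<lambda>x. norm (f x))"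
  unfolding loc_int_def using set_integrable_norm by blast

lemma loc_int_add: "loc_int f \<Longrightarrow> loc_int g \<Longrightarrow> loc_int (\<lambda>x. f x + g x)"
  unfolding loc_int_def using set_integral_add(1) by blast

lemma loc_int_diff: "loc_int f \<Longrightarrow> loc_int g \<Longrightarrow> loc_int (\<lambda>x. f x - g x)"
  unfolding loc_int_def using set_integral_diff(1) by blast

lemma loc_int_linear:
  assumes "bounded_linear L" "loc_int f"
  shows "loc_int (\<lambda>x. L (f x))"
  unfolding loc_int_def
proof (intro allI)
  fix a b :: real
  have "integrable lebesgue (\<lambda>x. L (indicat_real {a..b} x *\<^sub>R f x))"
    using assms by (intro integrable_bounded_linear[OF assms(1)]) (auto simp: loc_int_def
        set_integrable_def)
  then show "set_integrable lebesgue {a..b} (\<lambda>x. L (f x))"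
    by (simp add: set_integrable_def linear_simps[OF assms(1)])
qed

lemma loc_int_cmult:
  fixes f :: "real \<Rightarrow> 'a::{euclidean_space, real_normed_algebra}"
  shows "loc_int f \<Longrightarrow> loc_int (\<lambda>x. c * f x)"
  by (rule loc_int_linear[OF bounded_linear_mult_right])

lemma loc_int_cnj: "loc_int f \<Longrightarrow> loc_int (\<lambda>x. cnj (f x))"
  by (rule loc_int_linear[OF bounded_linear_cnj])

lemma loc_int_Re: "loc_int f \<Longrightarrow> loc_int (\<lambda>x. Re (f x))"
  by (rule loc_int_linear[OF bounded_linear_Re])

lemma loc_int_mult_bounded:
  fixes f g :: "real \<Rightarrow> 'a::{euclidean_space, real_normed_algebra}"
  assumes f: "loc_int f" and [measurable]: "g \<in> borel_measurable lebesgue"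
    and bdd: "\<And>a b. \<exists>B. \<forall>x\<in>{a..b}. norm (g x) \<le> B"
  shows "loc_int (\<lambda>x. f x * g x)"
  unfolding loc_int_def
proof (intro allI)
  fix a b :: real
  obtain B where B: "\<And>x. x \<in> {a..b} \<Longrightarrow> norm (g x) \<le> B" using bdd[of a b] by blast
  have f': "integrable lebesgue (\<lambda>x. indicat_real {a..b} x *\<^sub>R f x)"
    using loc_intD[OF f, of a b] by (simp add: set_integrable_def)
  have meas: "(\<lambda>x. indicat_real {a..b} x *\<^sub>R f x) \<in> borel_measurable lebesgue"
    using f' by (rule borel_measurable_integrable)
  have "integrable lebesgue (\<lambda>x. (indicat_real {a..b} x *\<^sub>R f x) * g x)"
  proof (rule Bochner_Integration.integrable_bound)
    show "integrable lebesgue (\<lambda>x. B * norm (indicat_real {a..b} x *\<^sub>R f x))"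
      using f' by (intro integrable_mult_right integrable_norm)
    show "(\<lambda>x. (indicat_real {a..b} x *\<^sub>R f x) * g x) \<in> borel_measurable lebesgue"
      using meas by measurable
    have "norm ((indicat_real {a..b} x *\<^sub>R f x) * g x) \<le> norm (B * norm (indicat_real {a..b} x *\<^sub>R
        f x))" for x
    proof (cases "x \<in> {a..b}")
      case True
      have "norm (f x * g x) \<le> norm (f x) * norm (g x)" by (rule norm_mult_ineq)
      also have "\<dots> \<le> norm (f x) * B" using B[OF True] by (intro mult_left_mono) auto
      also have "\<dots> \<le> \<bar>B * norm (f x)\<bar>" by (simp add: mult.commute)
      finally show ?thesis using True by simp
    qed simp
    then show "AE x in lebesgue. norm ((indicat_real {a..b} x *\<^sub>R f x) * g x)
        \<le> norm (B * norm (indicat_real {a..b} x *\<^sub>R f x))" by simp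
  qed
  then show "set_integrable lebesgue {a..b} (\<lambda>x. f x * g x)"
    by (simp add: set_integrable_def)
qed

lemma loc_int_continuous: "continuous_on UNIV f \<Longrightarrow> loc_int f"
  unfolding loc_int_def
  by (meson absolutely_integrable_continuous_real continuous_on_subset subset_UNIV)

lemma interval_integral_combine:
  fixes f :: "real \<Rightarrow> 'a::euclidean_space"
  assumes "loc_int f" "a \<le> c" "c \<le> b"
  shows "(LINT x:{a..b}|lebesgue. f x) = (LINT x:{a..c}|lebesgue. f x) + (LINT x:{c..b}|lebesgue.
      f x)"
  using Henstock_Kurzweil_Integration.integral_combine[OF assms(2,3), of f] assms(1)
  by (simp add: set_lebesgue_integral_eq_integral[OF loc_intD] )

lemma interval_integral_mono_set:
  fixes f :: "real \<Rightarrow> real"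
  assumes "loc_int f" "\<And>x. 0 \<le> f x" "a \<le> a'" "b' \<le> b"
  shows "(LINT x:{a'..b'}|lebesgue. f x) \<le> (LINT x:{a..b}|lebesgue. f x)"
  unfolding set_lebesgue_integral_def
  using assms(2-4) loc_intD[OF assms(1), unfolded set_integrable_def]
  by (intro integral_mono) (auto simp: indicator_def)

text \<open>This is continuity of the indefinite integral at \<open>x\<close>, in the form that
  Bolzano's lemma asks for: the interval may extend to both sides of \<open>x\<close>.\<close>

lemma interval_integral_small:
  fixes f :: "real \<Rightarrow> 'a::euclidean_space"
  assumes "loc_int f" "\<eta> > 0"
  shows "\<exists>d>0. \<forall>a b. a \<le> x \<and> x \<le> b \<and> b - a < d \<longrightarrow> norm (LINT y:{a..b}|lebesgue. f y) < \<eta>"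
proof -
  have int: "f integrable_on {a..b}" for a b
    using set_lebesgue_integral_eq_integral(1)[OF loc_intD[OF assms(1)]] .
  let ?\<Phi> = "\<lambda>t. integral {x-1..t} f"
  have "continuous_on {x-1..x+1} ?\<Phi>" by (rule indefinite_integral_continuous_1[OF int])
  from this[unfolded continuous_on_iff, rule_format, of x "\<eta>/2"]
  have "\<exists>d>0. \<forall>t\<in>{x-1..x+1}. dist t x < d \<longrightarrow> dist (?\<Phi> t) (?\<Phi> x) < \<eta>/2"
    using assms(2) by simp
  then obtain d where d: "d > 0"
    "\<forall>t\<in>{x-1..x+1}. dist t x < d \<longrightarrow> dist (?\<Phi> t) (?\<Phi> x) < \<eta>/2" by blast
  show ?thesis
  proof (intro exI[of _ "min d 1"] conjI allI impI)
    fix a b assume ab: "a \<le> x \<and> x \<le> b \<and> b - a < min d 1"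
    have "dist (?\<Phi> a) (?\<Phi> x) < \<eta>/2" "dist (?\<Phi> b) (?\<Phi> x) < \<eta>/2"
      using ab d(2)[rule_format, of a] d(2)[rule_format, of b] by (auto simp: dist_real_def)
    then have "dist (?\<Phi> a) (?\<Phi> b) < \<eta>" by (rule dist_triangle_half_l)
    have "?\<Phi> a + integral {a..b} f = ?\<Phi> b"
      using ab by (intro Henstock_Kurzweil_Integration.integral_combine int) auto
    then have "integral {a..b} f = ?\<Phi> b - ?\<Phi> a" by (simp add: algebra_simps)
    moreover have "dist (?\<Phi> b) (?\<Phi> a) < \<eta>"
      using \<open>dist (?\<Phi> a) (?\<Phi> b) < \<eta>\<close> by (simp add: dist_commute)
    ultimately show "norm (LINT y:{a..b}|lebesgue. f y) < \<eta>"
      by (simp add: set_lebesgue_integral_eq_integral[OF loc_intD[OF assms(1)]] dist_norm)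
  qed (use d in auto)
qed

lemma continuous_if_interval_integral:
  fixes f U :: "real \<Rightarrow> 'a::euclidean_space"
  assumes "loc_int f" and U: "\<And>a b. a \<le> b \<Longrightarrow> U b - U a = (LINT x:{a..b}|lebesgue. f x)"
  shows "continuous_on UNIV U"
proof -
  have "isCont U x" for x
    unfolding continuous_at_eps_delta
  proof (intro allI impI)
    fix e :: real assume "e > 0"
    then obtain d where d: "d > 0"
        "\<forall>a b. a \<le> x \<and> x \<le> b \<and> b - a < d \<longrightarrow> norm (LINT y:{a..b}|lebesgue. f y) < e"
      using interval_integral_small[OF assms(1), of e x] by blast
    show "\<exists>d>0. \<forall>x'. dist x' x < d \<longrightarrow> dist (U x') (U x) < e"
    proof (intro exI[of _ d] conjI allI impI)
      fix y assume "dist y x < d"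
      then show "dist (U y) (U x) < e"
        using d(2)[rule_format, of x y] d(2)[rule_format, of y x] U[of x y] U[of y x]
        by (cases "x \<le> y") (auto simp: dist_norm norm_minus_commute)
    qed (use d in auto)
  qed
  then show ?thesis by (simp add: continuous_at_imp_continuous_on)
qed

lemma continuous_bounded_interval:
  fixes f :: "real \<Rightarrow> 'a::real_normed_vector"
  assumes "continuous_on UNIV f"
  shows "\<exists>B. \<forall>x\<in>{a..b}. norm (f x) \<le> B"
proof -
  have "compact (f ` {a..b})"
    by (rule compact_continuous_image[OF continuous_on_subset[OF assms subset_UNIV] compact_Icc])
  then show ?thesis by (auto dest!: compact_imp_bounded simp: bounded_iff)
qed

lemma continuous_measurable_lebesgue:
  fixes f :: "real \<Rightarrow> 'a::euclidean_space"
  shows "continuous_on UNIV f \<Longrightarrow> f \<in> borel_measurable lebesgue"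
  by (simp add: borel_measurable_continuous_onI measurable_completion)

section \<open>Test functions and the lemma of du Bois-Reymond\<close>

definition smooth :: "(real \<Rightarrow> complex) \<Rightarrow> bool" where
  "smooth f \<longleftrightarrow> (\<forall>n x. ((vderiv ^^ n) f) differentiable (at x))"

lemma vderiv_eq: "(\<And>x. (f has_vector_derivative f' x) (at x)) \<Longrightarrow> vderiv f = f'"
  by (auto simp: vderiv_def fun_eq_iff intro: vector_derivative_at)

text \<open>Membership in \<open>S\<close> is an invariant of differentiation, which avoids explicit
  formulas for higher derivatives.\<close>

lemma smooth_if_closed_under_vderiv:
  assumes "f \<in> S" and S: "\<And>g. g \<in> S \<Longrightarrow> \<exists>g'\<in>S. \<forall>x. (g has_vector_derivative g' x) (at x)"
  shows "smooth f"
proof -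
  have "(vderiv ^^ n) f \<in> S" for n
  proof (induction n)
    case (Suc n)
    then obtain g' where "g' \<in> S" "\<forall>x. ((vderiv ^^ n) f has_vector_derivative g' x) (at x)" using
        S by blast
    then show ?case using vderiv_eq[of "(vderiv ^^ n) f" g'] by simp
  qed (simp add: assms(1))
  then show ?thesis
    unfolding smooth_def using S by (metis differentiableI_vector)
qed

lemma smooth_antiderivative:
  assumes "smooth \<psi>" "\<And>x. (\<phi> has_vector_derivative \<psi> x) (at x)"
  shows "smooth \<phi>"
  unfolding smooth_def
proof (intro allI)
  fix n x
  have "vderiv \<phi> = \<psi>" using assms(2) by (rule vderiv_eq)
  then show "((vderiv ^^ n) \<phi>) differentiable (at x)"
    using assms by (cases n) (auto simp: smooth_def funpow_swap1 intro: differentiableI_vector)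
qed

lemma smooth_has_vector_derivative: "smooth f \<Longrightarrow> (f has_vector_derivative vderiv f x) (at x)"
  unfolding smooth_def vderiv_def using vector_derivative_works[of f "at x"]
  by (metis funpow_0)

lemma smooth_vderiv: "smooth f \<Longrightarrow> smooth (vderiv f)"
  unfolding smooth_def by (metis funpow_Suc_right comp_apply)

lemma smooth_lincomb:
  assumes "smooth f" "smooth g"
  shows "smooth (\<lambda>x. c * f x + d * g x)"
proof (rule smooth_if_closed_under_vderiv)
  let ?S = "{\<lambda>x. c * f x + d * g x |f g. smooth f \<and> smooth g}"
  show "(\<lambda>x. c * f x + d * g x) \<in> ?S" using assms by blast
  fix k assume "k \<in> ?S"
  then obtain f g where fg: "k = (\<lambda>x. c * f x + d * g x)" "smooth f" "smooth g" by blast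
  have "(k has_vector_derivative c * vderiv f x + d * vderiv g x) (at x)" for x
    unfolding fg(1) using fg(2,3)[THEN smooth_has_vector_derivative]
    by (intro has_vector_derivative_add has_vector_derivative_mult_right)
  moreover have "(\<lambda>x. c * vderiv f x + d * vderiv g x) \<in> ?S"
    using fg(2,3)[THEN smooth_vderiv] by blast
  ultimately show "\<exists>g'\<in>?S. \<forall>x. (k has_vector_derivative g' x) (at x)"
    by (intro bexI[of _ "\<lambda>x. c * vderiv f x + d * vderiv g x"] allI)
qed

lemma smooth_continuous: "smooth f \<Longrightarrow> continuous_on UNIV f"
  by (intro continuous_at_imp_continuous_on ballI)
     (use has_vector_derivative_continuous smooth_has_vector_derivative in blast)

text \<open>For fixed \<open>a\<close>, \<open>b\<close> and \<open>\<kappa>\<close> these functions form a family that is closed under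
  differentiation.\<close> 

definition bump :: "real \<Rightarrow> real \<Rightarrow> real \<Rightarrow> real poly \<Rightarrow> nat \<Rightarrow> real \<Rightarrow> complex" where
  "bump a b \<kappa> R n x = (if a < x \<and> x < b
     then of_real (poly R x * exp (- \<kappa> / ((x - a) * (b - x))) / ((x - a) * (b - x)) ^ n) else 0)"

text \<open>The \<open>m\<close>-th power of \<open>t \<le> exp t\<close> at
  \<open>t = y / m\<close>. It lets \<open>exp (- \<kappa> / D)\<close> beat any negative power of
  \<open>D\<close>.\<close>

lemma power_le_exp:
  fixes y :: real
  assumes "0 \<le> y" "0 < m"
  shows "(y / real m) ^ m \<le> exp y"
proof -
  have "(y / real m) ^ m \<le> exp (y / real m) ^ m"
    using assms exp_ge_add_one_self[of "y / real m"] by (intro power_mono) (linarith, simp)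
  also have "\<dots> = exp y" using assms by (simp flip: exp_of_nat_mult)
  finally show ?thesis .
qed

text \<open>Quadratic decay towards the exterior is what differentiability at the endpoints needs.
  With \<open>m = n + 2\<close>, the bound
  \<open>exp (- \<kappa> / D) \<le> (m / \<kappa>) ^ m * D ^ m\<close> leaves
  \<open>D\<^sup>2\<close> after division by \<open>D ^ n\<close>, and \<open>D\<close> is at most
  \<open>b - a\<close> times the distance to any exterior point.\<close>

lemma bump_bound:
  assumes "0 < \<kappa>"
  shows "\<exists>C\<ge>0. \<forall>x y. (x \<le> a \<or> b \<le> x) \<longrightarrow> norm (bump a b \<kappa> R n y) \<le> C * (y - x)\<^sup>2"
proof -
  obtain B where B: "\<forall>x\<in>{a..b}. norm (poly R x) \<le> B"
    using continuous_bounded_interval[of "poly R" a b] continuous_at_imp_continuous_on[of UNIV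
        "poly R"]
      poly_isCont by blast
  define m where "m = n + 2"
  define C where "C = \<bar>B\<bar> * (real m / \<kappa>) ^ m * (b - a)\<^sup>2"
  have C0: "0 \<le> C" using assms by (simp add: C_def)
  have "norm (bump a b \<kappa> R n y) \<le> C * (y - x)\<^sup>2" if x: "x \<le> a \<or> b \<le> x" for x y
  proof (cases "a < y \<and> y < b")
    case True
    define D where "D = (y - a) * (b - y)"
    have D: "D > 0" using True by (simp add: D_def)
    have "(\<kappa> / D / real m) ^ m \<le> exp (\<kappa> / D)"
      using D assms by (intro power_le_exp) (auto simp: m_def)
    then have "exp (- (\<kappa> / D)) \<le> inverse ((\<kappa> / D / real m) ^ m)"
      unfolding exp_minus using D assms by (intro le_imp_inverse_le) (auto simp: m_def)
    also have "\<dots> = (real m / \<kappa>) ^ m * D ^ m" by (simp add: field_simps power_mult_distrib)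
    finally have e: "exp (- \<kappa> / D) \<le> (real m / \<kappa>) ^ m * D ^ m" by simp
    have Dle: "D \<le> (b - a) * \<bar>y - x\<bar>"
    proof -
      consider "y - a \<le> \<bar>y - x\<bar>" | "b - y \<le> \<bar>y - x\<bar>" using x True by linarith
      then show ?thesis
      proof cases
        case 1
        then have "(y - a) * (b - y) \<le> \<bar>y - x\<bar> * (b - a)" using True by (intro mult_mono) auto
        then show ?thesis by (simp add: D_def mult.commute)
      next
        case 2
        then have "(y - a) * (b - y) \<le> (b - a) * \<bar>y - x\<bar>" using True by (intro mult_mono) auto
        then show ?thesis by (simp add: D_def)
      qed
    qed
    have "norm (bump a b \<kappa> R n y) = \<bar>poly R y\<bar> * exp (- \<kappa> / D) / D ^ n"
      using True D by (simp add: bump_def D_def[symmetric] norm_mult norm_divide norm_power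
          abs_mult del: of_real_mult of_real_divide)
    also have "\<dots> \<le> \<bar>B\<bar> * ((real m / \<kappa>) ^ m * D ^ m) / D ^ n"
    proof (intro divide_right_mono mult_mono e)
      show "\<bar>poly R y\<bar> \<le> \<bar>B\<bar>" using B[rule_format, of y] True by simp
    qed (use D in auto)
    also have "\<dots> = \<bar>B\<bar> * (real m / \<kappa>) ^ m * D\<^sup>2"
      using D by (simp add: m_def power_add power2_eq_square)
    also have "\<dots> \<le> \<bar>B\<bar> * (real m / \<kappa>) ^ m * ((b - a) * \<bar>y - x\<bar>)\<^sup>2"
      using D Dle assms by (intro mult_left_mono power_mono) auto
    also have "\<dots> = C * (y - x)\<^sup>2" by (simp add: C_def power_mult_distrib)
    finally show ?thesis .
  next
    case False
    then have "bump a b \<kappa> R n y = 0" by (auto simp: bump_def)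
    then show ?thesis using C0 by simp
  qed
  with C0 show ?thesis by blast
qed

lemma bump_deriv_outside:
  assumes "0 < \<kappa>" "x \<le> a \<or> b \<le> x"
  shows "(bump a b \<kappa> R n has_vector_derivative 0) (at x)"
proof -
  obtain C where C: "\<forall>x y. (x \<le> a \<or> b \<le> x) \<longrightarrow> norm (bump a b \<kappa> R n y) \<le> C * (y - x)\<^sup>2"
    using bump_bound[OF assms(1)] by blast
  have x0: "bump a b \<kappa> R n x = 0" using assms(2) by (auto simp: bump_def)
  show ?thesis
    unfolding has_vector_derivative_def
  proof (rule has_derivativeI_sandwich[of 1 _ _ _ _ "\<lambda>y. C * \<bar>y - x\<bar>"])
    have "((\<lambda>y. C * \<bar>y - x\<bar>) \<longlongrightarrow> C * \<bar>x - x\<bar>) (at x)" by (intro tendsto_intros)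
    then show "((\<lambda>y. C * \<bar>y - x\<bar>) \<longlongrightarrow> 0) (at x)" by simp
    fix y assume "y \<noteq> x"
    then show "norm (bump a b \<kappa> R n y - bump a b \<kappa> R n x - (y - x) *\<^sub>R 0) / norm (y - x) \<le> C * \<bar>y
        - x\<bar>"
    proof -
      have "(y - x)\<^sup>2 = \<bar>y - x\<bar> * \<bar>y - x\<bar>" by (simp add: power2_eq_square)
      then have "norm (bump a b \<kappa> R n y) \<le> C * \<bar>y - x\<bar> * \<bar>y - x\<bar>"
        using C[rule_format, OF assms(2), of y] by (simp only: mult.assoc)
      then show ?thesis using \<open>y \<noteq> x\<close> x0 by (simp add: pos_divide_le_eq)
    qed
  qed auto
qed

lemma bump_deriv:
  assumes "0 < \<kappa>"
  shows "\<exists>R'. \<forall>x. (bump a b \<kappa> R n has_vector_derivative bump a b \<kappa> R' (n + 2) x) (at x)"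
proof -
  define d where "d = [:- a, 1:] * [:b, - 1:]"
  have d: "poly d x = (x - a) * (b - x)" for x by (simp add: d_def algebra_simps)
  \<comment> \<open>The quotient rule for \<open>poly R * exp (- \<kappa> / d) / d ^ n\<close> over
    the denominator \<open>d ^ (n + 2)\<close>; the two additional powers come from differentiating
    the exponent.\<close>
  define R' where "R' = pderiv R * d\<^sup>2 - smult (real n) (R * pderiv d * d) + smult \<kappa> (R * pderiv d)"
  have "(bump a b \<kappa> R n has_vector_derivative bump a b \<kappa> R' (n + 2) x) (at x)" for x
  proof (cases "a < x \<and> x < b")
    case True
    let ?D = "poly d x"
    have D: "?D > 0" using True by (simp add: d)
    have "((\<lambda>x. poly R x * exp (- \<kappa> / poly d x) / poly d x ^ n) has_real_derivative
        ((poly (pderiv R) x * exp (- \<kappa> / ?D) + poly R x * (exp (- \<kappa> / ?D) * (\<kappa> * poly (pderiv d) x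
            / ?D\<^sup>2))) * ?D ^ n
          - poly R x * exp (- \<kappa> / ?D) * (real n * ?D ^ (n - 1) * poly (pderiv d) x)) / (?D ^ n)\<^sup>2)
              (at x)"
      using D by (auto intro!: derivative_eq_intros simp: power2_eq_square field_simps)
    also have "((poly (pderiv R) x * exp (- \<kappa> / ?D) + poly R x * (exp (- \<kappa> / ?D) * (\<kappa> * poly
        (pderiv d) x / ?D\<^sup>2))) * ?D ^ n
          - poly R x * exp (- \<kappa> / ?D) * (real n * ?D ^ (n - 1) * poly (pderiv d) x)) / (?D ^ n)\<^sup>2
        = poly R' x * exp (- \<kappa> / ?D) / ?D ^ (n + 2)"
      using D by (cases n) (simp_all add: R'_def power2_eq_square field_simps)
    finally have "((\<lambda>x. of_real (poly R x * exp (- \<kappa> / poly d x) / poly d x ^ n))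
        has_vector_derivative
        (of_real (poly R' x * exp (- \<kappa> / ?D) / ?D ^ (n + 2)) :: complex)) (at x)"
      by (rule has_vector_derivative_of_real)
    then have "(bump a b \<kappa> R n has_vector_derivative of_real (poly R' x * exp (- \<kappa> / ?D) / ?D ^ (n
        + 2))) (at x)"
      using True by (rule_tac has_vector_derivative_transform_within_open[where S="{a<..<b}"])
          (auto simp: bump_def d)
    then show ?thesis using True by (simp add: bump_def d)
  next
    case False
    then have "x \<le> a \<or> b \<le> x" by auto
    moreover have "bump a b \<kappa> R' (n + 2) x = 0" using False by (auto simp: bump_def)
    ultimately show ?thesis using bump_deriv_outside[OF assms] by metis
  qed
  then show ?thesis by blast
qed

lemma smooth_bump: "0 < \<kappa> \<Longrightarrow> smooth (bump a b \<kappa> R n)"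
proof (rule smooth_if_closed_under_vderiv)
  show "bump a b \<kappa> R n \<in> {bump a b \<kappa> R n |R n. True}" by blast
  show "\<exists>g'\<in>{bump a b \<kappa> R n |R n. True}. \<forall>x. (g has_vector_derivative g' x) (at x)"
    if "0 < \<kappa>" "g \<in> {bump a b \<kappa> R n |R n. True}" for g
    using that bump_deriv[OF that(1)] by blast
qed

lemma test_functionsI:
  assumes "smooth \<phi>" "\<And>x. x \<notin> {a..b} \<Longrightarrow> \<phi> x = 0"
  shows "\<phi> \<in> test_functions"
proof -
  have "{x. \<phi> x \<noteq> 0} \<subseteq> {a..b}" using assms(2) by blast
  then have "closure {x. \<phi> x \<noteq> 0} \<subseteq> {a..b}" by (intro closure_minimal) auto
  then have "compact (closure {x. \<phi> x \<noteq> 0})"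
    using compact_Int_closed[OF compact_Icc[of a b] closed_closure[of "{x. \<phi> x \<noteq> 0}"]] by (simp
        add: Int_absorb1)
  then show ?thesis using assms(1) by (simp add: test_functions_def smooth_def)
qed

lemma test_functionsD:
  assumes "\<phi> \<in> test_functions"
  shows "smooth \<phi>" "\<exists>a b. a \<le> b \<and> (\<forall>x. x \<notin> {a<..<b} \<longrightarrow> \<phi> x = 0)"
proof -
  show "smooth \<phi>" using assms by (simp add: test_functions_def smooth_def)
  have "bounded (closure {x. \<phi> x \<noteq> 0})" using assms by (simp add: test_functions_def
      compact_imp_bounded)
  then obtain B where B: "\<forall>x\<in>closure {x. \<phi> x \<noteq> 0}. norm x \<le> B" by (auto simp: bounded_iff)
  have "\<phi> x = 0" if "x \<notin> {-(\<bar>B\<bar>+1)<..<\<bar>B\<bar>+1}" for x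
    using B[rule_format, of x] that closure_subset[of "{x. \<phi> x \<noteq> 0}"] by force
  then show "\<exists>a b. a \<le> b \<and> (\<forall>x. x \<notin> {a<..<b} \<longrightarrow> \<phi> x = 0)"
    by (intro exI[of _ "-(\<bar>B\<bar>+1)"] exI[of _ "\<bar>B\<bar>+1"]) auto
qed

text \<open>The primitive that starts left of the support also vanishes to the right of it, because
  the total integral is zero.\<close>

lemma ex_test_antiderivative:
  assumes "smooth \<psi>" and zero: "\<And>x. x \<notin> {a..b} \<Longrightarrow> \<psi> x = 0" and "integral {a..b} \<psi> = 0"
  shows "\<exists>\<phi>\<in>test_functions. vderiv \<phi> = \<psi>"
proof -
  have c: "continuous_on UNIV \<psi>" using assms(1) by (rule smooth_continuous)
  then have int: "\<psi> integrable_on {x..y}" for x y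
    by (intro integrable_continuous_real continuous_on_subset[OF c]) auto
  \<comment> \<open>Starting at \<open>a - 1\<close> keeps every \<open>x \<ge> a\<close>, including
    \<open>a\<close> itself, in the interior of \<open>{a - 1..x + 1}\<close>.\<close>
  define \<phi> where "\<phi> x = integral {a - 1..x} \<psi>" for x
  have zero_int: "integral {x..y} \<psi> = 0" if "y < a \<or> b < x" for x y
    using that zero by (intro integral_unique has_integral_is_0) auto
  have der: "(\<phi> has_vector_derivative \<psi> x) (at x)" for x
  proof (cases "x < a")
    case True
    have "((\<lambda>_. 0) has_vector_derivative \<psi> x) (at x)"
      using zero[of x] True by simp
    then show ?thesis
      by (rule has_vector_derivative_transform_within_open[where S="{..<a}"])
        (use True zero_int in \<open>auto simp: \<phi>_def\<close>)
  next
    case False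
    have "(\<phi> has_vector_derivative \<psi> x) (at x within {a - 1..x + 1})"
      unfolding \<phi>_def using False
      by (intro integral_has_vector_derivative continuous_on_subset[OF c]) auto
    moreover have "at x within {a - 1..x + 1} = at x"
      using False by (intro at_within_interior) auto
    ultimately show ?thesis by simp
  qed
  have "integral {a - 1..x} \<psi> = 0" if "x > b" for x
  proof (cases "a \<le> b")
    case True
    have "(\<psi> has_integral integral {a..b} \<psi>) {a - 1..x}"
      using that zero by (intro has_integral_on_superset[OF integrable_integral[OF int]]) auto
    then show ?thesis using assms(3) by (simp add: integral_unique)
  next
    case False
    then show ?thesis using zero by (intro integral_unique has_integral_is_0) auto
  qed
  then have "\<phi> x = 0" if "x \<notin> {a..b}" for x
    using that zero_int[of x "a - 1"] unfolding \<phi>_def by (cases "x < a") auto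
  with smooth_antiderivative[OF assms(1) der] have "\<phi> \<in> test_functions" by (rule test_functionsI)
  with vderiv_eq[OF der] show ?thesis by blast
qed

section \<open>Vanishing interval integrals and functions with zero weak derivative\<close>

lemma sigma_finite_lebesgue: "sigma_finite_measure (lebesgue :: real measure)"
proof
  have "x \<in> (\<Union>n. {- real n..real n})" for x :: real
  proof -
    obtain n where "\<bar>x\<bar> \<le> real n" using real_arch_simple by blast
    then show ?thesis by (auto simp: abs_le_iff intro!: exI[of _ n])
  qed
  then show "\<exists>A. countable A \<and> A \<subseteq> sets lebesgue \<and> \<Union> A = space (lebesgue :: real measure) \<and>
      (\<forall>a\<in>A. emeasure lebesgue a \<noteq> \<infinity>)"
    by (intro exI[of _ "range (\<lambda>n::nat. {- real n..real n})"]) auto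
qed

text \<open>Intervals generate the Borel sets, and a Lebesgue set differs from a Borel set by a null
  set, so the integral over every measurable set vanishes. Truncation to
  \<open>{- real n..real n}\<close> provides the global integrability that this argument
  requires.\<close>

lemma AE_zero_if_interval_integrals_zero:
  fixes f :: "real \<Rightarrow> 'a::euclidean_space"
  assumes f: "loc_int f" and zero: "\<And>a b. a \<le> b \<Longrightarrow> (LINT x:{a..b}|lebesgue. f x) = 0"
  shows "AE x in lebesgue. f x = 0"
proof -
  have "AE x in lebesgue. indicat_real {- real n..real n} x *\<^sub>R f x = 0" for n
  proof (rule sigma_finite_measure.density_unique_banach[OF sigma_finite_lebesgue])
    let ?h = "\<lambda>x. indicat_real {- real n..real n} x *\<^sub>R f x"
    show int: "integrable lebesgue ?h" using loc_intD[OF f] by (simp add: set_integrable_def)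
    have si: "set_integrable lebesgue A ?h" if "A \<in> sets lebesgue" for A
      unfolding set_integrable_def by (rule integrable_mult_indicator[OF that int])
    have Icc: "(LINT x:{a..b}|lebesgue. ?h x) = 0" if "a \<le> b" for a b
    proof -
      have "(LINT x:{a..b}|lebesgue. ?h x) = (LINT x:{max a (- real n)..min b (real n)}|lebesgue.
          f x)"
        unfolding set_lebesgue_integral_def
        by (intro Bochner_Integration.integral_cong) (auto simp: indicator_def)
      also have "\<dots> = 0"
        using zero[of "max a (- real n)" "min b (real n)"]
        by (cases "max a (- real n) \<le> min b (real n)") (auto simp: set_lebesgue_integral_def)
      finally show ?thesis .
    qed
    have total: "(LINT x|lebesgue. ?h x) = 0"
    proof -
      have "(LINT x|lebesgue. ?h x) = (LINT x:{- real n..real n}|lebesgue. f x)"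
        by (simp add: set_lebesgue_integral_def)
      then show ?thesis using zero by simp
    qed
    have borel: "(LINT x:A|lebesgue. ?h x) = 0" if "A \<in> sets borel" for A
      using that
    proof (induction rule: borel_set_induct)
      case (compl A)
      have "(LINT x:A|lebesgue. ?h x) + (LINT x:- A|lebesgue. ?h x) = (LINT x:A \<union> - A|lebesgue. ?h
          x)"
        using compl by (intro set_integral_Un[symmetric] si) auto
      also have "\<dots> = 0" using total by (simp add: set_lebesgue_integral_def)
      finally show ?case using compl by simp
    next
      case (union A)
      have "(LINT x:(\<Union>i. A i)|lebesgue. ?h x) = (\<Sum>i. (LINT x:(A i)|lebesgue. ?h x))"
        using union by (intro lebesgue_integral_countable_add si) (auto simp:
            disjoint_family_on_def)
      then show ?case using union by simp
    qed (simp_all only: Icc, simp add: set_lebesgue_integral_def)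
    fix A :: "real set" assume A: "A \<in> sets lebesgue"
    then obtain S N N' where S: "A = S \<union> N" "N \<subseteq> N'" "N' \<in> null_sets lborel" "S \<in> sets lborel"
      by (rule sets_completionE)
    then have "N' \<in> null_sets lebesgue" by (simp add: null_sets_completionI)
    have SL: "S \<in> sets lebesgue" using S(4) by simp
    have "(LINT x:A|lebesgue. ?h x) = (LINT x:S|lebesgue. ?h x)"
    proof (rule set_integral_null_delta[OF int A SL])
      have "(A - S) \<union> (S - A) \<subseteq> N'" using S by auto
      then show "(A - S) \<union> (S - A) \<in> null_sets lebesgue"
        using \<open>N' \<in> null_sets lebesgue\<close> A SL
        by (meson null_sets_subset sets.Diff sets.Un)
    qed
    also have "\<dots> = 0" using S(4) by (intro borel) simp
    finally show "(LINT x:A|lebesgue. ?h x) = (LINT x:A|lebesgue. 0)" by simp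
  qed simp
  then have "AE x in lebesgue. \<forall>n. indicat_real {- real n..real n} x *\<^sub>R f x = 0"
    by (subst AE_all_countable) blast
  then show ?thesis
  proof eventually_elim
    case (elim x)
    obtain n where "\<bar>x\<bar> \<le> real n" using real_arch_simple by blast
    then show ?case using elim[rule_format, of n] by (simp add: abs_le_iff)
  qed
qed

lemma integral_bump_nonzero:
  assumes "0 < \<kappa>" "a < b"
  shows "integral {a..b} (bump a b \<kappa> 1 0) \<noteq> 0"
proof
  assume 0: "integral {a..b} (bump a b \<kappa> 1 0) = 0"
  have c: "continuous_on {a..b} (bump a b \<kappa> 1 0)"
    using smooth_continuous[OF smooth_bump[OF assms(1)]] continuous_on_subset by blast
  have "integral {a..b} (\<lambda>x. Re (bump a b \<kappa> 1 0 x)) = Re (integral {a..b} (bump a b \<kappa> 1 0))"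
    using integral_linear[OF integrable_continuous_real[OF c] bounded_linear_Re] by (simp add:
        o_def)
  then have i0: "integral {a..b} (\<lambda>x. Re (bump a b \<kappa> 1 0 x)) = 0" using 0 by simp
  have c': "continuous_on {a..b} (\<lambda>x. Re (bump a b \<kappa> 1 0 x))" by (intro continuous_intros c)
  have "Re (bump a b \<kappa> 1 0 ((a + b) / 2)) = 0"
  proof (rule has_integral_0_cbox_imp_0[of a b "\<lambda>x. Re (bump a b \<kappa> 1 0 x)"])
    show "((\<lambda>x. Re (bump a b \<kappa> 1 0 x)) has_integral 0) (cbox a b)"
      using integrable_integral[OF integrable_continuous_real[OF c']] i0 by simp
  qed (use c' assms in \<open>auto simp: bump_def\<close>)
  then show False using assms by (simp add: bump_def field_simps)
qed

text \<open>As \<open>\<kappa> \<rightarrow> 0\<close> the bumps tend boundedly to the indicator function of the interval.\<close> 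

lemma du_Bois_Reymond:
  assumes T: "loc_int T" and T0: "\<And>\<phi>. \<phi> \<in> test_functions \<Longrightarrow> (LINT x|lebesgue. T x * vderiv \<phi> x) = 0"
  shows "\<exists>c. AE x in lebesgue. T x = c"
proof -
  define B where "B a b \<kappa> = bump a b \<kappa> 1 0" for a b \<kappa>
  define I where "I a b \<kappa> = integral {a..b} (B a b \<kappa>)" for a b \<kappa>
  define L where "L \<psi> = (LINT x|lebesgue. T x * \<psi> x)" for \<psi>
  have B_smooth: "smooth (B a b \<kappa>)" if "\<kappa> > 0" for a b \<kappa> using that by (simp add: B_def smooth_bump)
  have B_zero: "B a b \<kappa> x = 0" if "x \<notin> {a..b}" for a b \<kappa> x using that by (auto simp: B_def bump_def)
  have I_nz: "I a b \<kappa> \<noteq> 0" if "\<kappa> > 0" "a < b" for a b \<kappa>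
    using integral_bump_nonzero[OF that] by (simp add: I_def B_def)
  have TB: "integrable lebesgue (\<lambda>x. T x * B a b \<kappa> x)" if "\<kappa> > 0" for a b \<kappa>
  proof -
    have "loc_int (\<lambda>x. T x * B a b \<kappa> x)"
      using smooth_continuous[OF B_smooth[OF that]]
      by (intro loc_int_mult_bounded T continuous_measurable_lebesgue continuous_bounded_interval)
    from loc_intD[OF this, of a b] show ?thesis
      unfolding set_integrable_def
      by (rule Bochner_Integration.integrable_cong[THEN iffD1, rotated 2]) (auto simp:
          indicator_def B_zero)
  qed
  \<comment> \<open>The combination \<open>?\<psi>\<close> of two bumps has integral zero and is
    therefore the derivative of a test function. Hence the quotient of \<open>L\<close> and
    \<open>I\<close> is the same for all bumps; this common value is the constant
    \<open>c\<close>.\<close>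
  have ratio: "L (B a b \<kappa>) * I a' b' \<kappa>' = L (B a' b' \<kappa>') * I a b \<kappa>"
    if pos: "\<kappa> > 0" "\<kappa>' > 0" for a b \<kappa> a' b' \<kappa>'
  proof -
    let ?\<psi> = "\<lambda>x. I a' b' \<kappa>' * B a b \<kappa> x + (- I a b \<kappa>) * B a' b' \<kappa>' x"
    have "\<exists>\<phi>\<in>test_functions. vderiv \<phi> = ?\<psi>"
    proof (rule ex_test_antiderivative)
      show "smooth ?\<psi>" by (intro smooth_lincomb B_smooth pos)
      show "?\<psi> x = 0" if "x \<notin> {min a a'..max b b'}" for x
      proof -
        have "x \<notin> {a..b}" "x \<notin> {a'..b'}" using that by auto
        then show ?thesis by (simp add: B_zero)
      qed
      have hi: "(B a b \<kappa> has_integral I a b \<kappa>) {min a a'..max b b'}"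
        "(B a' b' \<kappa>' has_integral I a' b' \<kappa>') {min a a'..max b b'}"
        unfolding I_def
        using continuous_on_subset[OF smooth_continuous[OF B_smooth[OF pos(1)]] subset_UNIV]
          continuous_on_subset[OF smooth_continuous[OF B_smooth[OF pos(2)]] subset_UNIV]
        by (intro has_integral_on_superset[OF integrable_integral[OF integrable_continuous_real]];
            auto simp: B_zero)+
      show "integral {min a a'..max b b'} ?\<psi> = 0"
        using has_integral_add[OF has_integral_mult_right[OF hi(1), of "I a' b' \<kappa>'"]
            has_integral_mult_right[OF hi(2), of "- I a b \<kappa>"]]
        by (intro integral_unique) (simp add: mult.commute)
    qed
    then obtain \<phi> where \<phi>: "\<phi> \<in> test_functions" "vderiv \<phi> = ?\<psi>" by blast
    have "0 = (LINT x|lebesgue. T x * ?\<psi> x)" using T0[OF \<phi>(1)] \<phi>(2) by simp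
    also have "\<dots> = (LINT x|lebesgue. I a' b' \<kappa>' * (T x * B a b \<kappa> x) - I a b \<kappa> * (T x * B a' b' \<kappa>'
        x))"
      by (intro Bochner_Integration.integral_cong) (auto simp: algebra_simps)
    also have "\<dots> = I a' b' \<kappa>' * L (B a b \<kappa>) - I a b \<kappa> * L (B a' b' \<kappa>')"
      unfolding L_def using TB[OF pos(1)] TB[OF pos(2)] by simp
    finally show ?thesis by (simp add: mult.commute)
  qed
  define c where "c = L (B 0 1 1) / I 0 1 1"
  have L_eq: "L (B a b \<kappa>) = c * I a b \<kappa>" if "\<kappa> > 0" for a b \<kappa>
    using ratio[of \<kappa> 1 a b 0 1] I_nz[of 1 0 1] that by (simp add: c_def field_simps)
  have Tc: "loc_int (\<lambda>x. T x - c)"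
    by (intro loc_int_diff T loc_int_continuous continuous_intros)
  have "(LINT x:{a..b}|lebesgue. T x - c) = 0" if "a \<le> b" for a b
  proof -
    let ?s = "\<lambda>n x. (T x - c) * B a b (1 / real (Suc n)) x"
    have s0: "(LINT x|lebesgue. ?s n x) = 0" for n
    proof -
      let ?\<kappa> = "1 / real (Suc n)"
      have cB: "continuous_on {a..b} (B a b ?\<kappa>)"
        using smooth_continuous[OF B_smooth[of ?\<kappa> a b]] continuous_on_subset by fastforce
      have iB: "set_integrable lebesgue {a..b} (B a b ?\<kappa>)"
        by (rule absolutely_integrable_continuous_real[OF cB])
      have "(\<lambda>x. indicat_real {a..b} x *\<^sub>R B a b ?\<kappa> x) = B a b ?\<kappa>"
        by (auto simp: indicator_def B_zero)
      then have "integrable lebesgue (B a b ?\<kappa>)" "(LINT x|lebesgue. B a b ?\<kappa> x) = I a b ?\<kappa>"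
        using iB set_lebesgue_integral_eq_integral(2)[OF iB]
        by (simp_all add: set_integrable_def I_def set_lebesgue_integral_def)
      then have "(LINT x|lebesgue. T x * B a b ?\<kappa> x - c * B a b ?\<kappa> x) = L (B a b ?\<kappa>) - c * I a b ?\<kappa>"
        using TB[of ?\<kappa> a b] by (simp add: L_def)
      then show ?thesis using L_eq[of ?\<kappa> a b] by (simp add: left_diff_distrib)
    qed
    have meas_T: "(\<lambda>x. indicat_real {a..b} x *\<^sub>R (T x - c)) \<in> borel_measurable lebesgue"
      using loc_intD[OF Tc, of a b] by (simp add: set_integrable_def borel_measurable_integrable)
    have "(\<lambda>n. LINT x|lebesgue. ?s n x) \<longlonglongrightarrow> (LINT x|lebesgue. indicat_real {a<..<b} x *\<^sub>R (T x - c))"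
    proof (rule integral_dominated_convergence)
      show "integrable lebesgue (\<lambda>x. norm (indicat_real {a..b} x *\<^sub>R (T x - c)))"
        using loc_intD[OF Tc, of a b] unfolding set_integrable_def by (rule integrable_norm)
      have "set_integrable lebesgue {a<..<b} (\<lambda>x. T x - c)"
        using loc_intD[OF Tc, of a b] by (rule set_integrable_subset) auto
      then show "(\<lambda>x. indicat_real {a<..<b} x *\<^sub>R (T x - c)) \<in> borel_measurable lebesgue"
        by (simp add: set_integrable_def borel_measurable_integrable)
      show "?s n \<in> borel_measurable lebesgue" for n
      proof -
        have "B a b (1 / real (Suc n)) \<in> borel_measurable lebesgue"
          by (intro continuous_measurable_lebesgue smooth_continuous B_smooth) simp
        then have "(\<lambda>x. (indicat_real {a..b} x *\<^sub>R (T x - c)) * B a b (1 / real (Suc n)) x) \<in>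
            borel_measurable lebesgue"
          using meas_T by measurable
        also have "(\<lambda>x. (indicat_real {a..b} x *\<^sub>R (T x - c)) * B a b (1 / real (Suc n)) x) = ?s n"
          by (auto simp: indicator_def B_zero)
        finally show ?thesis .
      qed
      have "(\<lambda>n. ?s n x) \<longlonglongrightarrow> indicat_real {a<..<b} x *\<^sub>R (T x - c)" for x
      proof (cases "x \<in> {a<..<b}")
        case True
        let ?D = "(x - a) * (b - x)"
        have "(\<lambda>n. exp (- (1 / real (Suc n)) / ?D)) \<longlonglongrightarrow> exp (- 0 / ?D)"
          using True by (intro tendsto_intros LIMSEQ_Suc[OF lim_1_over_n]) auto
        then have "(\<lambda>n. (T x - c) * of_real (exp (- (1 / real (Suc n)) / ?D))) \<longlonglongrightarrow> (T x - c) *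
            of_real (exp (- 0 / ?D))"
          by (intro tendsto_mult tendsto_const tendsto_of_real)
        then show ?thesis using True by (simp add: B_def bump_def)
      qed (auto simp: B_def bump_def)
      then show "AE x in lebesgue. (\<lambda>n. ?s n x) \<longlonglongrightarrow> indicat_real {a<..<b} x *\<^sub>R (T x - c)" by simp
      have "norm (B a b (1 / real (Suc n)) x) \<le> indicat_real {a..b} x" for n x
        by (auto simp: B_def bump_def indicator_def norm_mult)
      then have "norm (?s n x) \<le> norm (T x - c) * indicat_real {a..b} x" for n x
        unfolding norm_mult by (rule mult_left_mono) simp
      then show "AE x in lebesgue. norm (?s n x) \<le> norm (indicat_real {a..b} x *\<^sub>R (T x - c))" for n
        by (intro AE_I2) (simp add: mult.commute)
    qed
    then have "(LINT x:{a<..<b}|lebesgue. T x - c) = 0"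
      unfolding s0 set_lebesgue_integral_def by (simp add: LIMSEQ_const_iff)
    \<comment> \<open>The bumps vanish at \<open>a\<close> and \<open>b\<close>, so their limit is
      the indicator of the open interval; the endpoints form a null set.\<close>
    also have "(LINT x:{a<..<b}|lebesgue. T x - c) = (LINT x:{a..b}|lebesgue. T x - c)"
    proof -
      have "set_integrable lebesgue {a<..<b} (\<lambda>x. T x - c)"
        by (rule set_integrable_subset[OF loc_intD[OF Tc, of a b]]) auto
      then have "set_borel_measurable lebesgue {a<..<b} (\<lambda>x. T x - c)"
        by (simp add: set_integrable_def set_borel_measurable_def borel_measurable_integrable)
      moreover have "AE x in lebesgue. x \<noteq> a" "AE x in lebesgue. x \<noteq> b"
        by (auto intro!: AE_completion AE_lborel_singleton)
      then have "AE x in lebesgue. (x \<in> {a..b}) = (x \<in> {a<..<b})" by eventually_elim auto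
      ultimately show ?thesis
        using loc_intD[OF Tc, of a b]
        by (intro set_integral_cong_set) (auto simp: set_integrable_def set_borel_measurable_def)
    qed
    finally show ?thesis .
  qed
  from AE_zero_if_interval_integrals_zero[OF Tc this] show ?thesis by auto
qed

section \<open>Integrals against a signed measure and the product rule\<close>

text \<open>To be instantiated with the two parts of the Jordan decomposition of \<open>V\<close>:
  \<open>sint\<close> is then integration against \<open>V\<close>, and \<open>tv\<close> is
  \<open>|V|\<close>.\<close>

locale measure_pair =
  fixes M N :: "real measure"
  assumes sets_M [measurable_cong, simp]: "sets M = sets borel" and sets_N [measurable_cong,
      simp]: "sets N = sets borel"
    and finite_M: "finite_measure M" and finite_N: "finite_measure N"
begin

definition sint :: "real set \<Rightarrow> (real \<Rightarrow> complex) \<Rightarrow> complex" where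
  "sint A k = (LINT x:A|M. k x) - (LINT x:A|N. k x)"

definition tv :: "real set \<Rightarrow> real" where
  "tv A = measure M A + measure N A"

lemma tv_nonneg [simp]: "0 \<le> tv A" by (simp add: tv_def)

lemma tv_Un: "A \<in> sets borel \<Longrightarrow> B \<in> sets borel \<Longrightarrow> A \<inter> B = {} \<Longrightarrow> tv (A \<union> B) = tv A + tv B"
  using finite_measure.finite_measure_Union[OF finite_M, of A B]
    finite_measure.finite_measure_Union[OF finite_N, of A B] by (simp add: tv_def)

lemma tv_mono: "A \<subseteq> B \<Longrightarrow> B \<in> sets borel \<Longrightarrow> tv A \<le> tv B"
  using finite_measure.finite_measure_mono[OF finite_M, of A B]
    finite_measure.finite_measure_mono[OF finite_N, of A B] by (simp add: tv_def)

text \<open>With half-open intervals an atom at the common endpoint is counted exactly once. Hence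
  the Bolzano arguments can join adjacent intervals.\<close>

lemma tv_combine: "a \<le> b \<Longrightarrow> b \<le> c \<Longrightarrow> tv {a<..c} = tv {a<..b} + tv {b<..c}"
  using tv_Un[of "{a<..b}" "{b<..c}"] by (simp add: ivl_disj_un_two(6))

lemma set_integrable_bounded:
  fixes k :: "real \<Rightarrow> complex"
  assumes "k \<in> borel_measurable borel" "A \<in> sets borel" "\<And>x. x \<in> A \<Longrightarrow> norm (k x) \<le> K"
  shows "set_integrable M A k" "set_integrable N A k"
proof -
  have *: "set_integrable L A k" if [measurable_cong, simp]: "sets L = sets borel" and
      "finite_measure L" for L
    unfolding set_integrable_def
  proof (rule finite_measure.integrable_const_bound[OF \<open>finite_measure L\<close>, of _ "max K 0"])
    show "AE x in L. norm (indicat_real A x *\<^sub>R k x) \<le> max K 0"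
      using assms(3) by (intro AE_I2) (auto simp: indicator_def max.coboundedI1)
    show "(\<lambda>x. indicat_real A x *\<^sub>R k x) \<in> borel_measurable L"
      using assms(1,2) by measurable
  qed
  show "set_integrable M A k" "set_integrable N A k" by (intro * finite_M finite_N sets_M sets_N)+
qed

lemma norm_sint_le:
  assumes "k \<in> borel_measurable borel" "A \<in> sets borel" "\<And>x. x \<in> A \<Longrightarrow> norm (k x) \<le> K"
  shows "norm (sint A k) \<le> K * tv A"
proof -
  have *: "norm (LINT x:A|L. k x) \<le> K * measure L A"
    if [simp]: "sets L = sets borel" and "finite_measure L" and int: "set_integrable L A k" for L
  proof -
    interpret finite_measure L by fact
    have [simp]: "integrable L (indicat_real A)"
      using assms(2) by (intro integrable_real_indicator) (auto simp: less_top[symmetric])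
    have "norm (LINT x:A|L. k x) \<le> (LINT x:A|L. norm (k x))"
      by (rule set_integral_norm_bound[OF int])
    also have "\<dots> \<le> (LINT x:A|L. K)"
      using assms(2,3) int by (intro set_integral_mono set_integrable_norm)
        (auto simp: set_integrable_def)
    also have "\<dots> = K * measure L A"
      using assms(2) by (simp add: set_lebesgue_integral_def)
    finally show ?thesis .
  qed
  have "norm (sint A k) \<le> norm (LINT x:A|M. k x) + norm (LINT x:A|N. k x)"
    unfolding sint_def by (rule norm_triangle_ineq4)
  also have "\<dots> \<le> K * measure M A + K * measure N A"
    by (intro add_mono * finite_M finite_N sets_M sets_N set_integrable_bounded[OF assms(1-3)]) auto
  finally show ?thesis by (simp add: tv_def distrib_left)
qed

lemma sint_combine:
  assumes "k \<in> borel_measurable borel" "\<And>x. x \<in> {a<..c} \<Longrightarrow> norm (k x) \<le> K" "a \<le> b" "b \<le> c"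
  shows "sint {a<..c} k = sint {a<..b} k + sint {b<..c} k"
proof -
  have int: "set_integrable M {a<..b} k" "set_integrable N {a<..b} k"
    "set_integrable M {b<..c} k" "set_integrable N {b<..c} k"
    using assms by (auto intro!: set_integrable_bounded[where K=K])
  have "{a<..c} = {a<..b} \<union> {b<..c}" using assms(3,4) by auto
  then show ?thesis
    using int by (simp add: sint_def set_integral_Un)
qed

lemma sint_cmult: "sint A (\<lambda>x. c * k x) = c * sint A k"
  by (simp add: sint_def right_diff_distrib)

lemma sint_diff:
  assumes "k \<in> borel_measurable borel" "A \<in> sets borel" "\<And>x. x \<in> A \<Longrightarrow> norm (k x) \<le> K"
    and "l \<in> borel_measurable borel" "\<And>x. x \<in> A \<Longrightarrow> norm (l x) \<le> L"
  shows "sint A (\<lambda>x. k x - l x) = sint A k - sint A l"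
  using set_integrable_bounded[OF assms(1-3)] set_integrable_bounded[OF assms(4,2,5)]
  by (simp add: sint_def)

text \<open>Both sides are additive over adjacent intervals. By Bolzano's lemma it therefore
  suffices to compare them on short intervals, up to a small multiple of an additive mass
  \<open>\<nu>\<close> of the interval.\<close> 

lemma product_rule:
  fixes U W U' g k :: "real \<Rightarrow> complex"
  assumes U': "loc_int U'" and U: "\<And>a b. a \<le> b \<Longrightarrow> U b - U a = (LINT x:{a..b}|lebesgue. U' x)"
    and g: "loc_int g" and k: "k \<in> borel_measurable borel" and K: "\<And>x. norm (k x) \<le> K"
    and W: "\<And>a b. a \<le> b \<Longrightarrow> W b - W a = sint {a<..b} k + (LINT x:{a..b}|lebesgue. g x)"
    and W_meas: "W \<in> borel_measurable lebesgue" and "a \<le> b"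
  shows "U b * W b - U a * W a =
    sint {a<..b} (\<lambda>x. U x * k x) + (LINT x:{a..b}|lebesgue. U' x * W x + U x * g x)"
proof -
  have K0: "0 \<le> K" using K[of 0] norm_ge_zero order_trans by blast
  have cU: "continuous_on UNIV U" by (rule continuous_if_interval_integral[OF U' U])
  then have U_meas: "U \<in> borel_measurable borel" by (rule borel_measurable_continuous_onI)
  have Uk_meas: "(\<lambda>x. U x * k x) \<in> borel_measurable borel" using U_meas k by measurable
  note ng = loc_int_norm[OF g] and nU = loc_int_norm[OF U']
  have W_le: "norm (W b - W t) \<le> K * tv {a<..b} + (LINT x:{a..b}|lebesgue. norm (g x))"
    if "a \<le> t" "t \<le> b" for a t b
  proof -
    have "norm (W b - W t) \<le> norm (sint {t<..b} k) + norm (LINT x:{t..b}|lebesgue. g x)"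
      unfolding W[OF that(2)] by (rule norm_triangle_ineq)
    also have "norm (sint {t<..b} k) \<le> K * tv {t<..b}" using k K by (intro norm_sint_le) auto
    also have "\<dots> \<le> K * tv {a<..b}" using that K0 by (intro mult_left_mono tv_mono) auto
    also have "norm (LINT x:{t..b}|lebesgue. g x) \<le> (LINT x:{t..b}|lebesgue. norm (g x))"
      by (rule set_integral_norm_bound[OF loc_intD[OF g]])
    also have "\<dots> \<le> (LINT x:{a..b}|lebesgue. norm (g x))"
      using that by (intro interval_integral_mono_set ng) auto
    finally show ?thesis by simp
  qed
  have W_bdd: "\<exists>B. \<forall>x\<in>{a..b}. norm (W x) \<le> B" for a b
  proof (intro exI ballI)
    fix x assume "x \<in> {a..b}"
    then show "norm (W x) \<le> norm (W b) + (K * tv {a<..b} + (LINT x:{a..b}|lebesgue. norm (g x)))"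
      using W_le[of a x b] norm_triangle_ineq2[of "W x" "W b"] by (simp add: norm_minus_commute)
  qed
  note U_bdd = continuous_bounded_interval[OF cU]
  have UW: "loc_int (\<lambda>x. U' x * W x)" by (rule loc_int_mult_bounded[OF U' W_meas W_bdd])
  have Ug: "loc_int (\<lambda>x. U x * g x)"
    using loc_int_mult_bounded[OF g continuous_measurable_lebesgue[OF cU] U_bdd] by (simp add:
        mult.commute)
  note UWg = loc_int_add[OF UW Ug]
  \<comment> \<open>\<open>R\<close> is the defect of the product rule and \<open>\<nu>\<close> the
    additive mass against which it is measured.\<close>
  define R where "R a b = U b * W b - U a * W a - (sint {a<..b} (\<lambda>x. U x * k x)
      + (LINT x:{a..b}|lebesgue. U' x * W x + U x * g x))" for a b
  define \<nu> where "\<nu> a b = tv {a<..b} + (LINT x:{a..b}|lebesgue. norm (g x))" for a b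
  have Uk_bdd: "\<exists>B. \<forall>x\<in>{a..b}. norm (U x * k x) \<le> B" for a b
  proof -
    obtain B where "\<forall>x\<in>{a..b}. norm (U x) \<le> B" using U_bdd[of a b] by blast
    then show ?thesis
      using K by (intro exI[of _ "B * K"]) (auto simp: norm_mult intro!: mult_mono' )
  qed
  have main: "norm (R a b) \<le> \<eta> * \<nu> a b" if "\<eta> > 0" for \<eta>
    using \<open>a \<le> b\<close>
  proof (induction rule: Bolzano)
    case (trans a b c)
    obtain B where B: "\<forall>x\<in>{a..c}. norm (U x * k x) \<le> B" using Uk_bdd[of a c] by blast
    have "R a c = R a b + R b c"
      unfolding R_def interval_integral_combine[OF UWg trans(3,4)]
      using sint_combine[OF Uk_meas _ trans(3,4), of B] B by simp
    moreover have "\<nu> a c = \<nu> a b + \<nu> b c"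
      unfolding \<nu>_def using interval_integral_combine[OF ng trans(3,4)] tv_combine[OF trans(3,4)]
          by simp
    ultimately show ?case
      using trans(1,2) norm_triangle_ineq[of "R a b" "R b c"] by (simp add: distrib_left)
  next
    case (local x)
    \<comment> \<open>The errors \<open>e1\<close>, \<open>e2\<close>, \<open>e3\<close> below add
      up to \<open>3 * K * \<eta>1\<close> times \<open>tv\<close> plus \<open>3 * \<eta>1\<close>
      times the integral of \<open>|g|\<close>; both coefficients must stay below \<eta>, and
      \<open>K\<close> may be 0.\<close>
    define \<eta>1 where "\<eta>1 = \<eta> / (4 * (K + 1))"
    have \<eta>1: "\<eta>1 > 0" "4 * (K * \<eta>1) \<le> \<eta>" "4 * \<eta>1 \<le> \<eta>"
      using \<open>\<eta> > 0\<close> K0 by (auto simp: \<eta>1_def field_simps)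
    have "isCont U x" using cU continuous_on_eq_continuous_at[OF open_UNIV] by blast
    from this[unfolded continuous_at_eps_delta, rule_format, OF \<eta>1(1)]
    obtain d1 where d1: "d1 > 0" "\<forall>y. dist y x < d1 \<longrightarrow> dist (U y) (U x) < \<eta>1" by blast
    from interval_integral_small[OF nU \<eta>1(1), of x]
    obtain d2 where d2: "d2 > 0"
      "\<forall>a b. a \<le> x \<and> x \<le> b \<and> b - a < d2 \<longrightarrow> norm (LINT y:{a..b}|lebesgue. norm (U' y)) < \<eta>1" by blast
    show ?case
    proof (intro exI[of _ "min d1 d2"] conjI allI impI)
      show "0 < min d1 d2" using d1 d2 by simp
      fix a b assume ab: "a \<le> x \<and> x \<le> b \<and> b - a < min d1 d2"
      then have le: "a \<le> b" by linarith
      have small: "(LINT y:{a..b}|lebesgue. norm (U' y)) \<le> \<eta>1"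
        using d2(2) ab by (smt (verit, best) real_norm_def)
      have osc: "norm (U a - U t) \<le> 2 * \<eta>1" if "t \<in> {a..b}" for t
      proof -
        have "dist (U a) (U x) < \<eta>1" "dist (U t) (U x) < \<eta>1"
          using ab that d1(2)[rule_format, of a] d1(2)[rule_format, of t] by (auto simp:
              dist_real_def)
        then show ?thesis using dist_triangle2[of "U a" "U t" "U x"] by (simp add: dist_norm)
      qed
      obtain B where B: "\<forall>x\<in>{a..b}. norm (U x * k x) \<le> B" using Uk_bdd[of a b] by blast
      have U'Wb: "set_integrable lebesgue {a..b} (\<lambda>t. U' t * W b)"
        using loc_intD[OF U'] by (intro set_integrable_mult_left) auto
      have Uag: "set_integrable lebesgue {a..b} (\<lambda>t. U a * g t)"
        using loc_intD[OF g] by (intro set_integrable_mult_right) auto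
      have 1: "(U b - U a) * W b - (LINT t:{a..b}|lebesgue. U' t * W t)
          = (LINT t:{a..b}|lebesgue. U' t * (W b - W t))"
        using U'Wb loc_intD[OF UW] by (simp add: U[OF le] right_diff_distrib)
      have 2: "U a * sint {a<..b} k - sint {a<..b} (\<lambda>x. U x * k x) = sint {a<..b} (\<lambda>x. (U a - U x)
          * k x)"
        unfolding left_diff_distrib
        using B K borel_measurable_times[OF borel_measurable_const k] by (subst sint_diff[where
            K="norm (U a) * K" and L=B])
          (auto simp: sint_cmult norm_mult Uk_meas k intro!: mult_left_mono)
      have 3: "U a * (LINT t:{a..b}|lebesgue. g t) - (LINT t:{a..b}|lebesgue. U t * g t)
          = (LINT t:{a..b}|lebesgue. (U a - U t) * g t)"
        using Uag loc_intD[OF Ug] by (simp add: left_diff_distrib)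
      \<comment> \<open>\<open>W\<close> is frozen at \<open>b\<close> and \<open>U\<close> at
        \<open>a\<close>. Atoms may make \<open>W\<close> oscillate even on short intervals, but its
        oscillation is controlled by \<nu> and gets multiplied by the small integral of
        \<open>|U'|\<close>; \<open>U\<close> is continuous and nearly constant.\<close>
      have "R a b = ((U b - U a) * W b - (LINT t:{a..b}|lebesgue. U' t * W t))
          + (U a * sint {a<..b} k - sint {a<..b} (\<lambda>x. U x * k x))
          + (U a * (LINT t:{a..b}|lebesgue. g t) - (LINT t:{a..b}|lebesgue. U t * g t))"
      proof -
        have "U b * W b - U a * W a = (U b - U a) * W b + U a * (W b - W a)"
          by (simp add: algebra_simps)
        then show ?thesis
          unfolding R_def W[OF le] using loc_intD[OF UW] loc_intD[OF Ug] by (simp add: distrib_left)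
      qed
      then have R_eq: "R a b = (LINT t:{a..b}|lebesgue. U' t * (W b - W t))
          + sint {a<..b} (\<lambda>x. (U a - U x) * k x) + (LINT t:{a..b}|lebesgue. (U a - U t) * g t)"
        unfolding 1 2 3 .
      have e1: "norm (LINT t:{a..b}|lebesgue. U' t * (W b - W t)) \<le> \<eta>1 * (K * tv {a<..b} + (LINT
          x:{a..b}|lebesgue. norm (g x)))"
        (is "_ \<le> _ * ?D")
      proof -
        have D0: "0 \<le> ?D" using W_le[of a b b] le by simp
        have i: "set_integrable lebesgue {a..b} (\<lambda>t. U' t * (W b - W t))"
          using U'Wb loc_intD[OF UW] by (simp add: right_diff_distrib)
        have "norm (LINT t:{a..b}|lebesgue. U' t * (W b - W t)) \<le> (LINT t:{a..b}|lebesgue. norm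
            (U' t * (W b - W t)))"
          by (rule set_integral_norm_bound[OF i])
        also have "\<dots> \<le> (LINT t:{a..b}|lebesgue. norm (U' t) * ?D)"
        proof (rule set_integral_mono)
          show "set_integrable lebesgue {a..b} (\<lambda>t. norm (U' t * (W b - W t)))" by (rule
              set_integrable_norm[OF i])
          show "set_integrable lebesgue {a..b} (\<lambda>t. norm (U' t) * ?D)"
            using loc_intD[OF nU] by (intro set_integrable_mult_left) auto
          show "norm (U' t * (W b - W t)) \<le> norm (U' t) * ?D" if "t \<in> {a..b}" for t
            using that W_le[of a t b] by (auto simp: norm_mult intro!: mult_left_mono)
        qed
        also have "\<dots> = (LINT t:{a..b}|lebesgue. norm (U' t)) * ?D" by simp
        also have "\<dots> \<le> \<eta>1 * ?D" using small D0 by (intro mult_right_mono)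
        finally show ?thesis .
      qed
      have e2: "norm (sint {a<..b} (\<lambda>x. (U a - U x) * k x)) \<le> (2 * \<eta>1 * K) * tv {a<..b}"
      proof (rule norm_sint_le)
        show "(\<lambda>x. (U a - U x) * k x) \<in> borel_measurable borel" using U_meas k by measurable
        show "norm ((U a - U t) * k t) \<le> 2 * \<eta>1 * K" if "t \<in> {a<..b}" for t
          using osc[of t] K[of t] that \<eta>1(1) unfolding norm_mult by (intro mult_mono) auto
      qed simp
      have e3: "norm (LINT t:{a..b}|lebesgue. (U a - U t) * g t) \<le> 2 * \<eta>1 * (LINT
          x:{a..b}|lebesgue. norm (g x))"
      proof -
        have i: "set_integrable lebesgue {a..b} (\<lambda>t. (U a - U t) * g t)"
          using Uag loc_intD[OF Ug] by (simp add: left_diff_distrib)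
        have "norm (LINT t:{a..b}|lebesgue. (U a - U t) * g t) \<le> (LINT t:{a..b}|lebesgue. norm ((U
            a - U t) * g t))"
          by (rule set_integral_norm_bound[OF i])
        also have "\<dots> \<le> (LINT t:{a..b}|lebesgue. (2 * \<eta>1) * norm (g t))"
        proof (rule set_integral_mono)
          show "set_integrable lebesgue {a..b} (\<lambda>t. norm ((U a - U t) * g t))" by (rule
              set_integrable_norm[OF i])
          show "set_integrable lebesgue {a..b} (\<lambda>t. 2 * \<eta>1 * norm (g t))"
            using loc_intD[OF ng] by (intro set_integrable_mult_right) auto
          show "norm ((U a - U t) * g t) \<le> 2 * \<eta>1 * norm (g t)" if "t \<in> {a..b}" for t
            using osc[OF that] unfolding norm_mult by (intro mult_right_mono) auto
        qed
        finally show ?thesis by simp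
      qed
      let ?G = "LINT x:{a..b}|lebesgue. norm (g x)"
      have G0: "0 \<le> ?G" by (simp add: set_lebesgue_integral_def integral_nonneg_AE)
      have "norm (R a b) \<le> \<eta>1 * (K * tv {a<..b} + ?G) + (2 * \<eta>1 * K) * tv {a<..b} + 2 * \<eta>1 * ?G"
        unfolding R_eq by (intro norm_triangle_le add_mono e1 e2 e3)
      also have "\<dots> = (3 * (K * \<eta>1)) * tv {a<..b} + (3 * \<eta>1) * ?G" by (simp add: algebra_simps)
      also have "\<dots> \<le> \<eta> * tv {a<..b} + \<eta> * ?G"
        using \<eta>1 G0 K0 by (intro add_mono mult_right_mono) auto
      finally show "norm (R a b) \<le> \<eta> * \<nu> a b" by (simp add: \<nu>_def distrib_left)
    qed
  qed
  have nu: "0 \<le> \<nu> a b" by (simp add: \<nu>_def set_lebesgue_integral_def integral_nonneg_AE)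
  have "norm (R a b) \<le> e" if "e > 0" for e
  proof -
    have "norm (R a b) \<le> (e / (\<nu> a b + 1)) * \<nu> a b"
      using nu that by (intro main divide_pos_pos) auto
    also have "\<dots> \<le> e" using nu that by (simp add: field_simps)
    finally show ?thesis .
  qed
  then have "norm (R a b) \<le> 0" by (rule dense_ge)
  then show ?thesis by (simp add: R_def)
qed

end

section \<open>Growth of the energy\<close>

text \<open>The largest eigenvalue \<open>\<mu>\<close> of the quadratic form satisfies \<open>\<mu> + 1/\<mu> = 2 + q\<^sup>2 \<le> e\<^sup>q +
  e\<^sup>-\<^sup>q\<close>.\<close> 

lemma shear_bound:
  fixes a p q :: real
  assumes "0 \<le> q"
  shows "a\<^sup>2 + (p + q * a)\<^sup>2 \<le> exp q * (a\<^sup>2 + p\<^sup>2)"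
proof (cases "q = 0")
  case False
  with assms have q: "q > 0" by simp
  define E where "E = exp q - 1"
  have E: "E > 0" using q by (simp add: E_def)
  let ?h = "exp (q / 2)"
  \<comment> \<open>The inequality \<open>q \<le> 2 * sinh (q / 2)\<close>, squared and multiplied
    by \<open>exp q\<close>, becomes \<open>q\<^sup>2 * (E + 1) \<le> E\<^sup>2\<close>. This is the
    discriminant condition for the quadratic form in \<open>a\<close> and \<open>p\<close>
    below.\<close>
  have "q / 2 \<le> (?h - inverse ?h) / 2" using assms by (intro real_le_x_sinh) simp
  then have "q\<^sup>2 \<le> (?h - inverse ?h)\<^sup>2" using q by (intro power_mono) auto
  then have "q\<^sup>2 * ?h\<^sup>2 \<le> ((?h - inverse ?h) * ?h)\<^sup>2" by (simp add: power_mult_distrib)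
  also have "(?h - inverse ?h) * ?h = E" by (simp add: E_def algebra_simps flip: exp_add)
  also have "?h\<^sup>2 = E + 1" by (simp add: E_def power2_eq_square flip: exp_add)
  finally have *: "0 \<le> E * E - q\<^sup>2 * (E + 1)" by (simp add: power2_eq_square)
  have "E * ((E - q\<^sup>2) * a\<^sup>2 - 2 * q * a * p + E * p\<^sup>2) = (E * p - q * a)\<^sup>2 + (E * E - q\<^sup>2 * (E +
      1)) * a\<^sup>2"
    by (simp add: power2_eq_square algebra_simps)
  also have "\<dots> \<ge> 0" using * by (intro add_nonneg_nonneg mult_nonneg_nonneg) auto
  finally have "0 \<le> (E - q\<^sup>2) * a\<^sup>2 - 2 * q * a * p + E * p\<^sup>2"
    using E by (simp add: zero_le_mult_iff)
  then show ?thesis by (simp add: E_def power2_eq_square algebra_simps)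
qed simp

section \<open>Increments of squared norms and of the energy\<close>

lemma set_integral_Re:
  assumes "set_integrable M A f"
  shows "Re (LINT x:A|M. f x) = (LINT x:A|M. Re (f x))"
  using Bochner_Integration.integral_Re[OF assms[unfolded set_integrable_def]] by (simp add:
      set_lebesgue_integral_def)

lemma set_integral_cnj: "(LINT x:A|M. cnj (f x)) = cnj (LINT x:A|M. f x)"
  using Bochner_Integration.integral_cnj[of M "\<lambda>x. indicat_real A x *\<^sub>R f x"]
  by (simp add: set_lebesgue_integral_def)

lemma interval_integral_nonneg:
  fixes f :: "real \<Rightarrow> real"
  shows "(\<And>x. 0 \<le> f x) \<Longrightarrow> 0 \<le> (LINT x:A|M. f x)"
  by (simp add: set_lebesgue_integral_def integral_nonneg_AE)

context measure_pair begin

text \<open>The product rule for \<open>cnj (w x) * w x\<close> with singular density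
  \<open>k = 0\<close>, reduced to real parts.\<close>

lemma norm_square_increment:
  assumes v: "loc_int v" and w: "\<And>a b. a \<le> b \<Longrightarrow> w b - w a = (LINT x:{a..b}|lebesgue. v x)" and "a \<le>
      b"
  shows "(norm (w b))\<^sup>2 - (norm (w a))\<^sup>2 = (LINT x:{a..b}|lebesgue. 2 * Re (cnj (w x) * v x))"
    and "loc_int (\<lambda>x. cnj (w x) * v x)"
proof -
  have cw: "continuous_on UNIV w" by (rule continuous_if_interval_integral[OF v w])
  have ccw: "continuous_on UNIV (\<lambda>x. cnj (w x))" by (intro continuous_intros cw)
  note bw = continuous_bounded_interval[OF cw]
  have i1: "loc_int (\<lambda>x. cnj (v x) * w x)"
    by (rule loc_int_mult_bounded[OF loc_int_cnj[OF v] continuous_measurable_lebesgue[OF cw] bw])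
  show i2: "loc_int (\<lambda>x. cnj (w x) * v x)"
    using loc_int_cnj[OF i1] by (simp add: mult.commute)
  have "cnj (w b) * w b - cnj (w a) * w a =
    sint {a<..b} (\<lambda>x. cnj (w x) * 0) + (LINT x:{a..b}|lebesgue. cnj (v x) * w x + cnj (w x) * v x)"
  proof (rule product_rule[where K=0])
    show "cnj (w b) - cnj (w a) = (LINT x:{a..b}|lebesgue. cnj (v x))" if "a \<le> b" for a b
      unfolding set_integral_cnj using w[OF that] by (metis complex_cnj_diff)
    show "w b - w a = sint {a<..b} (\<lambda>x. 0) + (LINT x:{a..b}|lebesgue. v x)" if "a \<le> b" for a b
      using w[OF that] by (simp add: sint_def)
  qed (auto simp: v loc_int_cnj continuous_measurable_lebesgue[OF cw] \<open>a \<le> b\<close>)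
  then have "Re (cnj (w b) * w b - cnj (w a) * w a) = (LINT x:{a..b}|lebesgue. Re (cnj (v x) * w x
      + cnj (w x) * v x))"
    using set_integral_Re[OF loc_intD[OF loc_int_add[OF i1 i2]]] by (simp add: sint_def)
  also have "\<dots> = (LINT x:{a..b}|lebesgue. 2 * Re (cnj (w x) * v x))"
    by (intro set_lebesgue_integral_cong) auto
  finally show "(norm (w b))\<^sup>2 - (norm (w a))\<^sup>2 = (LINT x:{a..b}|lebesgue. 2 * Re (cnj (w x) * v
      x))"
    unfolding cmod_power2 by (simp add: power2_eq_square)
qed

text \<open>With \<open>\<eta> * \<nu>\<close> added on the right the estimate is stable under concatenation of
  intervals, so by Bolzano's lemma it needs a proof only on short intervals, where \<open>w\<close> is
  almost constant and the singular part acts as a shear.\<close> 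

lemma energy_growth:
  fixes w p v G :: "real \<Rightarrow> complex" and s :: "real \<Rightarrow> real" and c e :: real
  assumes "0 \<le> c" "0 < e"
    and v: "loc_int v" and w: "\<And>a b. a \<le> b \<Longrightarrow> w b - w a = (LINT x:{a..b}|lebesgue. v x)"
    and G: "loc_int G"
    and p: "\<And>a b. a \<le> b \<Longrightarrow> p b - p a = of_real c * sint {a<..b} w - (LINT x:{a..b}|lebesgue. G x)"
    and p_meas: "p \<in> borel_measurable lebesgue"
    and s: "loc_int s" "\<And>x. 0 \<le> s x"
      "\<And>x. 2 * e\<^sup>2 * Re (cnj (w x) * v x) - 2 * Re (cnj (p x) * G x) \<le> s x"
    and "a \<le> b"
  shows "e\<^sup>2 * (norm (w b))\<^sup>2 + (norm (p b))\<^sup>2 \<le>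
    exp (c / e * tv {a<..b}) * (e\<^sup>2 * (norm (w a))\<^sup>2 + (norm (p a))\<^sup>2 + (LINT x:{a..b}|lebesgue. s
        x))"
proof -
  have cw: "continuous_on UNIV w" by (rule continuous_if_interval_integral[OF v w])
  then have w_meas: "w \<in> borel_measurable borel" by (rule borel_measurable_continuous_onI)
  note bw = continuous_bounded_interval[OF cw]
  note nG = loc_int_norm[OF G]
  define \<Gamma> where "\<Gamma> a b = (LINT x:{a..b}|lebesgue. norm (G x))" for a b
  have \<Gamma>_nonneg: "0 \<le> \<Gamma> a b" for a b unfolding \<Gamma>_def by (intro interval_integral_nonneg) simp
  have \<Gamma>_bound: "norm (LINT x:{a..b}|lebesgue. G x) \<le> \<Gamma> a b" for a b
    unfolding \<Gamma>_def by (rule set_integral_norm_bound[OF loc_intD[OF G]])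
  have p_le: "norm (p b - p t) \<le> c * (B * tv {a<..b}) + \<Gamma> a b"
    if "a \<le> t" "t \<le> b" "\<forall>x\<in>{a..b}. norm (w x) \<le> B" for a t b B
  proof -
    have B0: "0 \<le> B" using that norm_ge_zero[of "w a"] by (meson atLeastAtMost_iff order_refl
        order_trans)
    have "norm (p b - p t) \<le> norm (of_real c * sint {t<..b} w) + norm (LINT x:{t..b}|lebesgue. G x)"
      unfolding p[OF that(2)] by (rule norm_triangle_ineq4)
    also have "norm (of_real c * sint {t<..b} w) = c * norm (sint {t<..b} w)"
      using \<open>0 \<le> c\<close> by (simp add: norm_mult)
    also have "\<dots> \<le> c * (B * tv {t<..b})"
      using that \<open>0 \<le> c\<close> by (intro mult_left_mono norm_sint_le w_meas) auto
    also have "\<dots> \<le> c * (B * tv {a<..b})"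
      using that B0 \<open>0 \<le> c\<close> by (intro mult_left_mono tv_mono) auto
    also have "norm (LINT x:{t..b}|lebesgue. G x) \<le> \<Gamma> t b" by (rule \<Gamma>_bound)
    also have "\<dots> \<le> \<Gamma> a b"
      unfolding \<Gamma>_def using that by (intro interval_integral_mono_set nG) auto
    finally show ?thesis by simp
  qed
  have bp: "\<exists>B. \<forall>x\<in>{a..b}. norm (p x) \<le> B" for a b
  proof -
    obtain B where B: "\<forall>x\<in>{a..b}. norm (w x) \<le> B" using bw[of a b] by blast
    show ?thesis
    proof (intro exI ballI)
      fix x assume "x \<in> {a..b}"
      then show "norm (p x) \<le> norm (p b) + (c * (B * tv {a<..b}) + \<Gamma> a b)"
        using p_le[of a x b B] B norm_triangle_ineq2[of "p x" "p b"] by (simp add: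
            norm_minus_commute)
    qed
  qed
  have pG: "loc_int (\<lambda>x. cnj (p x) * G x)"
  proof -
    have "loc_int (\<lambda>x. cnj (G x) * p x)" by (rule loc_int_mult_bounded[OF loc_int_cnj[OF G] p_meas
        bp])
    from loc_int_cnj[OF this] show ?thesis by (simp add: mult.commute)
  qed
  note wv = norm_square_increment(2)[OF v w \<open>a \<le> b\<close>]
  define F where "F x = e\<^sup>2 * (norm (w x))\<^sup>2 + (norm (p x))\<^sup>2" for x
  define q where "q a b = c / e * tv {a<..b}" for a b
  define S where "S a b = (LINT x:{a..b}|lebesgue. s x)" for a b
  define \<nu> where "\<nu> a b = tv {a<..b} + \<Gamma> a b" for a b
  define T where "T = tv UNIV"
  have T: "tv {a<..b} \<le> T" for a b unfolding T_def by (intro tv_mono) auto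
  have q_nonneg: "0 \<le> q a b" for a b using assms(1,2) by (simp add: q_def)
  have S_nonneg: "0 \<le> S a b" for a b unfolding S_def by (intro interval_integral_nonneg s)
  have \<nu>_nonneg: "0 \<le> \<nu> a b" for a b using \<Gamma>_nonneg by (simp add: \<nu>_def)
  have main: "F b \<le> exp (q a b) * (F a + S a b + \<eta> * \<nu> a b)" if "\<eta> > 0" for \<eta>
    using \<open>a \<le> b\<close>
  proof (induction rule: Bolzano)
    case (trans a b c')
    have add: "q a c' = q a b + q b c'" "S a c' = S a b + S b c'" "\<nu> a c' = \<nu> a b + \<nu> b c'"
      unfolding q_def S_def \<nu>_def \<Gamma>_def
      using interval_integral_combine[OF nG trans(3,4)] interval_integral_combine[OF s(1)
          trans(3,4)]
        tv_combine[OF trans(3,4)] by (simp_all add: distrib_left)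
    have "F c' \<le> exp (q b c') * (F b + (S b c' + \<eta> * \<nu> b c'))" using trans(2) by (simp add:
        add.assoc)
    also have "\<dots> \<le> exp (q b c') * (exp (q a b) * (F a + S a b + \<eta> * \<nu> a b) + exp (q a b) * (S b c'
        + \<eta> * \<nu> b c'))"
    proof (intro mult_left_mono add_mono trans(1))
      have "0 \<le> S b c' + \<eta> * \<nu> b c'" using S_nonneg \<nu>_nonneg that by simp
      then show "S b c' + \<eta> * \<nu> b c' \<le> exp (q a b) * (S b c' + \<eta> * \<nu> b c')"
        using q_nonneg[of a b] by (simp add: mult_le_cancel_right1)
    qed simp
    also have "\<dots> = exp (q a c') * (F a + S a c' + \<eta> * \<nu> a c')"
      by (simp add: add exp_add algebra_simps)
    finally show ?case .
  next
    case (local x)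
    obtain Bw where Bw: "\<forall>t\<in>{x-1..x+1}. norm (w t) \<le> Bw" using bw by blast
    obtain Bp where Bp: "\<forall>t\<in>{x-1..x+1}. norm (p t) \<le> Bp" using bp by blast
    have Bw0: "0 \<le> Bw" using Bw[rule_format, of x] order_trans[OF norm_ge_zero[of "w x"]] by simp
    have Bp0: "0 \<le> Bp" using Bp[rule_format, of x] order_trans[OF norm_ge_zero[of "p x"]] by simp
    have T0: "0 \<le> T" by (simp add: T_def)
    \<comment> \<open>\<open>C\<close> bounds the coefficient of \<open>\<tau> * \<omega>\<close> in
      the expansion of \<open>(P + q a b * A + c * \<omega> * \<tau>)\<^sup>2\<close>, where
      \<omega> is the oscillation of \<open>w\<close>. The choice of \<omega> brings this error
      below \<open>\<eta> / 2 * \<tau>\<close>.\<close>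
    define C where "C = 2 * (Bp + c * T * Bw) * c + c\<^sup>2 * T"
    have C0: "0 \<le> C" using Bw0 Bp0 T0 \<open>0 \<le> c\<close> by (simp add: C_def)
    define \<omega> where "\<omega> = min 1 (\<eta> / (2 * (C + 1)))"
    have \<omega>: "0 < \<omega>" "\<omega> \<le> 1" "C * \<omega> \<le> \<eta> / 2"
    proof -
      have "C * \<omega> \<le> C * (\<eta> / (2 * (C + 1)))" using C0 by (intro mult_left_mono) (auto simp: \<omega>_def)
      also have "\<dots> \<le> \<eta> / 2" using C0 that by (simp add: field_simps)
      finally show "C * \<omega> \<le> \<eta> / 2" .
    qed (use C0 that in \<open>auto simp: \<omega>_def\<close>)
    \<comment> \<open>With \<open>g \<le> \<kappa>\<close> the quadratic error
      \<open>2 * (c * Bw) * g * \<tau> + 5 * g\<^sup>2\<close> at the end is at most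
      \<open>\<eta> / 2 * \<tau> + \<eta> * g\<close>.\<close>
    define \<kappa> where "\<kappa> = \<eta> / (4 * (c * Bw) + 5)"
    have D0: "0 \<le> c * Bw" using Bw0 \<open>0 \<le> c\<close> by simp
    have \<kappa>: "0 < \<kappa>" "2 * (c * Bw) * \<kappa> \<le> \<eta> / 2" "5 * \<kappa> \<le> \<eta>"
    proof -
      show "2 * (c * Bw) * \<kappa> \<le> \<eta> / 2"
        using D0 that mult_nonneg_nonneg[OF D0 less_imp_le[OF that]]
        by (simp add: \<kappa>_def pos_divide_le_eq algebra_simps)
      show "5 * \<kappa> \<le> \<eta>"
        using D0 that mult_nonneg_nonneg[OF D0 less_imp_le[OF that]]
        by (simp add: \<kappa>_def pos_divide_le_eq algebra_simps)
    qed (use D0 that in \<open>simp add: \<kappa>_def\<close>)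
    have "isCont w x" using cw continuous_on_eq_continuous_at[OF open_UNIV] by blast
    from this[unfolded continuous_at_eps_delta, rule_format, OF half_gt_zero[OF \<omega>(1)]]
    obtain d1 where d1: "d1 > 0" "\<forall>y. dist y x < d1 \<longrightarrow> dist (w y) (w x) < \<omega> / 2" by blast
    from interval_integral_small[OF nG \<kappa>(1), of x]
    obtain d2 where d2: "d2 > 0"
      "\<forall>a b. a \<le> x \<and> x \<le> b \<and> b - a < d2 \<longrightarrow> norm (LINT y:{a..b}|lebesgue. norm (G y)) < \<kappa>" by blast
    show ?case
    proof (intro exI[of _ "min 1 (min d1 d2)"] conjI allI impI)
      show "0 < min 1 (min d1 d2)" using d1 d2 by simp
      fix a b assume ab: "a \<le> x \<and> x \<le> b \<and> b - a < min 1 (min d1 d2)"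
      then have le: "a \<le> b" by linarith
      define \<tau> where "\<tau> = tv {a<..b}"
      define g where "g = \<Gamma> a b"
      have \<tau>: "0 \<le> \<tau>" "\<tau> \<le> T" using T by (auto simp: \<tau>_def)
      have g: "0 \<le> g" "g \<le> \<kappa>"
        using d2(2)[rule_format, of a b] ab \<Gamma>_nonneg[of a b] by (auto simp: g_def \<Gamma>_def)
      have Bw': "\<forall>t\<in>{a..b}. norm (w t) \<le> Bw" using ab Bw by auto
      have osc: "norm (w t) \<le> norm (w a) + \<omega>" if "t \<in> {a..b}" for t
      proof -
        have "dist (w a) (w x) < \<omega> / 2" "dist (w t) (w x) < \<omega> / 2"
          using ab that d1(2)[rule_format, of a] d1(2)[rule_format, of t] by (auto simp:
              dist_real_def)
        then have "dist (w a) (w t) < \<omega>" by (rule dist_triangle_half_l)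
        then show ?thesis using norm_triangle_ineq2[of "w t" "w a"] by (simp add: dist_norm
            norm_minus_commute)
      qed
      \<comment> \<open>The increment of \<open>p\<close> splits into the action \<Delta> of the
        measure, which need not be small, and the small regular part \<open>J\<close>.\<close>
      define \<Delta> where "\<Delta> = of_real c * sint {a<..b} w"
      define J where "J = (LINT x:{a..b}|lebesgue. G x)"
      have p_b: "p b = p a + \<Delta> - J" using p[OF le] by (simp add: \<Delta>_def J_def algebra_simps)
      have J_le: "norm J \<le> g" unfolding J_def g_def by (rule \<Gamma>_bound)
      have "norm (sint {a<..b} w) \<le> (norm (w a) + \<omega>) * \<tau>"
        unfolding \<tau>_def using osc by (intro norm_sint_le w_meas) auto
      then have \<Delta>_le: "norm \<Delta> \<le> c * ((norm (w a) + \<omega>) * \<tau>)"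
        using \<open>0 \<le> c\<close> by (simp add: \<Delta>_def norm_mult mult_left_mono)
      have wa: "norm (w a) \<le> Bw" "norm (p a) \<le> Bp" using ab Bw Bp by auto
      \<comment> \<open>Up to the oscillation of \<open>w\<close>, the measure changes
        \<open>norm (p a)\<close> by at most \<open>c * norm (w a) * \<tau> = q a b * A\<close>. In
        the variables \<open>A\<close> and \<open>P\<close> this is exactly the shear of
        \<open>shear_bound\<close>.\<close>
      have jump: "e\<^sup>2 * (norm (w a))\<^sup>2 + (norm (p a + \<Delta>))\<^sup>2 \<le> exp (q a b) * F a + \<eta> / 2 * \<tau>"
      proof -
        define A where "A = e * norm (w a)"
        define P where "P = norm (p a)"
        have qA: "q a b * A = c * norm (w a) * \<tau>" using \<open>0 < e\<close> by (simp add: q_def A_def \<tau>_def)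
        have qA_le: "q a b * A \<le> c * T * Bw"
          unfolding qA using wa \<tau> \<open>0 \<le> c\<close> Bw0 by (simp add: mult.assoc mult.commute[of T]
              mult_left_mono mult_mono)
        have A0: "0 \<le> A" "0 \<le> P" "0 \<le> q a b * A" using \<open>0 < e\<close> q_nonneg by (auto simp: A_def P_def)
        have "norm (p a + \<Delta>) \<le> P + q a b * A + c * \<omega> * \<tau>"
          using norm_triangle_ineq[of "p a" \<Delta>] \<Delta>_le unfolding qA P_def by (simp add: algebra_simps)
        then have "(norm (p a + \<Delta>))\<^sup>2 \<le> (P + q a b * A + c * \<omega> * \<tau>)\<^sup>2" by (intro power_mono) auto
        also have "\<dots> = (P + q a b * A)\<^sup>2 + \<tau> * \<omega> * (2 * (P + q a b * A) * c + c\<^sup>2 * (\<omega> * \<tau>))"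
          by (simp add: power2_eq_square algebra_simps)
        also have "\<dots> \<le> (P + q a b * A)\<^sup>2 + \<tau> * \<omega> * C"
        proof -
          have "\<omega> * \<tau> \<le> 1 * T" using \<omega> \<tau> by (intro mult_mono) auto
          then have "2 * (P + q a b * A) * c + c\<^sup>2 * (\<omega> * \<tau>) \<le> C"
            unfolding C_def using wa qA_le \<open>0 \<le> c\<close> by (intro add_mono mult_right_mono
                mult_left_mono) (auto simp: P_def)
          then show ?thesis using \<tau> \<omega> by (intro add_left_mono mult_left_mono) auto
        qed
        also have "\<tau> * \<omega> * C \<le> \<eta> / 2 * \<tau>"
          using mult_right_mono[OF \<omega>(3) \<tau>(1)] by (simp add: mult_ac)
        finally have "A\<^sup>2 + (norm (p a + \<Delta>))\<^sup>2 \<le> (A\<^sup>2 + (P + q a b * A)\<^sup>2) + \<eta> / 2 * \<tau>" by simp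
        also have "A\<^sup>2 + (P + q a b * A)\<^sup>2 \<le> exp (q a b) * (A\<^sup>2 + P\<^sup>2)"
          by (rule shear_bound[OF q_nonneg])
        finally show ?thesis by (simp add: A_def P_def F_def power_mult_distrib)
      qed
      have cross: "- 2 * Re (cnj (p a + \<Delta>) * J) \<le> - 2 * (LINT t:{a..b}|lebesgue. Re (cnj (p t) * G
          t))
          + 2 * (c * (Bw * \<tau>) + 2 * g) * g"
      proof -
        have i1: "set_integrable lebesgue {a..b} (\<lambda>t. cnj (p a + \<Delta>) * G t)"
          using loc_intD[OF G] by (intro set_integrable_mult_right) auto
        have i2: "set_integrable lebesgue {a..b} (\<lambda>t. (cnj (p a + \<Delta>) - cnj (p t)) * G t)"
          using i1 loc_intD[OF pG] by (simp add: left_diff_distrib)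
        have "cnj (p a + \<Delta>) * J - (LINT t:{a..b}|lebesgue. cnj (p t) * G t)
          = (LINT t:{a..b}|lebesgue. (cnj (p a + \<Delta>) - cnj (p t)) * G t)"
          unfolding left_diff_distrib J_def using i1 loc_intD[OF pG] by simp
        also have "norm \<dots> \<le> (LINT t:{a..b}|lebesgue. norm ((cnj (p a + \<Delta>) - cnj (p t)) * G t))"
          by (rule set_integral_norm_bound[OF i2])
        also have "\<dots> \<le> (LINT t:{a..b}|lebesgue. (c * (Bw * \<tau>) + 2 * g) * norm (G t))"
        proof (rule set_integral_mono)
          show "set_integrable lebesgue {a..b} (\<lambda>t. norm ((cnj (p a + \<Delta>) - cnj (p t)) * G t))"
            by (rule set_integrable_norm[OF i2])
          show "set_integrable lebesgue {a..b} (\<lambda>t. (c * (Bw * \<tau>) + 2 * g) * norm (G t))"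
            using loc_intD[OF nG] by (intro set_integrable_mult_right) auto
          fix t assume t: "t \<in> {a..b}"
          have "norm (p a + \<Delta> - p t) = norm ((p b - p t) + J)" by (simp add: p_b algebra_simps)
          also have "\<dots> \<le> norm (p b - p t) + norm J" by (rule norm_triangle_ineq)
          also have "\<dots> \<le> (c * (Bw * \<tau>) + g) + g"
            using p_le[of a t b Bw] t Bw' J_le by (intro add_mono) (auto simp: \<tau>_def g_def)
          finally have "norm (cnj (p a + \<Delta>) - cnj (p t)) \<le> c * (Bw * \<tau>) + 2 * g"
            by (metis complex_cnj_diff complex_mod_cnj mult_2 add.assoc)
          then show "norm ((cnj (p a + \<Delta>) - cnj (p t)) * G t) \<le> (c * (Bw * \<tau>) + 2 * g) * norm (G t)"
            unfolding norm_mult by (intro mult_right_mono) auto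
        qed
        also have "\<dots> = (c * (Bw * \<tau>) + 2 * g) * g" by (simp add: g_def \<Gamma>_def)
        finally have "norm (cnj (p a + \<Delta>) * J - (LINT t:{a..b}|lebesgue. cnj (p t) * G t)) \<le> (c *
            (Bw * \<tau>) + 2 * g) * g" .
        from order_trans[OF abs_Re_le_cmod this] show ?thesis
          unfolding minus_complex.sel set_integral_Re[OF loc_intD[OF pG], symmetric] by linarith
      qed
      have w_b: "e\<^sup>2 * (norm (w b))\<^sup>2 = e\<^sup>2 * (norm (w a))\<^sup>2 + (LINT t:{a..b}|lebesgue. 2 * e\<^sup>2 *
          Re (cnj (w t) * v t))"
      proof -
        have "(norm (w b))\<^sup>2 = (norm (w a))\<^sup>2 + (LINT t:{a..b}|lebesgue. 2 * Re (cnj (w t) * v t))"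
          using norm_square_increment(1)[OF v w le] by simp
        moreover have "e\<^sup>2 * (LINT t:{a..b}|lebesgue. 2 * Re (cnj (w t) * v t))
            = (LINT t:{a..b}|lebesgue. 2 * e\<^sup>2 * Re (cnj (w t) * v t))"
          unfolding set_integral_mult_right[symmetric] by (simp only: mult_ac)
        ultimately show ?thesis by (simp only: distrib_left)
      qed
      have S_le: "(LINT t:{a..b}|lebesgue. 2 * e\<^sup>2 * Re (cnj (w t) * v t)) - 2 * (LINT
          t:{a..b}|lebesgue. Re (cnj (p t) * G t)) \<le> S a b"
      proof -
        have i: "set_integrable lebesgue {a..b} (\<lambda>t. 2 * e\<^sup>2 * Re (cnj (w t) * v t))"
          "set_integrable lebesgue {a..b} (\<lambda>t. 2 * Re (cnj (p t) * G t))"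
          using loc_intD[OF loc_int_Re[OF wv]] loc_intD[OF loc_int_Re[OF pG]]
          by (intro set_integrable_mult_right; simp)+
        have "(LINT t:{a..b}|lebesgue. 2 * e\<^sup>2 * Re (cnj (w t) * v t)) - 2 * (LINT
            t:{a..b}|lebesgue. Re (cnj (p t) * G t))
           = (LINT t:{a..b}|lebesgue. 2 * e\<^sup>2 * Re (cnj (w t) * v t) - 2 * Re (cnj (p t) * G t))"
          by (simp only: set_integral_diff(2)[OF i] set_integral_mult_right)
        also have "\<dots> \<le> S a b"
          unfolding S_def by (intro set_integral_mono set_integral_diff(1)[OF i] loc_intD[OF s(1)]
              s(3))
        finally show ?thesis .
      qed
      have "(norm (p b))\<^sup>2 = (norm (p a + \<Delta>))\<^sup>2 - 2 * Re (cnj (p a + \<Delta>) * J) + (norm J)\<^sup>2"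
        unfolding p_b cmod_power2 by (simp add: power2_eq_square algebra_simps)
      moreover have "(norm J)\<^sup>2 \<le> g\<^sup>2" using J_le by (intro power_mono) auto
      ultimately have "F b \<le> exp (q a b) * F a + \<eta> / 2 * \<tau> + S a b + 2 * (c * (Bw * \<tau>) + 2 * g) *
          g + g\<^sup>2"
        using jump cross w_b S_le unfolding F_def by linarith
      moreover have "2 * (c * (Bw * \<tau>) + 2 * g) * g + g\<^sup>2 = (2 * (c * Bw) * g) * \<tau> + 5 * g * g"
        by (simp add: power2_eq_square algebra_simps)
      moreover have "(2 * (c * Bw) * g) * \<tau> + 5 * g * g \<le> \<eta> / 2 * \<tau> + \<eta> * g"
      proof (intro add_mono mult_right_mono \<tau> g)
        show "2 * (c * Bw) * g \<le> \<eta> / 2" using mult_left_mono[OF g(2), of "2 * (c * Bw)"] D0 \<kappa>(2)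
            by linarith
        show "5 * g \<le> \<eta>" using g(2) \<kappa>(3) by linarith
      qed
      moreover have "\<eta> * \<nu> a b = \<eta> / 2 * \<tau> + \<eta> / 2 * \<tau> + \<eta> * g"
        by (simp add: \<nu>_def \<tau>_def g_def distrib_left)
      ultimately have "F b \<le> exp (q a b) * F a + (S a b + \<eta> * \<nu> a b)"
        by linarith
      moreover have "S a b + \<eta> * \<nu> a b \<le> exp (q a b) * (S a b + \<eta> * \<nu> a b)"
      proof -
        have "0 \<le> S a b + \<eta> * \<nu> a b" using S_nonneg \<nu>_nonneg that by simp
        then show ?thesis using q_nonneg[of a b] by (simp add: mult_le_cancel_right1)
      qed
      ultimately show "F b \<le> exp (q a b) * (F a + S a b + \<eta> * \<nu> a b)"
        by (simp add: distrib_left)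
    qed
  qed
  define X where "X = exp (q a b) * \<nu> a b"
  have X0: "0 \<le> X" using \<nu>_nonneg by (simp add: X_def)
  have "F b \<le> exp (q a b) * (F a + S a b) + \<epsilon>" if "\<epsilon> > 0" for \<epsilon>
  proof -
    have "F b \<le> exp (q a b) * (F a + S a b + (\<epsilon> / (X + 1)) * \<nu> a b)"
      using X0 that by (intro main divide_pos_pos) auto
    also have "\<dots> = exp (q a b) * (F a + S a b) + \<epsilon> / (X + 1) * X" by (simp add: X_def algebra_simps)
    also have "\<epsilon> / (X + 1) * X \<le> \<epsilon>" using X0 that by (simp add: field_simps)
    finally show ?thesis by simp
  qed
  then have "F b \<le> exp (q a b) * (F a + S a b)" by (rule field_le_epsilon)
  then show ?thesis by (simp add: F_def q_def S_def)
qed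

end

section \<open>Representatives of weak derivatives\<close>

lemma L2_measurable: "f \<in> L2 \<Longrightarrow> f \<in> borel_measurable lebesgue"
  and L2_integrable: "f \<in> L2 \<Longrightarrow> integrable lebesgue (\<lambda>x. (norm (f x))\<^sup>2)"
  by (auto simp: L2_def)

lemma integrable_mult_L2:
  fixes f g :: "'a \<Rightarrow> real"
  assumes [measurable]: "f \<in> borel_measurable M" "g \<in> borel_measurable M"
    and "integrable M (\<lambda>x. (f x)\<^sup>2)" "integrable M (\<lambda>x. (g x)\<^sup>2)"
  shows "integrable M (\<lambda>x. f x * g x)"
proof (rule Bochner_Integration.integrable_bound)
  show "integrable M (\<lambda>x. (f x)\<^sup>2 + (g x)\<^sup>2)" using assms by simp
  have "\<bar>f x * g x\<bar> \<le> (f x)\<^sup>2 + (g x)\<^sup>2" for x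
  proof -
    have "2 * \<bar>f x\<bar> * \<bar>g x\<bar> \<le> (f x)\<^sup>2 + (g x)\<^sup>2" using sum_squares_bound[of "\<bar>f x\<bar>" "\<bar>g x\<bar>"] by simp
    moreover have "0 \<le> \<bar>f x\<bar> * \<bar>g x\<bar>" by simp
    ultimately show ?thesis unfolding abs_mult by linarith
  qed
  then show "AE x in M. norm (f x * g x) \<le> norm ((f x)\<^sup>2 + (g x)\<^sup>2)" by (intro AE_I2) simp
qed measurable

lemma Cauchy_Schwarz_integral:
  fixes f g :: "'a \<Rightarrow> real"
  assumes "f \<in> borel_measurable M" "g \<in> borel_measurable M"
    and f: "integrable M (\<lambda>x. (f x)\<^sup>2)" and g: "integrable M (\<lambda>x. (g x)\<^sup>2)"
  shows "(LINT x|M. f x * g x)\<^sup>2 \<le> (LINT x|M. (f x)\<^sup>2) * (LINT x|M. (g x)\<^sup>2)"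
proof -
  let ?a = "LINT x|M. (f x)\<^sup>2" and ?b = "LINT x|M. f x * g x" and ?c = "LINT x|M. (g x)\<^sup>2"
  note fg = integrable_mult_L2[OF assms]
  have q: "0 \<le> t\<^sup>2 * ?a - 2 * t * ?b + ?c" for t
  proof -
    have "0 \<le> (LINT x|M. (t * f x - g x)\<^sup>2)" by simp
    also have "\<dots> = (LINT x|M. t\<^sup>2 * (f x)\<^sup>2 - 2 * t * (f x * g x) + (g x)\<^sup>2)"
      by (intro Bochner_Integration.integral_cong) (auto simp: power2_eq_square algebra_simps)
    also have "\<dots> = t\<^sup>2 * ?a - 2 * t * ?b + ?c" using f g fg by simp
    finally show ?thesis .
  qed
  have a0: "0 \<le> ?a" by simp
  show ?thesis
  proof (cases "?a = 0")
    case True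
    have "?b = 0"
    proof (rule ccontr)
      assume b: "?b \<noteq> 0"
      \<comment> \<open>With \<open>?a = 0\<close> the expression in \<open>q\<close> is affine in
        \<open>t\<close>; at this \<open>t\<close> it would equal \<open>- 1\<close>.\<close>
      have "2 * ((?c + 1) / (2 * ?b)) * ?b = ?c + 1" using b by (simp add: field_simps)
      then show False using q[of "(?c + 1) / (2 * ?b)"] True by simp
    qed
    then show ?thesis using True by simp
  next
    case False
    with a0 have a: "?a > 0" by (metis less_le)
    have "0 \<le> ((?b / ?a)\<^sup>2 * ?a - 2 * (?b / ?a) * ?b + ?c) * ?a"
      using q[of "?b / ?a"] a by (intro mult_nonneg_nonneg) auto
    also have "\<dots> = ?a * ?c - ?b\<^sup>2" using a by (simp add: power2_eq_square field_simps)
    finally show ?thesis by simp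
  qed
qed

lemma L2_loc_int:
  assumes "f \<in> L2"
  shows "loc_int f"
  unfolding loc_int_def set_integrable_def
proof (intro allI)
  fix a b :: real
  have [measurable]: "f \<in> borel_measurable lebesgue" using assms by (rule L2_measurable)
  have "integrable lebesgue (indicat_real {a..b})"
    using loc_intD[OF loc_int_continuous[of "\<lambda>_. 1 :: real"], of a b] by (simp add:
        set_integrable_def)
  then have *: "integrable lebesgue (\<lambda>x. indicat_real {a..b} x + (norm (f x))\<^sup>2)"
    using L2_integrable[OF assms] by (rule Bochner_Integration.integrable_add)
  show "integrable lebesgue (\<lambda>x. indicat_real {a..b} x *\<^sub>R f x)"
  proof (rule Bochner_Integration.integrable_bound[OF *])
    have "norm (indicat_real {a..b} x *\<^sub>R f x) \<le> indicat_real {a..b} x + (norm (f x))\<^sup>2" for x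
    proof (cases "x \<in> {a..b}")
      case True
      have "0 \<le> (norm (f x) - 1)\<^sup>2" by simp
      then have "2 * norm (f x) \<le> 1 + (norm (f x))\<^sup>2" by (simp add: power2_eq_square algebra_simps)
      then have "norm (f x) \<le> 1 + (norm (f x))\<^sup>2" using norm_ge_zero[of "f x"] by linarith
      then show ?thesis using True by simp
    qed simp
    then show "AE x in lebesgue. norm (indicat_real {a..b} x *\<^sub>R f x)
        \<le> norm (indicat_real {a..b} x + (norm (f x))\<^sup>2)" by (intro AE_I2) simp
    show "(\<lambda>x. indicat_real {a..b} x *\<^sub>R f x) \<in> borel_measurable lebesgue"
      by (intro borel_measurable_scaleR borel_measurable_indicator L2_measurable assms) simp
  qed
qed

lemma L2_lincomb:
  assumes "f \<in> L2" "g \<in> L2"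
  shows "(\<lambda>x. c * f x + d * g x) \<in> L2"
proof -
  have m [measurable]: "f \<in> borel_measurable lebesgue" "g \<in> borel_measurable lebesgue"
    using assms by (auto intro: L2_measurable)
  have "integrable lebesgue (\<lambda>x. (norm (c * f x + d * g x))\<^sup>2)"
  proof (rule Bochner_Integration.integrable_bound)
    show "integrable lebesgue (\<lambda>x. 2 * (norm c)\<^sup>2 * (norm (f x))\<^sup>2 + 2 * (norm d)\<^sup>2 * (norm (g
        x))\<^sup>2)"
      using assms[THEN L2_integrable] by simp
    have "(norm (c * f x + d * g x))\<^sup>2 \<le> 2 * (norm c)\<^sup>2 * (norm (f x))\<^sup>2 + 2 * (norm d)\<^sup>2 * (norm
        (g x))\<^sup>2" for x
    proof -
      have "(norm (c * f x + d * g x))\<^sup>2 \<le> (norm c * norm (f x) + norm d * norm (g x))\<^sup>2"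
        using norm_triangle_ineq[of "c * f x" "d * g x"] by (intro power_mono) (auto simp:
            norm_mult)
      also have "\<dots> \<le> 2 * (norm c * norm (f x))\<^sup>2 + 2 * (norm d * norm (g x))\<^sup>2"
        using sum_squares_bound[of "norm c * norm (f x)" "norm d * norm (g x)"]
        by (simp add: power2_sum)
      finally show ?thesis by (simp add: power_mult_distrib)
    qed
    then show "AE x in lebesgue. norm ((norm (c * f x + d * g x))\<^sup>2)
        \<le> norm (2 * (norm c)\<^sup>2 * (norm (f x))\<^sup>2 + 2 * (norm d)\<^sup>2 * (norm (g x))\<^sup>2)" by (intro
            AE_I2) simp
  qed measurable
  then show ?thesis by (simp add: L2_def)
qed

lemma L2_cong_AE:
  assumes "f \<in> L2" "AE x in lebesgue. f x = g x" "g \<in> borel_measurable lebesgue"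
  shows "g \<in> L2"
proof -
  have [measurable]: "f \<in> borel_measurable lebesgue" "g \<in> borel_measurable lebesgue"
    using assms by (auto intro: L2_measurable)
  have "AE x in lebesgue. (norm (f x))\<^sup>2 = (norm (g x))\<^sup>2"
    using assms(2) by eventually_elim simp
  moreover have "(\<lambda>x. (norm (f x))\<^sup>2) \<in> borel_measurable lebesgue" "(\<lambda>x. (norm (g x))\<^sup>2) \<in>
      borel_measurable lebesgue"
    by measurable
  ultimately have "integrable lebesgue (\<lambda>x. (norm (g x))\<^sup>2)"
    using L2_integrable[OF assms(1)] integrable_cong_AE by metis
  then show ?thesis using assms(3) by (simp add: L2_def)
qed

text \<open>A closed set of full measure is the whole line. This is the uniqueness behind
  \<open>cont_rep\<close>.\<close>

lemma continuous_AE_eq: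
  fixes f g :: "real \<Rightarrow> 'a::t2_space"
  assumes "continuous_on UNIV f" "continuous_on UNIV g" "AE x in lebesgue. f x = g x"
  shows "f = g"
proof
  fix x
  have "closed {x. f x = g x}" using assms(1,2) by (rule closed_Collect_eq)
  from mem_closed_if_AE_lebesgue[OF this, of x] assms(3) show "f x = g x" by simp
qed

lemma test_function_vderiv_zero:
  assumes "\<And>x. x \<notin> {a<..<b} \<Longrightarrow> \<phi> x = 0" "x \<notin> {a..b}"
  shows "vderiv \<phi> x = 0"
proof -
  have "((\<lambda>_. 0) has_vector_derivative 0) (at x)" by simp
  then have "(\<phi> has_vector_derivative 0) (at x)"
    by (rule has_vector_derivative_transform_within_open[where S="- {a..b}"]) (use assms in auto)
  then show ?thesis by (simp add: vderiv_def vector_derivative_at)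
qed

text \<open>Allows the weak derivative of \<open>u\<close> to be tested against
  \<open>vderiv \<phi>\<close>, which turns the second derivative in \<open>P\<close> into a first
  derivative of \<open>u'\<close>.\<close>

lemma vderiv_test_function: "\<phi> \<in> test_functions \<Longrightarrow> vderiv \<phi> \<in> test_functions"
proof -
  assume \<phi>: "\<phi> \<in> test_functions"
  obtain a b where ab: "\<forall>x. x \<notin> {a<..<b} \<longrightarrow> \<phi> x = 0" using test_functionsD(2)[OF \<phi>] by blast
  show ?thesis
    by (rule test_functionsI[of _ a b])
      (use test_function_vderiv_zero[of a b \<phi>] ab smooth_vderiv[OF test_functionsD(1)[OF \<phi>]] in
          auto)
qed

context measure_pair begin

lemma cumulative_measurable:
  assumes k: "k \<in> borel_measurable borel"
  shows "(\<lambda>x. sint {..x} k) \<in> borel_measurable borel"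
proof -
  have *: "(\<lambda>x. LINT y:{..x}|L. k y) \<in> borel_measurable borel"
    if sets: "sets L = sets borel" and "finite_measure L" for L :: "real measure"
  proof -
    interpret finite_measure L by fact
    note [measurable_cong] = sets
    note [measurable] = k
    have "(\<lambda>x. LINT y|L. (if y \<le> x then k y else 0)) \<in> borel_measurable borel"
      by (rule borel_measurable_lebesgue_integral) measurable
    also have "(\<lambda>x. LINT y|L. (if y \<le> x then k y else 0)) = (\<lambda>x. LINT y:{..x}|L. k y)"
      by (auto simp: set_lebesgue_integral_def indicator_def fun_eq_iff intro!:
          Bochner_Integration.integral_cong)
    finally show ?thesis .
  qed
  show ?thesis
    unfolding sint_def by (intro borel_measurable_diff * finite_M finite_N sets_M sets_N)
qed

text \<open>The measure \<open>k V + g dx\<close> has an explicit primitive \<open>W\<close>. By the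
  product rule with a test function, \<open>T - W\<close> has weak derivative zero, so it is
  constant, and the constant is added to \<open>W\<close>. The case \<open>k = 0\<close> yields the
  continuous representative of \<open>u\<close>, the case \<open>k = w / h\<close> the
  representative of \<open>hu'\<close>.\<close>

lemma weak_derivative_representative:
  assumes T: "loc_int T" and g: "loc_int g" and k: "k \<in> borel_measurable borel" and K: "\<And>x. norm
      (k x) \<le> K"
    and weak: "\<And>\<phi>. \<phi> \<in> test_functions \<Longrightarrow>
      - (LINT x|lebesgue. T x * vderiv \<phi> x) = sint UNIV (\<lambda>x. k x * \<phi> x) + (LINT x|lebesgue. g x *
          \<phi> x)"
  shows "\<exists>W. W \<in> borel_measurable lebesgue \<and> (AE x in lebesgue. T x = W x) \<and>
    (\<forall>a b. a \<le> b \<longrightarrow> W b - W a = sint {a<..b} k + (LINT x:{a..b}|lebesgue. g x))"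
proof -
  define G where "G x = (if 0 \<le> x then LINT t:{0..x}|lebesgue. g t else - (LINT t:{x..0}|lebesgue.
      g t))" for x
  have G: "G b - G a = (LINT t:{a..b}|lebesgue. g t)" if "a \<le> b" for a b
    using that interval_integral_combine[OF g, of a 0 b] interval_integral_combine[OF g, of 0 a b]
      interval_integral_combine[OF g, of a b 0] by (auto simp: G_def)
  have G_meas: "G \<in> borel_measurable lebesgue"
    by (rule continuous_measurable_lebesgue[OF continuous_if_interval_integral[OF g G]])
  \<comment> \<open>The set \<open>{..x}\<close> contains \<open>x\<close>, so an atom at
    \<open>x\<close> is already counted in \<open>W x\<close>, in accordance with increments over
    \<open>{a<..b}\<close>.\<close>
  define W where "W x = sint {..x} k + G x" for x
  have S: "sint {..b} k - sint {..a} k = sint {a<..b} k" if "a \<le> b" for a b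
  proof -
    have int: "set_integrable M {..a} k" "set_integrable N {..a} k" "set_integrable M {a<..b} k"
        "set_integrable N {a<..b} k"
      using k K by (auto intro!: set_integrable_bounded[where K=K])
    have "{..b} = {..a} \<union> {a<..b}" using that by auto
    moreover have "{..a} \<inter> {a<..b} = {}" by auto
    ultimately show ?thesis using int by (simp add: sint_def set_integral_Un)
  qed
  have W: "W b - W a = sint {a<..b} k + (LINT t:{a..b}|lebesgue. g t)" if "a \<le> b" for a b
    using S[OF that] G[OF that] by (simp add: W_def algebra_simps)
  have W_meas: "W \<in> borel_measurable lebesgue"
  proof -
    have "(\<lambda>x. sint {..x} k) \<in> borel_measurable lborel" using cumulative_measurable[OF k] by simp
    then show ?thesis unfolding W_def by (intro borel_measurable_add measurable_completion G_meas)
  qed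
  have W_bdd: "\<exists>B. \<forall>x\<in>{a..b}. norm (W x) \<le> B" for a b
  proof -
    obtain B where B: "\<forall>x\<in>{a..b}. norm (G x) \<le> B"
      using continuous_bounded_interval[OF continuous_if_interval_integral[OF g G]] by blast
    have K0: "0 \<le> K" using K[of 0] norm_ge_zero order_trans by blast
    have "norm (sint {..x} k) \<le> K * tv UNIV" for x
    proof -
      have "norm (sint {..x} k) \<le> K * tv {..x}" using k K by (intro norm_sint_le) auto
      also have "\<dots> \<le> K * tv UNIV" using K0 by (intro mult_left_mono tv_mono) auto
      finally show ?thesis .
    qed
    then show ?thesis using B unfolding W_def
      by (intro exI[of _ "K * tv UNIV + B"] ballI norm_triangle_le add_mono) auto
  qed
  have Wl: "loc_int W"
    using loc_int_mult_bounded[OF loc_int_continuous[of "\<lambda>_. 1"] W_meas W_bdd] by simp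
  have "(LINT x|lebesgue. (T x - W x) * vderiv \<phi> x) = 0" if \<phi>: "\<phi> \<in> test_functions" for \<phi>
  proof -
    obtain a b where ab: "a \<le> b" "\<forall>x. x \<notin> {a<..<b} \<longrightarrow> \<phi> x = 0" using test_functionsD(2)[OF \<phi>] by
        blast
    note sm = test_functionsD(1)[OF \<phi>]
    note c\<phi> = smooth_continuous[OF sm] and c\<phi>' = smooth_continuous[OF smooth_vderiv[OF sm]]
    have z: "vderiv \<phi> x = 0" "\<phi> x = 0" if "x \<notin> {a..b}" for x
      using test_function_vderiv_zero[of a b \<phi> x] ab that by auto
    have U: "\<phi> d - \<phi> c = (LINT x:{c..d}|lebesgue. vderiv \<phi> x)" if "c \<le> d" for c d
    proof -
      have "(vderiv \<phi> has_integral \<phi> d - \<phi> c) {c..d}"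
        by (rule fundamental_theorem_of_calculus[OF that
            has_vector_derivative_at_within[OF smooth_has_vector_derivative[OF sm]]])
      then show ?thesis
        using set_lebesgue_integral_eq_integral(2)[OF loc_intD[OF loc_int_continuous[OF c\<phi>']]]
        by (simp add: integral_unique)
    qed
    have loc: "loc_int (\<lambda>x. F x * \<psi> x)" if "loc_int F" "continuous_on UNIV \<psi>" for F \<psi> :: "real \<Rightarrow>
        complex"
      using that by (intro loc_int_mult_bounded continuous_measurable_lebesgue
          continuous_bounded_interval)
    have global: "integrable lebesgue F" "(LINT x:{a..b}|lebesgue. F x) = (LINT x|lebesgue. F x)"
      if "loc_int F" "\<And>x. x \<notin> {a..b} \<Longrightarrow> F x = 0" for F :: "real \<Rightarrow> complex"
    proof -
      have "(\<lambda>x. indicat_real {a..b} x *\<^sub>R F x) = F" using that(2) by (auto simp: indicator_def)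
      then show "integrable lebesgue F" "(LINT x:{a..b}|lebesgue. F x) = (LINT x|lebesgue. F x)"
        using loc_intD[OF that(1), of a b] by (simp_all add: set_integrable_def
            set_lebesgue_integral_def)
    qed
    have gT: "integrable lebesgue (\<lambda>x. T x * vderiv \<phi> x)" by (rule global(1)[OF loc[OF T c\<phi>']])
        (simp add: z)
    have gW: "integrable lebesgue (\<lambda>x. W x * vderiv \<phi> x)" by (rule global(1)[OF loc[OF Wl c\<phi>']])
        (simp add: z)
    have gg: "integrable lebesgue (\<lambda>x. g x * \<phi> x)" by (rule global(1)[OF loc[OF g c\<phi>]]) (simp add:
        z)
    \<comment> \<open>The left side of the product rule vanishes since \<phi> is zero at both
      endpoints: its support was enclosed in an open interval.\<close>
    have "0 = sint {a<..b} (\<lambda>x. \<phi> x * k x) + (LINT x:{a..b}|lebesgue. vderiv \<phi> x * W x + \<phi> x * g x)"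
      using product_rule[OF loc_int_continuous[OF c\<phi>'] U g k K W W_meas ab(1)] ab by simp
    also have "(LINT x:{a..b}|lebesgue. vderiv \<phi> x * W x + \<phi> x * g x) = (LINT x|lebesgue. W x *
        vderiv \<phi> x + g x * \<phi> x)"
      unfolding mult.commute[of "vderiv \<phi> _"] mult.commute[of "\<phi> _"]
      by (rule global(2)[OF loc_int_add[OF loc[OF Wl c\<phi>'] loc[OF g c\<phi>]]]) (simp add: z)
    also have "\<dots> = (LINT x|lebesgue. W x * vderiv \<phi> x) + (LINT x|lebesgue. g x * \<phi> x)"
      using gW gg by simp
    also have "sint {a<..b} (\<lambda>x. \<phi> x * k x) = sint UNIV (\<lambda>x. k x * \<phi> x)"
    proof -
      have "indicat_real {a<..b} x *\<^sub>R (\<phi> x * k x) = k x * \<phi> x" for x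
        using ab(2)[rule_format, of x] by (auto simp: indicator_def)
      then show ?thesis by (simp add: sint_def set_lebesgue_integral_def)
    qed
    finally have "(LINT x|lebesgue. W x * vderiv \<phi> x) + - (LINT x|lebesgue. T x * vderiv \<phi> x) = 0"
      unfolding weak[OF \<phi>] by (simp add: algebra_simps)
    then show ?thesis using gT gW by (simp add: left_diff_distrib)
  qed
  from du_Bois_Reymond[OF loc_int_diff[OF T Wl] this]
  obtain c where c: "AE x in lebesgue. T x - W x = c" by blast
  show ?thesis
  proof (intro exI[of _ "\<lambda>x. W x + c"] conjI allI impI)
    show "(\<lambda>x. W x + c) \<in> borel_measurable lebesgue" using W_meas by measurable
    show "AE x in lebesgue. T x = W x + c" using c by eventually_elim (simp add: algebra_simps)
  qed (simp add: W)
qed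

end

section \<open>Bounds for solutions\<close>

lemma ex_small_value_above:
  fixes F :: "real \<Rightarrow> real"
  assumes int: "integrable lebesgue F" and nonneg: "\<And>x. 0 \<le> F x" and "\<eta> > 0"
  shows "\<exists>x\<ge>N. F x < \<eta>"
proof (rule ccontr)
  assume "\<not> ?thesis"
  then have ge: "\<eta> \<le> F x" if "N \<le> x" for x using that by force
  obtain n :: nat where n: "(LINT x|lebesgue. F x) < real n * \<eta>"
    using reals_Archimedean3[OF \<open>\<eta> > 0\<close>] by blast
  have "real n * \<eta> = (LINT x:{N..N + real n}|lebesgue. \<eta>)"
    by (simp add: set_lebesgue_integral_def mult.commute)
  also have "\<dots> \<le> (LINT x|lebesgue. F x)"
    unfolding set_lebesgue_integral_def
  proof (rule integral_mono[OF _ int])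
    show "integrable lebesgue (\<lambda>x. indicat_real {N..N + real n} x *\<^sub>R \<eta>)"
      using loc_intD[OF loc_int_continuous[of "\<lambda>_. \<eta>"], of N "N + real n"] by (simp add:
          set_integrable_def)
    show "indicat_real {N..N + real n} x *\<^sub>R \<eta> \<le> F x" for x
      using ge[of x] nonneg[of x] by (auto simp: indicator_def)
  qed
  finally show False using n by simp
qed

lemma integrable_lebesgue_reflect:
  fixes F :: "real \<Rightarrow> 'a::euclidean_space"
  assumes "integrable lebesgue F"
  shows "integrable lebesgue (\<lambda>x. F (- x))"
  using lebesgue_integrable_real_affine[OF assms, of "- 1" 0] by simp

lemma ex_vanishing_sequences:
  fixes F :: "real \<Rightarrow> real"
  assumes int: "integrable lebesgue F" and nonneg: "\<And>x. 0 \<le> F x"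
  shows "\<exists>\<alpha> \<beta> :: nat \<Rightarrow> real. (\<forall>n. \<alpha> n \<le> - real n \<and> real n \<le> \<beta> n) \<and>
    (\<lambda>n. F (\<alpha> n)) \<longlonglongrightarrow> 0 \<and> (\<lambda>n. F (\<beta> n)) \<longlonglongrightarrow> 0"
proof -
  have "\<exists>y\<ge>real n. F y < 1 / real (Suc n)" "\<exists>y\<ge>real n. F (- y) < 1 / real (Suc n)" for n
    using ex_small_value_above[OF int nonneg, of "1 / real (Suc n)" "real n"]
      ex_small_value_above[OF integrable_lebesgue_reflect[OF int] nonneg, of "1 / real (Suc n)"
          "real n"] by auto
  then obtain \<beta> \<gamma> where \<beta>: "\<And>n. real n \<le> \<beta> n \<and> F (\<beta> n) < 1 / real (Suc n)"
    and \<gamma>: "\<And>n. real n \<le> \<gamma> n \<and> F (- \<gamma> n) < 1 / real (Suc n)" by metis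
  have lim: "(\<lambda>n. F (y n)) \<longlonglongrightarrow> 0" if "\<And>n. F (y n) < 1 / real (Suc n)" for y :: "nat \<Rightarrow> real"
  proof (rule tendsto_sandwich[OF _ _ tendsto_const LIMSEQ_Suc[OF lim_1_over_n]])
    show "\<forall>\<^sub>F n in sequentially. 0 \<le> F (y n)" using nonneg by simp
    show "\<forall>\<^sub>F n in sequentially. F (y n) \<le> 1 / real (Suc n)"
      using less_imp_le[OF that] by (rule always_eventually[OF allI])
  qed
  show ?thesis
    using \<beta> \<gamma> by (intro exI[of _ "\<lambda>n. - \<gamma> n"] exI[of _ \<beta>] conjI allI lim) auto
qed

lemma tendsto_expanding_interval_integral:
  fixes \<phi> :: "real \<Rightarrow> 'a::euclidean_space"
  assumes int: "integrable lebesgue \<phi>" and \<alpha>\<beta>: "\<And>n. \<alpha> n \<le> - real n \<and> real n \<le> \<beta> n"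
  shows "(\<lambda>n. LINT x:{\<alpha> n..\<beta> n}|lebesgue. \<phi> x) \<longlonglongrightarrow> (LINT x|lebesgue. \<phi> x)"
  unfolding set_lebesgue_integral_def
proof (rule integral_dominated_convergence)
  have [measurable]: "\<phi> \<in> borel_measurable lebesgue" using int by (rule borel_measurable_integrable)
  show "\<phi> \<in> borel_measurable lebesgue" by fact
  show "(\<lambda>x. indicat_real {\<alpha> n..\<beta> n} x *\<^sub>R \<phi> x) \<in> borel_measurable lebesgue" for n
    by (intro borel_measurable_scaleR borel_measurable_indicator) auto
  show "integrable lebesgue (\<lambda>x. norm (\<phi> x))" using int by (rule integrable_norm)
  show "AE x in lebesgue. norm (indicat_real {\<alpha> n..\<beta> n} x *\<^sub>R \<phi> x) \<le> norm (\<phi> x)" for n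
    by (intro AE_I2) (auto simp: indicator_def)
  have "(\<lambda>n. indicat_real {\<alpha> n..\<beta> n} x *\<^sub>R \<phi> x) \<longlonglongrightarrow> \<phi> x" for x
  proof (rule tendsto_eventually)
    obtain N where N: "\<bar>x\<bar> \<le> real N" using real_arch_simple by blast
    have "indicat_real {\<alpha> n..\<beta> n} x *\<^sub>R \<phi> x = \<phi> x" if "n \<ge> N" for n
    proof -
      have "\<bar>x\<bar> \<le> real n" using N that by linarith
      then have "x \<in> {\<alpha> n..\<beta> n}" using \<alpha>\<beta>[of n] by auto
      then show ?thesis by simp
    qed
    then show "\<forall>\<^sub>F n in sequentially. indicat_real {\<alpha> n..\<beta> n} x *\<^sub>R \<phi> x = \<phi> x"
      unfolding eventually_sequentially by blast
  qed
  then show "AE x in lebesgue. (\<lambda>n. indicat_real {\<alpha> n..\<beta> n} x *\<^sub>R \<phi> x) \<longlonglongrightarrow> \<phi> x" by simp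
qed

lemma integrable_imp_loc_int: "integrable lebesgue f \<Longrightarrow> loc_int f"
  unfolding loc_int_def set_integrable_def by (intro allI integrable_mult_indicator) auto

lemma interval_integral_le_integral:
  fixes f :: "real \<Rightarrow> real"
  assumes "integrable lebesgue f" "\<And>x. 0 \<le> f x"
  shows "(LINT x:{a..b}|lebesgue. f x) \<le> (LINT x|lebesgue. f x)"
  unfolding set_lebesgue_integral_def
  using assms loc_intD[OF integrable_imp_loc_int[OF assms(1)], of a b]
  by (intro integral_mono) (auto simp: indicator_def set_integrable_def)

lemma integrable_L2_product:
  assumes "f \<in> L2" "g \<in> L2"
  shows "integrable lebesgue (\<lambda>x. norm (f x) * norm (g x))"
    and "(LINT x|lebesgue. norm (f x) * norm (g x))\<^sup>2
      \<le> (LINT x|lebesgue. (norm (f x))\<^sup>2) * (LINT x|lebesgue. (norm (g x))\<^sup>2)"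
proof -
  have m: "(\<lambda>x. norm (f x)) \<in> borel_measurable lebesgue" "(\<lambda>x. norm (g x)) \<in> borel_measurable
      lebesgue"
    using assms[THEN L2_measurable] by measurable
  note * = m assms[THEN L2_integrable]
  show "integrable lebesgue (\<lambda>x. norm (f x) * norm (g x))" by (rule integrable_mult_L2[OF *])
  show "(LINT x|lebesgue. norm (f x) * norm (g x))\<^sup>2
      \<le> (LINT x|lebesgue. (norm (f x))\<^sup>2) * (LINT x|lebesgue. (norm (g x))\<^sup>2)"
    by (rule Cauchy_Schwarz_integral[OF *])
qed

text \<open>The roles of \<open>w\<close> and \<open>p\<close> are those of \<open>u\<close> and \<open>hu'\<close>; the two increment formulas say
  that \<open>hw' = p\<close> and \<open>hp' = wV - f - zw\<close> with \<open>z = E - i\<sigma>\<epsilon>\<close>.\<close> 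

locale resolvent_solution = measure_pair +
  fixes w p f :: "real \<Rightarrow> complex" and h E \<epsilon> \<sigma> :: real
  assumes h: "0 < h" and E: "0 < E" and \<epsilon>: "0 \<le> \<epsilon>" "\<epsilon> \<le> 1" and \<sigma>: "\<sigma> \<in> {1, - 1}"
    and w_L2: "w \<in> L2" and p_L2: "p \<in> L2" and f_L2: "f \<in> L2"
    and w_incr: "\<And>a b. a \<le> b \<Longrightarrow> w b - w a = (LINT x:{a..b}|lebesgue. of_real (1 / h) * p x)"
    and p_incr: "\<And>a b. a \<le> b \<Longrightarrow> p b - p a = of_real (1 / h) * sint {a<..b} w
      - (LINT x:{a..b}|lebesgue. of_real (1 / h) * (f x + (of_real E - of_real \<sigma> * \<i> * of_real \<epsilon>)
          * w x))"
begin

abbreviation energy :: "real \<Rightarrow> real" where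
  "energy x \<equiv> E * (norm (w x))\<^sup>2 + (norm (p x))\<^sup>2"

text \<open>The scalars to which \<open>resolvent_arithmetic\<close> reduces the estimate.\<close>

abbreviation "X \<equiv> LINT x|lebesgue. (norm (w x))\<^sup>2"
abbreviation "Y \<equiv> LINT x|lebesgue. (norm (p x))\<^sup>2"
abbreviation "A \<equiv> LINT x|lebesgue. norm (w x) * norm (f x)"
abbreviation "R \<equiv> LINT x|lebesgue. norm (w x) * norm (p x)"
abbreviation "D \<equiv> LINT x|lebesgue. norm (p x) * norm (f x)"

lemma energy_nonneg: "0 \<le> energy x" using E by simp

lemma energy_integrable: "integrable lebesgue energy"
  using L2_integrable[OF w_L2] L2_integrable[OF p_L2] by simp

lemma p_loc_int: "loc_int (\<lambda>x. of_real (1 / h) * p x)" by (rule loc_int_cmult[OF L2_loc_int[OF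
    p_L2]])

lemma g_loc_int: "loc_int (\<lambda>x. of_real (1 / h) * (f x + (of_real E - of_real \<sigma> * \<i> * of_real \<epsilon>) *
    w x))"
  by (intro loc_int_cmult loc_int_add L2_loc_int f_L2 w_L2)

lemma w_continuous: "continuous_on UNIV w"
  by (rule continuous_if_interval_integral[OF p_loc_int w_incr])

lemma w_borel: "w \<in> borel_measurable borel"
  by (rule borel_measurable_continuous_onI[OF w_continuous])

text \<open>\<open>energy_growth\<close> with \<open>c = 1 / h\<close> and
  \<open>e = sqrt E\<close>, started at points tending to minus infinity along which the energy
  vanishes. The source \<open>s\<close> majorizes what is left after the terms with \<open>E\<close>
  cancel.\<close>

lemma energy_bound:
  "energy b \<le> exp (tv UNIV / (h * sqrt E)) * (2 / h * D + 2 * \<epsilon> / h * R)"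
proof -
  define s where "s x = 2 / h * (norm (p x) * norm (f x)) + 2 * \<epsilon> / h * (norm (w x) * norm (p x))"
      for x
  have s_int: "integrable lebesgue s"
    unfolding s_def using integrable_L2_product(1)[OF p_L2 f_L2] integrable_L2_product(1)[OF w_L2
        p_L2] by simp
  have s_nonneg: "0 \<le> s x" for x using h \<epsilon> by (simp add: s_def)
  have s_total: "(LINT x|lebesgue. s x) = 2 / h * D + 2 * \<epsilon> / h * R"
    unfolding s_def using integrable_L2_product(1)[OF p_L2 f_L2] integrable_L2_product(1)[OF w_L2
        p_L2] by simp
  obtain \<alpha> \<beta> :: "nat \<Rightarrow> real" where \<alpha>: "\<forall>n. \<alpha> n \<le> - real n \<and> real n \<le> \<beta> n" "(\<lambda>n. energy (\<alpha> n)) \<longlonglongrightarrow> 0"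
    using ex_vanishing_sequences[OF energy_integrable energy_nonneg] by blast
  let ?q = "tv UNIV / (h * sqrt E)"
  have step: "energy b \<le> exp ?q * (energy a + (2 / h * D + 2 * \<epsilon> / h * R))" if "a \<le> b" for a
  proof -
    have "energy b \<le> exp ((1 / h) / sqrt E * tv {a<..b}) * (energy a + (LINT x:{a..b}|lebesgue. s
        x))"
    proof -
      have "2 * (sqrt E)\<^sup>2 * Re (cnj (w x) * (of_real (1 / h) * p x))
        - 2 * Re (cnj (p x) * (of_real (1 / h) * (f x + (of_real E - of_real \<sigma> * \<i> * of_real \<epsilon>) *
            w x))) \<le> s x" for x
      proof -
        let ?u = "cnj (p x) * f x" and ?v = "cnj (p x) * w x"
        \<comment> \<open>The products of \<open>w\<close> and \<open>p\<close> with coefficient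
          \<open>E\<close> occur with opposite signs and equal real parts; only \<open>f\<close> and
          the imaginary part of \<open>z\<close> survive.\<close>
        have "2 * (sqrt E)\<^sup>2 * Re (cnj (w x) * (of_real (1 / h) * p x))
          - 2 * Re (cnj (p x) * (of_real (1 / h) * (f x + (of_real E - of_real \<sigma> * \<i> * of_real \<epsilon>)
              * w x)))
          = (2 / h) * (- Re ?u - \<epsilon> * (\<sigma> * Im ?v))"
          using h E by (simp add: field_simps)
        also have "\<dots> \<le> (2 / h) * (norm (p x) * norm (f x) + \<epsilon> * (norm (w x) * norm (p x)))"
        proof (intro mult_left_mono)
          have "- Re ?u \<le> norm (p x) * norm (f x)"
            using abs_Re_le_cmod[of ?u] by (simp add: norm_mult)
          moreover have "- (\<sigma> * Im ?v) \<le> norm (w x) * norm (p x)"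
            using abs_Im_le_cmod[of ?v] \<sigma> by (auto simp: norm_mult mult.commute)
          then have "\<epsilon> * - (\<sigma> * Im ?v) \<le> \<epsilon> * (norm (w x) * norm (p x))"
            using \<epsilon> by (intro mult_left_mono)
          ultimately show "- Re ?u - \<epsilon> * (\<sigma> * Im ?v) \<le> norm (p x) * norm (f x) + \<epsilon> * (norm (w x) *
              norm (p x))"
            by linarith
        qed (use h in simp)
        finally show ?thesis by (simp add: s_def distrib_left)
      qed
      from energy_growth[OF _ _ p_loc_int w_incr g_loc_int p_incr L2_measurable[OF p_L2]
          integrable_imp_loc_int[OF s_int] s_nonneg this that]
      show ?thesis using h E by simp
    qed
    also have "\<dots> \<le> exp ?q * (energy a + (2 / h * D + 2 * \<epsilon> / h * R))"
    proof (intro mult_mono add_left_mono)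
      have "tv {a<..b} \<le> tv UNIV" by (intro tv_mono) auto
      then show "exp ((1 / h) / sqrt E * tv {a<..b}) \<le> exp ?q"
        using h E by (simp add: divide_right_mono)
      show "(LINT x:{a..b}|lebesgue. s x) \<le> 2 / h * D + 2 * \<epsilon> / h * R"
        unfolding s_total[symmetric] by (rule interval_integral_le_integral[OF s_int s_nonneg])
      show "0 \<le> energy a + (LINT x:{a..b}|lebesgue. s x)"
        by (intro add_nonneg_nonneg[OF energy_nonneg] interval_integral_nonneg s_nonneg)
    qed simp
    finally show ?thesis .
  qed
  have "(\<lambda>n. exp ?q * (energy (\<alpha> n) + (2 / h * D + 2 * \<epsilon> / h * R))) \<longlonglongrightarrow> exp ?q * (0 + (2 / h * D + 2
      * \<epsilon> / h * R))"
    by (intro tendsto_mult tendsto_add tendsto_const \<alpha>(2))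
  moreover have "energy b \<le> exp ?q * (energy (\<alpha> n) + (2 / h * D + 2 * \<epsilon> / h * R))" if "n \<ge> nat
      \<lceil>\<bar>b\<bar>\<rceil>" for n
  proof (rule step)
    have "\<bar>b\<bar> \<le> real n" using that by linarith
    then show "\<alpha> n \<le> b" using \<alpha>(1)[rule_format, of n] by linarith
  qed
  ultimately have "energy b \<le> exp ?q * (0 + (2 / h * D + 2 * \<epsilon> / h * R))"
    using LIMSEQ_le_const by blast
  then show ?thesis by simp
qed

text \<open>The increments of \<open>|w|\<^sup>2\<close> on the two sides of \<open>b\<close>
  together use the integral over the line once, so
  \<open>2 * (norm (w b))\<^sup>2 \<le> 2 / h * R\<close>.\<close>

lemma w_sup_bound: "(norm (w b))\<^sup>2 \<le> R / h"
proof -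
  obtain \<alpha> \<beta> :: "nat \<Rightarrow> real" where \<alpha>\<beta>: "\<forall>n. \<alpha> n \<le> - real n \<and> real n \<le> \<beta> n"
    and lim: "(\<lambda>n. energy (\<alpha> n)) \<longlonglongrightarrow> 0" "(\<lambda>n. energy (\<beta> n)) \<longlonglongrightarrow> 0"
    using ex_vanishing_sequences[OF energy_integrable energy_nonneg] by blast
  define t where "t x = 2 * Re (cnj (w x) * (of_real (1 / h) * p x))" for x
  define T where "T x = 2 / h * (norm (w x) * norm (p x))" for x
  have tT: "\<bar>t x\<bar> \<le> T x" for x
  proof -
    have "\<bar>Re (cnj (w x) * (of_real (1 / h) * p x))\<bar> \<le> norm (cnj (w x) * (of_real (1 / h) * p x))"
      by (rule abs_Re_le_cmod)
    also have "\<dots> = 1 / h * (norm (w x) * norm (p x))" using h by (simp add: norm_mult norm_divide)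
    finally have "2 * \<bar>Re (cnj (w x) * (of_real (1 / h) * p x))\<bar> \<le> T x" by (simp add: T_def)
    then show ?thesis by (simp only: t_def abs_mult abs_numeral)
  qed
  have T_int: "integrable lebesgue T"
    unfolding T_def using integrable_L2_product(1)[OF w_L2 p_L2] by simp
  have T_nonneg: "0 \<le> T x" for x using h by (simp add: T_def)
  have t_loc: "loc_int t"
    unfolding t_def using loc_int_cmult[OF loc_int_Re[OF norm_square_increment(2)[OF p_loc_int
        w_incr order_refl]], of 2] .
  have T_loc: "loc_int T" by (rule integrable_imp_loc_int[OF T_int])
  have bound: "\<bar>(norm (w d))\<^sup>2 - (norm (w c))\<^sup>2\<bar> \<le> (LINT x:{c..d}|lebesgue. T x)" if "c \<le> d" for c d
  proof -
    have "(norm (w d))\<^sup>2 - (norm (w c))\<^sup>2 = (LINT x:{c..d}|lebesgue. t x)"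
      unfolding t_def by (rule norm_square_increment(1)[OF p_loc_int w_incr that])
    then have "\<bar>(norm (w d))\<^sup>2 - (norm (w c))\<^sup>2\<bar> \<le> (LINT x:{c..d}|lebesgue. \<bar>t x\<bar>)"
      using set_integral_norm_bound[OF loc_intD[OF t_loc]] by simp
    also have "\<dots> \<le> (LINT x:{c..d}|lebesgue. T x)"
      by (rule set_integral_mono[OF loc_intD[OF loc_int_norm[OF t_loc, unfolded real_norm_def]]
          loc_intD[OF T_loc] tT])
    finally show ?thesis .
  qed
  have step: "2 * (norm (w b))\<^sup>2 \<le> (energy (\<alpha> n) + energy (\<beta> n)) / E + 2 / h * R" if "n \<ge> nat
      \<lceil>\<bar>b\<bar>\<rceil>" for n
  proof -
    have "\<bar>b\<bar> \<le> real n" using that by linarith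
    then have ab: "\<alpha> n \<le> b" "b \<le> \<beta> n" using \<alpha>\<beta>[rule_format, of n] by linarith+
    have "(norm (w x))\<^sup>2 \<le> energy x / E" for x using E by (simp add: pos_le_divide_eq mult.commute)
    note this[of "\<alpha> n"] this[of "\<beta> n"]
    moreover have "(LINT x:{\<alpha> n..b}|lebesgue. T x) + (LINT x:{b..\<beta> n}|lebesgue. T x) \<le> 2 / h * R"
    proof -
      have "(LINT x:{\<alpha> n..b}|lebesgue. T x) + (LINT x:{b..\<beta> n}|lebesgue. T x) = (LINT x:{\<alpha> n..\<beta>
          n}|lebesgue. T x)"
        using interval_integral_combine[OF T_loc ab] by simp
      also have "\<dots> \<le> (LINT x|lebesgue. T x)" by (rule interval_integral_le_integral[OF T_int
          T_nonneg])
      finally show ?thesis by (simp add: T_def)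
    qed
    ultimately show ?thesis
      using bound[OF ab(1)] bound[OF ab(2)] by (simp only: add_divide_distrib abs_le_iff) linarith
  qed
  have "(\<lambda>n. (energy (\<alpha> n) + energy (\<beta> n)) / E + 2 / h * R) \<longlonglongrightarrow> (0 + 0) / E + 2 / h * R"
    using E by (intro tendsto_add tendsto_divide lim tendsto_const) auto
  then have "2 * (norm (w b))\<^sup>2 \<le> (0 + 0) / E + 2 / h * R"
    by (rule LIMSEQ_le_const) (use step in blast)
  then show ?thesis by simp
qed

text \<open>The product rule for \<open>cnj w * p\<close>. It is the pairing of the equation with
  \<open>w\<close>, integrated by parts over \<open>{a<..b}\<close>; no jump of \<open>p\<close>
  does harm because \<open>w\<close> is continuous.\<close>

lemma boundary_form_increment:
  assumes "a \<le> b"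
  shows "of_real h * (cnj (w b) * p b - cnj (w a) * p a) =
    sint {a<..b} (\<lambda>x. of_real ((norm (w x))\<^sup>2))
    + (LINT x:{a..b}|lebesgue. of_real ((norm (p x))\<^sup>2) - cnj (w x) * f x
        - (of_real E - of_real \<sigma> * \<i> * of_real \<epsilon>) * of_real ((norm (w x))\<^sup>2))"
proof -
  let ?z = "of_real E - of_real \<sigma> * \<i> * of_real \<epsilon> :: complex"
  have R0: "norm (w x) \<le> sqrt (R / h)" for x using w_sup_bound[of x] by (simp add: real_le_rsqrt)
  have "cnj (w b) * p b - cnj (w a) * p a =
    sint {a<..b} (\<lambda>x. cnj (w x) * (of_real (1 / h) * w x))
    + (LINT x:{a..b}|lebesgue. cnj (of_real (1 / h) * p x) * p x + cnj (w x) * - (of_real (1 / h)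
        * (f x + ?z * w x)))"
  proof (rule product_rule[where K="1 / h * sqrt (R / h)"])
    show "loc_int (\<lambda>x. cnj (of_real (1 / h) * p x))" by (rule loc_int_cnj[OF p_loc_int])
    show "cnj (w b) - cnj (w a) = (LINT x:{a..b}|lebesgue. cnj (of_real (1 / h) * p x))" if "a \<le>
        b" for a b
      unfolding set_integral_cnj using w_incr[OF that] by (metis complex_cnj_diff)
    show "loc_int (\<lambda>x. - (of_real (1 / h) * (f x + ?z * w x)))"
      using loc_int_cmult[OF g_loc_int, of "- 1"] by (simp only: mult_minus1)
    show "(\<lambda>x. of_real (1 / h) * w x) \<in> borel_measurable borel"
      using w_borel by measurable
    show "norm (of_real (1 / h) * w x) \<le> 1 / h * sqrt (R / h)" for x
      unfolding norm_mult norm_of_real using R0[of x] h by (intro mult_mono) auto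
    show "p b - p a = sint {a<..b} (\<lambda>x. of_real (1 / h) * w x)
      + (LINT x:{a..b}|lebesgue. - (of_real (1 / h) * (f x + ?z * w x)))" if "a \<le> b" for a b
    proof -
      have "(LINT x:{a..b}|lebesgue. - F x) = - (LINT x:{a..b}|lebesgue. F x)" for F :: "real \<Rightarrow>
          complex"
        by (simp add: set_lebesgue_integral_def)
      then show ?thesis unfolding p_incr[OF that] sint_cmult by simp
    qed
  qed (use assms L2_measurable[OF p_L2] in auto)
  then have "of_real h * (cnj (w b) * p b - cnj (w a) * p a) =
    of_real h * sint {a<..b} (\<lambda>x. cnj (w x) * (of_real (1 / h) * w x))
    + of_real h * (LINT x:{a..b}|lebesgue. cnj (of_real (1 / h) * p x) * p x + cnj (w x) * -
        (of_real (1 / h) * (f x + ?z * w x)))"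
    by (simp only: distrib_left)
  also have "of_real h * sint {a<..b} (\<lambda>x. cnj (w x) * (of_real (1 / h) * w x)) = sint {a<..b}
      (\<lambda>x. of_real ((norm (w x))\<^sup>2))"
    unfolding sint_cmult[symmetric] complex_norm_square using h by (simp add: mult.commute)
  also have "of_real h * (LINT x:{a..b}|lebesgue. cnj (of_real (1 / h) * p x) * p x + cnj (w x) *
      - (of_real (1 / h) * (f x + ?z * w x)))
    = (LINT x:{a..b}|lebesgue. of_real ((norm (p x))\<^sup>2) - cnj (w x) * f x - ?z * of_real ((norm (w
        x))\<^sup>2))"
    unfolding set_integral_mult_right[symmetric]
  proof (intro set_lebesgue_integral_cong ballI allI impI)
    fix x
    show "of_real h * (cnj (of_real (1 / h) * p x) * p x + cnj (w x) * - (of_real (1 / h) * (f x +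
        ?z * w x)))
      = of_real ((norm (p x))\<^sup>2) - cnj (w x) * f x - ?z * of_real ((norm (w x))\<^sup>2)"
      using h unfolding complex_norm_square by (simp add: field_simps)
  qed simp
  finally show ?thesis .
qed

end

section \<open>The weight and the arithmetic of the constant\<close>

lemma exp_ge_twice: "2 * y \<le> exp y" for y :: real
proof (cases "y \<ge> 0")
  case True
  have "1 + y + y\<^sup>2 / 2 \<le> exp y" by (rule exp_lower_Taylor_quadratic[OF True])
  \<comment> \<open>\<open>1 + y + y\<^sup>2 / 2 - 2 * y\<close> equals
    \<open>((y - 1)\<^sup>2 + 1) / 2\<close>.\<close>
  moreover have "0 \<le> (y - 1)\<^sup>2" by simp
  then have "0 \<le> y\<^sup>2 - 2 * y + 1" by (simp add: power2_eq_square algebra_simps)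
  ultimately show ?thesis by linarith
next
  case False
  then show ?thesis using exp_gt_zero[of y] by linarith
qed

text \<open>The weight is dominated by two shifted copies of \<open>x powr (- 1 - \<delta>)\<close>
  on \<open>{1..}\<close>, one of them reflected, each with integral \<open>1 / \<delta>\<close>.
  They overlap only at the origin.\<close>

lemma weight_integral:
  assumes "0 < \<delta>"
  shows "integrable lebesgue (\<lambda>x :: real. (\<bar>x\<bar> + 1) powr (- 1 - \<delta>))"
    and "(LINT x|lebesgue. (\<bar>x\<bar> + 1) powr (- 1 - \<delta>)) \<le> 2 / \<delta>"
proof -
  define g where "g x = indicat_real {1..} x * x powr (- 1 - \<delta>)" for x :: real
  have hi: "((\<lambda>x. x powr (- 1 - \<delta>)) has_integral 1 / \<delta>) {1..}"
    using has_integral_powr_to_inf[of "- 1 - \<delta>" 1] assms by simp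
  then have "set_integrable lebesgue {1..} (\<lambda>x. x powr (- 1 - \<delta>))"
    by (intro nonnegative_absolutely_integrable_1) auto
  then have g_int: "integrable lebesgue g" and "(LINT x|lebesgue. g x) = 1 / \<delta>"
    using set_lebesgue_integral_eq_integral(2)[of "{1..}" "\<lambda>x. x powr (- 1 - \<delta>)"]
        integral_unique[OF hi]
    by (auto simp: set_integrable_def set_lebesgue_integral_def g_def[abs_def])
  note aff = lebesgue_integrable_real_affine[OF g_int, of 1 1] lebesgue_integrable_real_affine[OF
      g_int, of "- 1" 1]
  have aff_eq: "(LINT x|lebesgue. g (1 + x)) = 1 / \<delta>" "(LINT x|lebesgue. g (1 - x)) = 1 / \<delta>"
    using lebesgue_integral_real_affine[of 1 g 1] lebesgue_integral_real_affine[of "- 1" g 1]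
      \<open>(LINT x|lebesgue. g x) = 1 / \<delta>\<close> by simp_all
  have int: "integrable lebesgue (\<lambda>x. g (1 + x) + g (1 - x))" using aff by simp
  have le: "(\<bar>x\<bar> + 1) powr (- 1 - \<delta>) \<le> g (1 + x) + g (1 - x)" for x
    by (cases "x \<ge> 0") (auto simp: g_def indicator_def add.commute)
  show wint: "integrable lebesgue (\<lambda>x :: real. (\<bar>x\<bar> + 1) powr (- 1 - \<delta>))"
  proof (rule Bochner_Integration.integrable_bound[OF int])
    have "continuous_on UNIV (\<lambda>x :: real. (\<bar>x\<bar> + 1) powr (- 1 - \<delta>))"
      by (intro continuous_intros) auto
    then show "(\<lambda>x :: real. (\<bar>x\<bar> + 1) powr (- 1 - \<delta>)) \<in> borel_measurable lebesgue"
      by (rule continuous_measurable_lebesgue)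
    show "AE x in lebesgue. norm ((\<bar>x\<bar> + 1) powr (- 1 - \<delta>)) \<le> norm (g (1 + x) + g (1 - x))"
      using le by (intro AE_I2) (simp add: abs_le_iff order_trans[OF le] abs_ge_self)
  qed
  have "(LINT x|lebesgue. (\<bar>x\<bar> + 1) powr (- 1 - \<delta>)) \<le> (LINT x|lebesgue. g (1 + x) + g (1 - x))"
    using le by (intro integral_mono wint int)
  also have "\<dots> = 2 / \<delta>" using aff aff_eq by simp
  finally show "(LINT x|lebesgue. (\<bar>x\<bar> + 1) powr (- 1 - \<delta>)) \<le> 2 / \<delta>" .
qed

text \<open>\<open>J\<close> reappears on the right only through square roots, so squaring the bound
  on \<open>J\<close> and dividing by \<open>J\<close> closes the estimate. The roles:
  \<open>J\<close> is the weighted energy, \<open>N\<close> the weighted integral of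
  \<open>|f|\<^sup>2\<close>, \<open>F\<close> the supremum bound, \<tau> the norm of
  \<open>V\<close>.\<close>

lemma resolvent_arithmetic:
  fixes h E \<epsilon> \<delta> \<tau> q X Y A R D J N F K :: real
  assumes pos: "0 < h" "0 < E" "0 < \<delta>" "0 \<le> \<epsilon>" "\<epsilon> \<le> 1"
    and nonneg: "0 \<le> X" "0 \<le> Y" "0 \<le> A" "0 \<le> R" "0 \<le> D" "0 \<le> \<tau>" "0 \<le> J" "0 \<le> N"
    and \<epsilon>X: "\<epsilon> * X \<le> A" and Y: "Y \<le> R / h * \<tau> + A + E * X"
    and R: "R\<^sup>2 \<le> X * Y" and A: "A\<^sup>2 \<le> N * (J / E)" and D: "D\<^sup>2 \<le> N * J"
    and F: "F \<le> exp q * (2 / h * D + 2 * \<epsilon> / h * R)" and J: "J \<le> 2 / \<delta> * F"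
    and K: "K = 2 + 2 * E + \<tau>\<^sup>2 / h\<^sup>2"
  shows "J \<le> exp (2 / \<delta> + q) * (4 / h\<^sup>2 + 2 / h + 1 / (E * h\<^sup>2) * K\<^sup>2) * exp (2 / \<delta> + q) * N"
proof (cases "J = 0")
  case True
  then show ?thesis using pos nonneg by simp
next
  case False
  with nonneg have J0: "J > 0" by simp
  have K2: "2 \<le> K" using pos by (simp add: K)
  have am_gm: "a * b \<le> ((a + b) / 2)\<^sup>2" for a b :: real
  proof -
    have "0 \<le> (a - b)\<^sup>2" by simp
    then show ?thesis by (simp add: power2_eq_square field_simps)
  qed
  \<comment> \<open>By \<open>R\<^sup>2 \<le> X * Y\<close> and the arithmetic-geometric mean
    inequality the potential term costs half of \<open>Y\<close>, which can be moved to the left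
    side of the bound on \<open>Y\<close>.\<close>
  have "R / h * \<tau> \<le> (Y + X * (\<tau>\<^sup>2 / h\<^sup>2)) / 2"
  proof (rule power2_le_imp_le)
    have "(R / h * \<tau>)\<^sup>2 = R\<^sup>2 * (\<tau>\<^sup>2 / h\<^sup>2)" by (simp add: power_mult_distrib power_divide)
    also have "\<dots> \<le> (X * Y) * (\<tau>\<^sup>2 / h\<^sup>2)" by (intro mult_right_mono R) simp
    also have "\<dots> = Y * (X * (\<tau>\<^sup>2 / h\<^sup>2))" by simp
    also have "\<dots> \<le> ((Y + X * (\<tau>\<^sup>2 / h\<^sup>2)) / 2)\<^sup>2"
      by (rule am_gm)
    finally show "(R / h * \<tau>)\<^sup>2 \<le> ((Y + X * (\<tau>\<^sup>2 / h\<^sup>2)) / 2)\<^sup>2" .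
    show "0 \<le> (Y + X * (\<tau>\<^sup>2 / h\<^sup>2)) / 2" using nonneg by simp
  qed
  moreover have "(2 * E + \<tau>\<^sup>2 / h\<^sup>2) * X = 2 * (E * X) + X * (\<tau>\<^sup>2 / h\<^sup>2)" by (simp add:
      algebra_simps)
  ultimately have "Y \<le> 2 * A + (2 * E + \<tau>\<^sup>2 / h\<^sup>2) * X" using Y by argo
  \<comment> \<open>Origin of \<open>K\<close>: the summand 2 comes from \<open>2 * A\<close> and
    \<open>\<epsilon> \<le> 1\<close>, the rest from the coefficient of \<open>X\<close> and
    \<open>\<epsilon> * X \<le> A\<close>.\<close>
  then have "\<epsilon> * Y \<le> \<epsilon> * (2 * A + (2 * E + \<tau>\<^sup>2 / h\<^sup>2) * X)" using pos by (intro mult_left_mono)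
  also have "\<dots> = \<epsilon> * (2 * A) + (2 * E + \<tau>\<^sup>2 / h\<^sup>2) * (\<epsilon> * X)" by (simp add: algebra_simps)
  also have "\<dots> \<le> 1 * (2 * A) + (2 * E + \<tau>\<^sup>2 / h\<^sup>2) * A"
    using pos nonneg \<epsilon>X by (intro add_mono mult_mono mult_left_mono) auto
  also have "\<dots> = K * A" by (simp add: K algebra_simps)
  finally have \<epsilon>Y: "\<epsilon> * Y \<le> K * A" .
  \<comment> \<open>The factor \<open>\<epsilon>\<^sup>2\<close> is shared out, one \<epsilon> to
    \<open>X\<close> and one to \<open>Y\<close>, so the bound is uniform as \<epsilon> tends to
    0.\<close>
  have "(\<epsilon> * R)\<^sup>2 \<le> K * A\<^sup>2"
  proof -
    have "(\<epsilon> * R)\<^sup>2 \<le> \<epsilon>\<^sup>2 * (X * Y)" using R by (simp add: power_mult_distrib mult_left_mono)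
    also have "\<dots> = (\<epsilon> * X) * (\<epsilon> * Y)" by (simp add: power2_eq_square)
    also have "\<dots> \<le> A * (K * A)" by (rule mult_mono[OF \<epsilon>X \<epsilon>Y nonneg(3)]) (use nonneg pos in simp)
    finally show ?thesis by (simp add: power2_eq_square mult_ac)
  qed
  also have "\<dots> \<le> K * (N * (J / E))" using A K2 by (intro mult_left_mono) auto
  finally have \<epsilon>R: "(\<epsilon> * R)\<^sup>2 \<le> K * (N * (J / E))" .
  have DR: "(D + \<epsilon> * R)\<^sup>2 \<le> 2 * (1 + K / E) * N * J"
  proof -
    have "0 \<le> (D - \<epsilon> * R)\<^sup>2" by simp
    then have "(D + \<epsilon> * R)\<^sup>2 \<le> 2 * D\<^sup>2 + 2 * (\<epsilon> * R)\<^sup>2" by (simp add: power2_eq_square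
        algebra_simps)
    also have "\<dots> \<le> 2 * (N * J) + 2 * (K * (N * (J / E)))" using D \<epsilon>R by linarith
    also have "\<dots> = 2 * (1 + K / E) * N * J" using pos by (simp add: field_simps)
    finally show ?thesis .
  qed
  have "J \<le> 2 / \<delta> * (exp q * (2 / h * D + 2 * \<epsilon> / h * R))"
    using J F pos by (meson mult_left_mono order_trans divide_nonneg_pos zero_le_numeral)
  also have "\<dots> = 2 / \<delta> * exp q * (2 / h) * (D + \<epsilon> * R)"
    by (simp add: algebra_simps add_divide_distrib)
  finally have "J\<^sup>2 \<le> (2 / \<delta> * exp q * (2 / h) * (D + \<epsilon> * R))\<^sup>2" using J0 by (intro power_mono) auto
  also have "\<dots> = (2 / \<delta>)\<^sup>2 * (exp q)\<^sup>2 * (4 / h\<^sup>2) * (D + \<epsilon> * R)\<^sup>2"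
    by (simp add: power_mult_distrib power_divide)
  also have "\<dots> \<le> (2 / \<delta>)\<^sup>2 * (exp q)\<^sup>2 * (4 / h\<^sup>2) * (2 * (1 + K / E) * N * J)"
    by (intro mult_left_mono DR) simp
  finally have "J * J \<le> ((2 / \<delta>)\<^sup>2 * (exp q)\<^sup>2 * (4 / h\<^sup>2) * (2 * (1 + K / E) * N)) * J"
    by (simp add: power2_eq_square mult_ac)
  then have "J \<le> (2 / \<delta>)\<^sup>2 * (exp q)\<^sup>2 * (4 / h\<^sup>2) * (2 * (1 + K / E) * N)"
    using J0 by (rule mult_right_le_imp_le)
  also have "\<dots> \<le> ((exp (2 / \<delta>))\<^sup>2 / 4) * (exp q)\<^sup>2 * (4 / h\<^sup>2) * (2 * (1 + K / E) * N)"
  proof -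
    have "(2 / \<delta>)\<^sup>2 \<le> (exp (2 / \<delta>) / 2)\<^sup>2" using exp_ge_twice[of "2 / \<delta>"] pos by (intro
        power_mono) auto
    then show ?thesis
      using pos nonneg K2 by (intro mult_right_mono) (auto simp: power_divide)
  qed
  also have "\<dots> = (exp (2 / \<delta> + q))\<^sup>2 * (2 / h\<^sup>2 + 2 * K / (E * h\<^sup>2)) * N"
    unfolding exp_add power_mult_distrib using pos by (simp add: field_simps)
  also have "\<dots> \<le> (exp (2 / \<delta> + q))\<^sup>2 * (4 / h\<^sup>2 + 2 / h + 1 / (E * h\<^sup>2) * K\<^sup>2) * N"
  proof (intro mult_right_mono mult_left_mono nonneg)
    \<comment> \<open>Passage to the stated constant: \<open>K \<ge> 2\<close> replaces
      \<open>2 * K\<close> by its square.\<close>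
    have "2 * K \<le> K\<^sup>2" using K2 by (simp add: power2_eq_square)
    then have "2 * K / (E * h\<^sup>2) \<le> 1 / (E * h\<^sup>2) * K\<^sup>2" using pos by (simp add: divide_right_mono)
    moreover have "2 / h\<^sup>2 \<le> 4 / h\<^sup>2 + 2 / h" using pos by (simp add: divide_right_mono
        add_increasing2)
    ultimately show "2 / h\<^sup>2 + 2 * K / (E * h\<^sup>2) \<le> 4 / h\<^sup>2 + 2 / h + 1 / (E * h\<^sup>2) * K\<^sup>2" by
        linarith
  qed simp
  finally show ?thesis by (simp add: power2_eq_square mult_ac)
qed

section \<open>Mass bounds and the weighted estimate\<close>

context resolvent_solution begin

lemma cnj_w_f_integrable: "integrable lebesgue (\<lambda>x. cnj (w x) * f x)"
proof (rule Bochner_Integration.integrable_bound[OF integrable_L2_product(1)[OF w_L2 f_L2]])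
  have "(\<lambda>x. cnj (w x)) \<in> borel_measurable lebesgue"
    by (intro continuous_measurable_lebesgue continuous_intros w_continuous)
  then show "(\<lambda>x. cnj (w x) * f x) \<in> borel_measurable lebesgue"
    using L2_measurable[OF f_L2] by (rule borel_measurable_times)
qed (simp add: norm_mult)

text \<open>Along sequences on which the energy vanishes the boundary terms disappear, so
  \<open>- L\<close> is the limit of the integrals of \<open>|w|\<^sup>2\<close> against
  \<open>V\<close>. These are real because \<open>V\<close> is, and \<open>w_sup_bound\<close>
  bounds them by \<open>R / h\<close> times the total mass.\<close>

lemma boundary_form_limit:
  defines "L \<equiv> (LINT x|lebesgue. of_real ((norm (p x))\<^sup>2) - cnj (w x) * f x
        - (of_real E - of_real \<sigma> * \<i> * of_real \<epsilon>) * of_real ((norm (w x))\<^sup>2))"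
  shows "Im L = 0" "norm L \<le> R / h * tv UNIV"
proof -
  define \<phi> where "\<phi> x = of_real ((norm (p x))\<^sup>2) - cnj (w x) * f x
        - (of_real E - of_real \<sigma> * \<i> * of_real \<epsilon>) * of_real ((norm (w x))\<^sup>2)" for x
  have \<phi>_int: "integrable lebesgue \<phi>"
    unfolding \<phi>_def using L2_integrable[OF w_L2] L2_integrable[OF p_L2] cnj_w_f_integrable
    by (intro Bochner_Integration.integrable_diff integrable_mult_right integrable_of_real) auto
  obtain \<alpha> \<beta> :: "nat \<Rightarrow> real" where \<alpha>\<beta>: "\<forall>n. \<alpha> n \<le> - real n \<and> real n \<le> \<beta> n"
    and lim: "(\<lambda>n. energy (\<alpha> n)) \<longlonglongrightarrow> 0" "(\<lambda>n. energy (\<beta> n)) \<longlonglongrightarrow> 0"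
    using ex_vanishing_sequences[OF energy_integrable energy_nonneg] by blast
  have wp: "(\<lambda>n. cnj (w (y n)) * p (y n)) \<longlonglongrightarrow> 0" if "(\<lambda>n. energy (y n)) \<longlonglongrightarrow> 0" for y :: "nat \<Rightarrow> real"
  proof (rule Lim_null_comparison)
    have "norm (cnj (w x) * p x) \<le> (1 / E + 1) * energy x" for x
    proof -
      have "2 * (norm (w x) * norm (p x)) \<le> (norm (w x))\<^sup>2 + (norm (p x))\<^sup>2"
        using sum_squares_bound[of "norm (w x)" "norm (p x)"] by (simp add: mult.assoc)
      moreover have "0 \<le> norm (w x) * norm (p x)" by simp
      moreover have "(1 / E + 1) * energy x = (norm (w x))\<^sup>2 + (norm (p x))\<^sup>2 / E + energy x"
        using E by (simp add: field_simps)
      moreover have "0 \<le> (norm (p x))\<^sup>2 / E" "0 \<le> E * (norm (w x))\<^sup>2" using E by auto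
      ultimately show ?thesis unfolding norm_mult complex_mod_cnj by linarith
    qed
    then show "\<forall>\<^sub>F n in sequentially. norm (cnj (w (y n)) * p (y n)) \<le> (1 / E + 1) * energy (y n)"
        by simp
    show "(\<lambda>n. (1 / E + 1) * energy (y n)) \<longlonglongrightarrow> 0"
      using tendsto_mult_right_zero[OF that, of "1 / E + 1"] by simp
  qed
  define S where "S n = sint {\<alpha> n<..\<beta> n} (\<lambda>x. of_real ((norm (w x))\<^sup>2))" for n
  have S_eq: "S n = of_real h * (cnj (w (\<beta> n)) * p (\<beta> n) - cnj (w (\<alpha> n)) * p (\<alpha> n)) - (LINT x:{\<alpha>
      n..\<beta> n}|lebesgue. \<phi> x)" for n
  proof -
    have "\<alpha> n \<le> \<beta> n" using \<alpha>\<beta>[rule_format, of n] by simp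
    from boundary_form_increment[OF this] show ?thesis by (simp add: S_def \<phi>_def)
  qed
  have "(\<lambda>n. S n) \<longlonglongrightarrow> of_real h * (0 - 0) - (LINT x|lebesgue. \<phi> x)"
    unfolding S_eq
    by (intro tendsto_diff tendsto_mult tendsto_const wp lim
        tendsto_expanding_interval_integral[OF \<phi>_int])
      (use \<alpha>\<beta> in blast)
  then have S_lim: "S \<longlonglongrightarrow> - L" by (simp add: L_def \<phi>_def)
  have "Im (S n) = 0" for n
    by (simp add: S_def sint_def set_integral_complex_of_real del: of_real_power)
  then have "(\<lambda>n. Im (S n)) \<longlonglongrightarrow> 0" by simp
  moreover have "(\<lambda>n. Im (S n)) \<longlonglongrightarrow> Im (- L)" by (rule tendsto_Im[OF S_lim])
  ultimately show "Im L = 0" using LIMSEQ_unique by fastforce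
  have S_le: "norm (S n) \<le> R / h * tv UNIV" for n
  proof -
    have R0: "0 \<le> R / h" using w_sup_bound[of 0] by (meson order_trans zero_le_power2)
    have "norm (S n) \<le> R / h * tv {\<alpha> n<..\<beta> n}"
      unfolding S_def
    proof (rule norm_sint_le)
      show "(\<lambda>x. complex_of_real ((norm (w x))\<^sup>2)) \<in> borel_measurable borel"
        by (intro borel_measurable_continuous_onI continuous_intros w_continuous)
      show "norm (of_real ((norm (w x))\<^sup>2) :: complex) \<le> R / h" for x
        unfolding norm_of_real using w_sup_bound[of x] by simp
    qed simp
    also have "\<dots> \<le> R / h * tv UNIV" using R0 by (intro mult_left_mono tv_mono) auto
    finally show ?thesis .
  qed
  have "norm (- L) \<le> R / h * tv UNIV"
    by (rule LIMSEQ_le_const2[OF tendsto_norm[OF S_lim]]) (use S_le in blast)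
  then show "norm L \<le> R / h * tv UNIV" by simp
qed

text \<open>The imaginary and the real part of \<open>L = Y - B - z * X\<close> with
  \<open>z = E - i \<sigma> \<epsilon>\<close>. As \<open>L\<close> is real, the imaginary part
  leaves \<open>\<epsilon> * (\<sigma> * X) = Im B\<close>; the real part is solved for
  \<open>Y\<close>.\<close>

lemma mass_bounds: "\<epsilon> * X \<le> A" "Y \<le> R / h * tv UNIV + A + E * X"
proof -
  let ?z = "of_real E - of_real \<sigma> * \<i> * of_real \<epsilon> :: complex"
  define B where "B = (LINT x|lebesgue. cnj (w x) * f x)"
  have "norm B \<le> (LINT x|lebesgue. norm (cnj (w x) * f x))" unfolding B_def by (rule
      integral_norm_bound)
  then have B_le: "norm B \<le> A" by (simp add: norm_mult)
  define L where "L = (LINT x|lebesgue. of_real ((norm (p x))\<^sup>2) - cnj (w x) * f x - ?z * of_real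
      ((norm (w x))\<^sup>2))"
  have L_eq: "L = of_real Y - B - ?z * of_real X"
  proof -
    have i: "integrable lebesgue (\<lambda>x. complex_of_real ((norm (p x))\<^sup>2))" "integrable lebesgue (\<lambda>x.
        ?z * complex_of_real ((norm (w x))\<^sup>2))"
      by (intro integrable_mult_right integrable_of_real L2_integrable p_L2 w_L2)+
    show ?thesis
      unfolding L_def B_def
      using Bochner_Integration.integral_diff[OF Bochner_Integration.integrable_diff[OF i(1)
          cnj_w_f_integrable] i(2)]
        Bochner_Integration.integral_diff[OF i(1) cnj_w_f_integrable]
      by (simp only: integral_mult_right_zero integral_complex_of_real)
  qed
  note L = boundary_form_limit[folded L_def]
  have "\<epsilon> * (\<sigma> * X) = Im B" using L(1) unfolding L_eq by (simp add: mult_ac)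
  then have "\<bar>\<epsilon> * (\<sigma> * X)\<bar> \<le> A" using abs_Im_le_cmod[of B] B_le by simp
  moreover have "\<epsilon> * X \<le> \<bar>\<epsilon> * (\<sigma> * X)\<bar>" using \<sigma> by auto
  ultimately show "\<epsilon> * X \<le> A" by linarith
  have "Y = Re L + Re B + E * X" unfolding L_eq by simp
  then show "Y \<le> R / h * tv UNIV + A + E * X"
    using L(2) abs_Re_le_cmod[of L] abs_Re_le_cmod[of B] B_le by linarith
qed

text \<open>The bound on the energy is uniform in \<open>x\<close>, so it can be integrated against
  the weight. The weight is at most 1 and the energy integrable, hence \<open>J\<close> is a genuine
  finite integral and may be divided by.\<close>

proposition weighted_energy_bound:
  assumes \<delta>: "0 < \<delta>" and wf: "integrable lebesgue (\<lambda>x. (\<bar>x\<bar> + 1) powr (1 + \<delta>) * (norm (f x))\<^sup>2)"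
  defines "C1 \<equiv> 2 / \<delta> + tv UNIV / (h * sqrt E)"
  shows "(LINT x|lebesgue. (\<bar>x\<bar> + 1) powr (- 1 - \<delta>) * energy x)
    \<le> exp C1 * (4 / h\<^sup>2 + 2 / h + 1 / (E * h\<^sup>2) * (2 + 2 * E + (tv UNIV)\<^sup>2 / h\<^sup>2)\<^sup>2) * exp C1
      * (LINT x|lebesgue. (\<bar>x\<bar> + 1) powr (1 + \<delta>) * (norm (f x))\<^sup>2)"
proof -
  define \<omega> where "\<omega> x = (\<bar>x\<bar> + 1) powr (- 1 - \<delta>)" for x :: real
  define N where "N = (LINT x|lebesgue. (\<bar>x\<bar> + 1) powr (1 + \<delta>) * (norm (f x))\<^sup>2)"
  define J where "J = (LINT x|lebesgue. \<omega> x * energy x)"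
  define F where "F = exp (tv UNIV / (h * sqrt E)) * (2 / h * D + 2 * \<epsilon> / h * R)"
  have \<omega>: "\<omega> x \<le> 1" "0 \<le> \<omega> x" for x
  proof -
    have "\<bar>x\<bar> + 1 \<noteq> 0" by linarith
    then show "\<omega> x \<le> 1" "0 \<le> \<omega> x"
      using powr_mono[of "- 1 - \<delta>" 0 "\<bar>x\<bar> + 1"] \<delta> by (simp_all add: \<omega>_def)
  qed
  have \<omega>_cont: "continuous_on UNIV \<omega>" "continuous_on UNIV (\<lambda>x :: real. (\<bar>x\<bar> + 1) powr ((- 1 - \<delta>) /
      2))"
      "continuous_on UNIV (\<lambda>x :: real. (\<bar>x\<bar> + 1) powr ((1 + \<delta>) / 2))"
    unfolding \<omega>_def by (intro continuous_intros; auto)+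
  note \<omega>_meas [measurable] = \<omega>_cont[THEN continuous_measurable_lebesgue]
  have \<omega>_int: "integrable lebesgue \<omega>" unfolding \<omega>_def by (rule weight_integral(1)[OF \<delta>])
  have wt_int: "integrable lebesgue (\<lambda>x. \<omega> x * k x)" if k: "integrable lebesgue k" for k :: "real
      \<Rightarrow> real"
  proof (rule Bochner_Integration.integrable_bound[OF k])
    show "(\<lambda>x. \<omega> x * k x) \<in> borel_measurable lebesgue"
      using borel_measurable_integrable[OF k] \<omega>_meas(1) by measurable
    show "AE x in lebesgue. norm (\<omega> x * k x) \<le> norm (k x)"
      using \<omega> by (intro AE_I2) (simp add: abs_mult mult_left_le_one_le)
  qed
  have J_int: "integrable lebesgue (\<lambda>x. \<omega> x * energy x)" by (rule wt_int[OF energy_integrable])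
  have F0: "0 \<le> F" unfolding F_def by (rule order_trans[OF energy_nonneg energy_bound[of 0]])
  have J: "J \<le> 2 / \<delta> * F"
  proof -
    have "J \<le> (LINT x|lebesgue. \<omega> x * F)"
      unfolding J_def F_def using \<omega> \<omega>_int
      by (intro integral_mono J_int integrable_mult_left mult_left_mono energy_bound) auto
    also have "\<dots> = (LINT x|lebesgue. \<omega> x) * F" by simp
    also have "\<dots> \<le> 2 / \<delta> * F"
      unfolding \<omega>_def by (intro mult_right_mono weight_integral(2) \<delta> F0)
    finally show ?thesis .
  qed
  \<comment> \<open>Cauchy--Schwarz after inserting two mutually inverse powers of
    \<open>|x| + 1\<close>, one on each factor.\<close>
  have CS: "(LINT x|lebesgue. norm (k x) * norm (f x))\<^sup>2 \<le> (LINT x|lebesgue. \<omega> x * (norm (k x))\<^sup>2)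
      * N"
    if k: "k \<in> L2" for k
  proof -
    have *: "(\<bar>x\<bar> + 1) powr ((- 1 - \<delta>) / 2) * (\<bar>x\<bar> + 1) powr ((1 + \<delta>) / 2) = 1" for x :: real
      by (simp add: powr_add[symmetric] flip: add_divide_distrib)
    have sq: "((\<bar>x\<bar> + 1) powr ((- 1 - \<delta>) / 2))\<^sup>2 = \<omega> x" "((\<bar>x\<bar> + 1) powr ((1 + \<delta>) / 2))\<^sup>2 = (\<bar>x\<bar> +
        1) powr (1 + \<delta>)" for x :: real
      by (simp_all add: \<omega>_def power2_eq_square powr_add[symmetric])
    let ?a = "\<lambda>x. (\<bar>x\<bar> + 1) powr ((- 1 - \<delta>) / 2) * norm (k x)" and ?b = "\<lambda>x. (\<bar>x\<bar> + 1) powr ((1 +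
        \<delta>) / 2) * norm (f x)"
    have m: "?a \<in> borel_measurable lebesgue" "?b \<in> borel_measurable lebesgue"
      using L2_measurable[OF k] L2_measurable[OF f_L2] \<omega>_meas by measurable
    have "(LINT x|lebesgue. ?a x * ?b x)\<^sup>2 \<le> (LINT x|lebesgue. (?a x)\<^sup>2) * (LINT x|lebesgue. (?b
        x)\<^sup>2)"
      using wt_int[OF L2_integrable[OF k]] wf
      by (intro Cauchy_Schwarz_integral m) (simp_all add: power_mult_distrib sq)
    also have "(\<lambda>x. ?a x * ?b x) = (\<lambda>x. norm (k x) * norm (f x))"
    proof
      fix x
      have "?a x * ?b x = ((\<bar>x\<bar> + 1) powr ((- 1 - \<delta>) / 2) * (\<bar>x\<bar> + 1) powr ((1 + \<delta>) / 2)) * (norm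
          (k x) * norm (f x))"
        by (simp only: mult_ac)
      then show "?a x * ?b x = norm (k x) * norm (f x)" unfolding * by simp
    qed
    finally show ?thesis by (simp add: power_mult_distrib sq N_def)
  qed
  have Dle: "D\<^sup>2 \<le> N * J"
  proof -
    have "(LINT x|lebesgue. \<omega> x * (norm (p x))\<^sup>2) \<le> J"
      unfolding J_def using \<omega> E by (intro integral_mono wt_int L2_integrable p_L2 J_int
          mult_left_mono) auto
    then have "(LINT x|lebesgue. \<omega> x * (norm (p x))\<^sup>2) * N \<le> J * N"
      by (intro mult_right_mono) (auto simp: N_def)
    then show ?thesis using CS[OF p_L2] by (simp add: mult.commute)
  qed
  have Ale: "A\<^sup>2 \<le> N * (J / E)"
  proof -
    have "E * (LINT x|lebesgue. \<omega> x * (norm (w x))\<^sup>2) = (LINT x|lebesgue. \<omega> x * (E * (norm (w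
        x))\<^sup>2))"
      by (subst integral_mult_right_zero[symmetric]) (simp add: mult.left_commute)
    also have "\<dots> \<le> J"
      unfolding J_def using \<omega> E
      by (intro integral_mono wt_int integrable_mult_right L2_integrable w_L2 J_int
          mult_left_mono) auto
    finally have "(LINT x|lebesgue. \<omega> x * (norm (w x))\<^sup>2) \<le> J / E" using E by (simp add:
        pos_le_divide_eq mult.commute)
    then have "(LINT x|lebesgue. \<omega> x * (norm (w x))\<^sup>2) * N \<le> J / E * N"
      by (intro mult_right_mono) (auto simp: N_def)
    then show ?thesis using CS[OF w_L2] by (simp add: mult.commute)
  qed
  have "J \<le> exp (2 / \<delta> + tv UNIV / (h * sqrt E))
      * (4 / h\<^sup>2 + 2 / h + 1 / (E * h\<^sup>2) * (2 + 2 * E + (tv UNIV)\<^sup>2 / h\<^sup>2)\<^sup>2) * exp (2 / \<delta> + tv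
          UNIV / (h * sqrt E)) * N"
  proof (rule resolvent_arithmetic[OF h E \<delta> \<epsilon> _ _ _ _ _ _ _ _ mass_bounds
      integrable_L2_product(2)[OF w_L2 p_L2] Ale Dle _ J refl])
    show "F \<le> exp (tv UNIV / (h * sqrt E)) * (2 / h * D + 2 * \<epsilon> / h * R)" by (simp add: F_def)
  qed (auto simp: J_def N_def intro!: integral_nonneg_AE mult_nonneg_nonneg \<omega> energy_nonneg
      add_nonneg_nonneg less_imp_le[OF E])
  then show ?thesis by (simp add: J_def N_def \<omega>_def C1_def)
qed

end

section \<open>The resolvent estimate\<close>

lemma jordan_decomposition_pos_neg_var:
  assumes "finite_signed_borel_measure V"
  shows "jordan_decomposition V (pos_var V, neg_var V)"
  using someI_ex[OF ex_jordan_decomposition[OF assms]] by (simp add: pos_var_def neg_var_def)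

lemma measure_pair_pos_neg_var:
  assumes "finite_signed_borel_measure V"
  shows "measure_pair (pos_var V) (neg_var V)"
  using jordan_decomposition_pos_neg_var[OF assms]
  by (auto simp: jordan_decomposition_def measure_pair_def)

lemma set_integral_cong_AE_lebesgue:
  assumes "AE x in lebesgue. f x = g x" "f \<in> borel_measurable lebesgue" "g \<in> borel_measurable
      lebesgue"
  shows "(LINT x:{a..b :: real}|lebesgue. f x) = (LINT x:{a..b}|lebesgue. g x :: complex)"
  unfolding set_lebesgue_integral_def
proof (rule integral_cong_AE)
  show "AE x in lebesgue. indicat_real {a..b} x *\<^sub>R f x = indicat_real {a..b} x *\<^sub>R g x"
    using assms(1) by eventually_elim simp
qed (use assms in \<open>auto intro!: borel_measurable_scaleR borel_measurable_indicator\<close>)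

lemma H1_weak_deriv:
  assumes "u \<in> H1"
  shows "has_weak_deriv u (weak_deriv u)"
proof -
  have "\<exists>v. has_weak_deriv u v" using assms by (simp add: H1_def)
  then show ?thesis unfolding weak_deriv_def by (rule someI_ex)
qed

text \<open>\<open>weak_derivative_representative\<close> with \<open>k = 0\<close> gives a
  continuous candidate. It is bounded because the increments of its squared norm are at most the
  integral of \<open>2 |w| |v|\<close>, finite for two functions in \<open>L2\<close>; this and
  \<open>continuous_AE_eq\<close> determine \<open>cont_rep u\<close>.\<close>

lemma (in measure_pair) H1_continuous_representative:
  assumes u: "u \<in> H1"
  shows "a \<le> b \<Longrightarrow> cont_rep u b - cont_rep u a = (LINT x:{a..b}|lebesgue. weak_deriv u x)"
    and "AE x in lebesgue. u x = cont_rep u x"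
    and "continuous_on UNIV (cont_rep u)" and "bounded (range (cont_rep u))"
proof -
  define v where "v = weak_deriv u"
  have uv: "has_weak_deriv u v" unfolding v_def by (rule H1_weak_deriv[OF u])
  have u2: "u \<in> L2" and v2: "v \<in> L2" using u by (auto simp: H1_def v_def)
  note u_loc = L2_loc_int[OF u2] and v_loc = L2_loc_int[OF v2]
  have weak: "- (LINT x|lebesgue. u x * vderiv \<phi> x) = sint UNIV (\<lambda>x. 0 * \<phi> x) + (LINT x|lebesgue.
      v x * \<phi> x)"
    if "\<phi> \<in> test_functions" for \<phi>
    using uv that by (simp add: has_weak_deriv_def dist_eq_def dist_deriv_def dist_of_fun_def
        sint_def)
  obtain w where w_meas: "w \<in> borel_measurable lebesgue" and ae: "AE x in lebesgue. u x = w x"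
    and "\<forall>a b. a \<le> b \<longrightarrow> w b - w a = sint {a<..b} (\<lambda>x. 0) + (LINT x:{a..b}|lebesgue. v x)"
    using weak_derivative_representative[OF u_loc v_loc borel_measurable_const _ weak, of 0] by auto
  then have w: "w b - w a = (LINT x:{a..b}|lebesgue. v x)" if "a \<le> b" for a b
    using that by (simp add: sint_def)
  have w_cont: "continuous_on UNIV w" by (rule continuous_if_interval_integral[OF v_loc w])
  have w2: "w \<in> L2" by (rule L2_cong_AE[OF u2 ae w_meas])
  have wv_int: "integrable lebesgue (\<lambda>x. 2 * (norm (w x) * norm (v x)))"
    using integrable_L2_product(1)[OF w2 v2] by simp
  define B where "B = (LINT x|lebesgue. 2 * (norm (w x) * norm (v x)))"
  have increment: "\<bar>(norm (w d))\<^sup>2 - (norm (w c))\<^sup>2\<bar> \<le> B" if "c \<le> d" for c d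
  proof -
    note loc = loc_int_cmult[OF loc_int_Re[OF norm_square_increment(2)[OF v_loc w that]], of 2]
    have "(norm (w d))\<^sup>2 - (norm (w c))\<^sup>2 = (LINT x:{c..d}|lebesgue. 2 * Re (cnj (w x) * v x))"
      by (rule norm_square_increment(1)[OF v_loc w that])
    then have "\<bar>(norm (w d))\<^sup>2 - (norm (w c))\<^sup>2\<bar> \<le> (LINT x:{c..d}|lebesgue. \<bar>2 * Re (cnj (w x) * v
        x)\<bar>)"
      unfolding real_norm_def[symmetric] by (simp only:) (rule set_integral_norm_bound[OF
          loc_intD[OF loc]])
    also have "\<dots> \<le> (LINT x:{c..d}|lebesgue. 2 * (norm (w x) * norm (v x)))"
    proof (rule set_integral_mono[OF loc_intD[OF loc_int_norm[OF loc, unfolded real_norm_def]]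
        loc_intD[OF integrable_imp_loc_int[OF wv_int]]])
      fix x
      show "\<bar>2 * Re (cnj (w x) * v x)\<bar> \<le> 2 * (norm (w x) * norm (v x))"
        using abs_Re_le_cmod[of "cnj (w x) * v x"] unfolding norm_mult complex_mod_cnj abs_mult by
            simp
    qed
    also have "\<dots> \<le> B" unfolding B_def by (rule interval_integral_le_integral[OF wv_int]) simp
    finally show ?thesis .
  qed
  have w_sq: "(norm (w x))\<^sup>2 \<le> (norm (w 0))\<^sup>2 + B" for x
    using increment[of 0 x] increment[of x 0] by (cases "0 \<le> x") (simp_all add: abs_le_iff)
  have w_bdd: "bounded (range w)"
    unfolding bounded_iff
  proof (intro exI ballI)
    fix y assume "y \<in> range w"
    then show "norm y \<le> sqrt ((norm (w 0))\<^sup>2 + B)" using w_sq by (auto intro: real_le_rsqrt)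
  qed
  have "cont_rep u = w"
    unfolding cont_rep_def
  proof (rule the_equality)
    show "continuous_on UNIV w \<and> bounded (range w) \<and> (AE x in lebesgue. w x = u x)"
      using w_cont w_bdd ae by (auto simp: eq_commute)
    fix w' assume w': "continuous_on UNIV w' \<and> bounded (range w') \<and> (AE x in lebesgue. w' x = u x)"
    from w' have "AE x in lebesgue. w' x = u x" by blast
    with ae have "AE x in lebesgue. w' x = w x" by eventually_elim simp
    then show "w' = w" using w' w_cont by (intro continuous_AE_eq) auto
  qed
  then show "a \<le> b \<Longrightarrow> cont_rep u b - cont_rep u a = (LINT x:{a..b}|lebesgue. weak_deriv u x)"
    and "AE x in lebesgue. u x = cont_rep u x"
    and "continuous_on UNIV (cont_rep u)" and "bounded (range (cont_rep u))"
    using w ae w_cont w_bdd by (simp_all add: v_def)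
qed

lemma C1_const_eq:
  assumes "0 < \<delta>" "0 < h" "0 < E"
  shows "C1_const V E h \<delta> = 2 / \<delta> + tv_norm V / (h * sqrt E)"
proof -
  have "E powr (- 1 / 2) = 1 / sqrt E"
    using assms powr_minus_divide[of E "1 / 2"] by (simp add: powr_half_sqrt)
  moreover have "\<delta> powr (- 1) = 1 / \<delta>" "h powr (- 1) = 1 / h"
    using assms powr_minus_divide[of \<delta> 1] powr_minus_divide[of h 1] by simp_all
  ultimately show ?thesis unfolding C1_const_def by simp
qed

text \<open>The sign is \<open>s\<close>: subtracting \<open>z = E - i s \<epsilon>\<close> in
  \<open>P_shift\<close> yields \<open>P - E + i s \<epsilon>\<close>.\<close>

theorem theorem1p1:
  fixes \<delta> h \<epsilon> s :: real
    and V :: "real \<Rightarrow> real set \<Rightarrow> real"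
    and E :: "real \<Rightarrow> real"
    and u :: "real \<Rightarrow> complex"
  assumes "\<delta> > 0"
    and "\<And>k. k > 0 \<Longrightarrow> finite_signed_borel_measure (V k)"
    and "\<And>k. k > 0 \<Longrightarrow> E k > 0"
    and "h > 0"
    and "\<epsilon> \<in> {0..1}"
    and "s \<in> {1, -1}"
    and "u \<in> P_dom (V h) h"
    and "(\<lambda>x. of_real ((\<bar>x\<bar> + 1) powr ((1 + \<delta>) / 2))
              * P_shift (V h) h (of_real (E h) - of_real s * \<i> * of_real \<epsilon>) u x) \<in> L2"
  shows "(LINT x|lebesgue. (\<bar>x\<bar> + 1) powr (- 1 - \<delta>)
            * (E h * (norm (u x))\<^sup>2 + (norm (of_real h * weak_deriv u x))\<^sup>2))
         \<le> C_const (V h) (E h) h \<delta>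
            * (LINT x|lebesgue. (\<bar>x\<bar> + 1) powr (1 + \<delta>)
                * (norm (P_shift (V h) h (of_real (E h) - of_real s * \<i> * of_real \<epsilon>) u x))\<^sup>2)"
proof -
  let ?z = "of_real (E h) - of_real s * \<i> * of_real \<epsilon> :: complex"
  note \<delta> = assms(1) and h = assms(4)
  have E: "E h > 0" by (rule assms(3)[OF h])
  interpret measure_pair "pos_var (V h)" "neg_var (V h)"
    by (rule measure_pair_pos_neg_var[OF assms(2)[OF h]])
  have tv_eq: "tv UNIV = tv_norm (V h)"
    by (simp add: tv_def tv_norm_def total_variation_def)
  have si_eq: "signed_integral (V h) k = sint UNIV k" for k
    by (simp add: signed_integral_def sint_def set_lebesgue_integral_def)
  define w where "w = cont_rep u"
  define v where "v = weak_deriv u"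
  define g where "g = P_op (V h) h u"
  \<comment> \<open>\<open>u\<close> is an arbitrary representative, so the continuous
    \<open>w\<close> replaces it here; \<open>f\<close> then agrees with the shifted
    \<open>P u\<close> almost everywhere, and the integrals are unaffected.\<close>
  define f where "f x = g x - ?z * w x" for x
  have uH: "u \<in> H1" and "\<exists>f\<in>L2. dist_eq (P_dist (V h) h u) (dist_of_fun f)"
    using assms(7) by (auto simp: P_dom_def)
  then have "g \<in> L2 \<and> dist_eq (P_dist (V h) h u) (dist_of_fun g)"
    unfolding g_def P_op_def by (intro someI_ex[of "\<lambda>f. f \<in> L2 \<and> dist_eq (P_dist (V h) h u)
        (dist_of_fun f)"]) blast
  then have g2: "g \<in> L2" and Pu: "dist_eq (P_dist (V h) h u) (dist_of_fun g)" by auto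
  note w = H1_continuous_representative[OF uH, folded w_def v_def]
  have u2: "u \<in> L2" and v2: "v \<in> L2" using uH by (auto simp: H1_def v_def)
  have uv: "has_weak_deriv u v" unfolding v_def by (rule H1_weak_deriv[OF uH])
  have w2: "w \<in> L2" by (rule L2_cong_AE[OF u2 w(2) continuous_measurable_lebesgue[OF w(3)]])
  have "f = (\<lambda>x. 1 * g x + (- ?z) * w x)" by (auto simp: f_def algebra_simps)
  then have f2: "f \<in> L2" using L2_lincomb[OF g2 w2] by metis
  have hv2: "(\<lambda>x. of_real h * v x) \<in> L2" using L2_lincomb[OF v2 v2, of "of_real h" 0] by simp
  have w_borel: "w \<in> borel_measurable borel" by (rule borel_measurable_continuous_onI[OF w(3)])
  obtain K where K: "\<forall>x. norm (w x) \<le> K" using w(4) by (auto simp: bounded_iff)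
  \<comment> \<open>The equation \<open>P u = g\<close>, divided by \<open>h\<close>: the
    distributional derivative of \<open>h * v\<close> is the measure
    \<open>(w V - g dx) / h\<close>. So \<open>weak_derivative_representative\<close> applies and
    supplies \<open>p\<close>.\<close>
  have weak: "- (LINT x|lebesgue. of_real h * v x * vderiv \<phi> x)
      = sint UNIV (\<lambda>x. of_real (1 / h) * w x * \<phi> x) + (LINT x|lebesgue. - (of_real (1 / h) * g x)
          * \<phi> x)"
    if \<phi>: "\<phi> \<in> test_functions" for \<phi>
  proof -
    have *: "dist_deriv (dist_of_fun u) (vderiv \<phi>) = (LINT x|lebesgue. v x * vderiv \<phi> x)"
      using uv vderiv_test_function[OF \<phi>] by (simp add: has_weak_deriv_def dist_eq_def
          dist_of_fun_def)
    have "P_dist (V h) h u \<phi> = dist_of_fun g \<phi>" using Pu \<phi> by (simp add: dist_eq_def)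
    then have eq: "(of_real h)\<^sup>2 * (LINT x|lebesgue. v x * vderiv \<phi> x) + sint UNIV (\<lambda>x. w x * \<phi> x)
        = (LINT x|lebesgue. g x * \<phi> x)"
      by (simp add: P_dist_def dist_deriv_def[of "dist_deriv _"] * si_eq w_def[symmetric]
          dist_of_fun_def[of g])
    have 1: "(LINT x|lebesgue. of_real h * v x * vderiv \<phi> x) = of_real h * (LINT x|lebesgue. v x *
        vderiv \<phi> x)"
      by (simp add: mult.assoc)
    have 2: "sint UNIV (\<lambda>x. of_real (1 / h) * w x * \<phi> x) = of_real (1 / h) * sint UNIV (\<lambda>x. w x *
        \<phi> x)"
      using sint_cmult[of UNIV "of_real (1 / h)" "\<lambda>x. w x * \<phi> x"] by (simp only: mult.assoc)
    have 3: "(LINT x|lebesgue. - (of_real (1 / h) * g x) * \<phi> x) = - (of_real (1 / h) * (LINT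
        x|lebesgue. g x * \<phi> x))"
      by (simp only: mult_minus_left mult.assoc integral_minus integral_mult_right_zero)
    show ?thesis
      unfolding 1 2 3 eq[symmetric] using h by (simp add: field_simps power2_eq_square)
  qed
  obtain p where p_meas: "p \<in> borel_measurable lebesgue" and vp: "AE x in lebesgue. of_real h * v
      x = p x"
    and p: "\<forall>a b. a \<le> b \<longrightarrow> p b - p a = sint {a<..b} (\<lambda>x. of_real (1 / h) * w x)
      + (LINT x:{a..b}|lebesgue. - (of_real (1 / h) * g x))"
  proof -
    have g: "loc_int (\<lambda>x. - (of_real (1 / h) * g x))"
      using loc_int_cmult[OF L2_loc_int[OF g2], of "- of_real (1 / h)"] by simp
    have K': "norm (of_real (1 / h) * w x) \<le> 1 / h * K" for x
      using K h by (simp add: norm_mult norm_divide divide_right_mono)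
    have k: "(\<lambda>x. of_real (1 / h) * w x) \<in> borel_measurable borel" using w_borel by measurable
    show ?thesis
      using weak_derivative_representative[OF L2_loc_int[OF hv2] g k K' weak] that by blast
  qed
  have p2: "p \<in> L2" by (rule L2_cong_AE[OF hv2 vp p_meas])
  interpret resolvent_solution "pos_var (V h)" "neg_var (V h)" w p f h "E h" \<epsilon> s
  proof unfold_locales
    show "w b - w a = (LINT x:{a..b}|lebesgue. of_real (1 / h) * p x)" if "a \<le> b" for a b
      unfolding w(1)[OF that]
    proof (rule set_integral_cong_AE_lebesgue)
      show "AE x in lebesgue. v x = of_real (1 / h) * p x"
        using vp by eventually_elim (use h in \<open>auto simp: field_simps\<close>)
    qed (use p_meas L2_measurable[OF v2] in measurable)
    show "p b - p a = of_real (1 / h) * sint {a<..b} w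
        - (LINT x:{a..b}|lebesgue. of_real (1 / h) * (f x + ?z * w x))" if "a \<le> b" for a b
    proof -
      have neg: "(LINT x:{a..b}|lebesgue. - F x) = - (LINT x:{a..b}|lebesgue. F x)" for F :: "real
          \<Rightarrow> complex"
        by (simp add: set_lebesgue_integral_def)
      \<comment> \<open>The definition of \<open>f\<close> is undone, so that the increment formula
        of \<open>p\<close> takes the shape that the locale expects.\<close>
      have fz: "f x + ?z * w x = g x" for x by (simp add: f_def)
      show ?thesis using p[rule_format, OF that] unfolding sint_cmult neg fz by simp
    qed
  qed (use h E assms(5,6) w2 p2 f2 in auto)
  have shift: "AE x in lebesgue. P_shift (V h) h ?z u x = f x"
    using w(2) by eventually_elim (simp add: P_shift_def f_def g_def)
  have sq: "(norm (of_real ((\<bar>x\<bar> + 1) powr ((1 + \<delta>) / 2)) * a :: complex))\<^sup>2 = (\<bar>x\<bar> + 1) powr (1 +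
      \<delta>) * (norm a)\<^sup>2" for x a
  proof -
    have "((\<bar>x\<bar> + 1) powr ((1 + \<delta>) / 2))\<^sup>2 = (\<bar>x\<bar> + 1) powr (1 + \<delta>)"
      by (simp add: power2_eq_square powr_add[symmetric])
    then show ?thesis by (simp add: norm_mult power_mult_distrib)
  qed
  have powr_meas: "(\<lambda>x :: real. (\<bar>x\<bar> + 1) powr c) \<in> borel_measurable lebesgue" for c
  proof -
    have "continuous_on UNIV (\<lambda>x :: real. (\<bar>x\<bar> + 1) powr c)" by (intro continuous_intros) auto
    then show ?thesis by (rule continuous_measurable_lebesgue)
  qed
  have f_sq_meas: "(\<lambda>x. (\<bar>x\<bar> + 1) powr (1 + \<delta>) * (norm (f x))\<^sup>2) \<in> borel_measurable lebesgue"
    using powr_meas[of "1 + \<delta>"] L2_measurable[OF f2] by measurable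
  have S_int: "integrable lebesgue (\<lambda>x. (\<bar>x\<bar> + 1) powr (1 + \<delta>) * (norm (P_shift (V h) h ?z u x))\<^sup>2)"
    using L2_integrable[OF assms(8)] unfolding sq .
  have S_eq: "AE x in lebesgue. (\<bar>x\<bar> + 1) powr (1 + \<delta>) * (norm (P_shift (V h) h ?z u x))\<^sup>2
      = (\<bar>x\<bar> + 1) powr (1 + \<delta>) * (norm (f x))\<^sup>2"
    using shift by eventually_elim simp
  have f_int: "integrable lebesgue (\<lambda>x. (\<bar>x\<bar> + 1) powr (1 + \<delta>) * (norm (f x))\<^sup>2)"
    using integrable_cong_AE[OF borel_measurable_integrable[OF S_int] f_sq_meas S_eq] S_int by blast
  have lhs: "(LINT x|lebesgue. (\<bar>x\<bar> + 1) powr (- 1 - \<delta>) * (E h * (norm (u x))\<^sup>2 + (norm (of_real h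
      * v x))\<^sup>2))
      = (LINT x|lebesgue. (\<bar>x\<bar> + 1) powr (- 1 - \<delta>) * energy x)"
  proof (rule integral_cong_AE)
    show "AE x in lebesgue. (\<bar>x\<bar> + 1) powr (- 1 - \<delta>) * (E h * (norm (u x))\<^sup>2 + (norm (of_real h *
        v x))\<^sup>2)
        = (\<bar>x\<bar> + 1) powr (- 1 - \<delta>) * energy x"
      using w(2) vp by eventually_elim simp
    show "(\<lambda>x. (\<bar>x\<bar> + 1) powr (- 1 - \<delta>) * (E h * (norm (u x))\<^sup>2 + (norm (of_real h * v x))\<^sup>2)) \<in>
        borel_measurable lebesgue"
      using powr_meas[of "- 1 - \<delta>"] L2_measurable[OF u2] L2_measurable[OF hv2] by measurable
    show "(\<lambda>x. (\<bar>x\<bar> + 1) powr (- 1 - \<delta>) * energy x) \<in> borel_measurable lebesgue"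
      using powr_meas[of "- 1 - \<delta>"] L2_measurable[OF w2] p_meas by measurable
  qed
  have rhs: "(LINT x|lebesgue. (\<bar>x\<bar> + 1) powr (1 + \<delta>) * (norm (P_shift (V h) h ?z u x))\<^sup>2)
      = (LINT x|lebesgue. (\<bar>x\<bar> + 1) powr (1 + \<delta>) * (norm (f x))\<^sup>2)"
    by (rule integral_cong_AE[OF borel_measurable_integrable[OF S_int] f_sq_meas S_eq])
  show ?thesis
    using weighted_energy_bound[OF \<delta> f_int]
    unfolding C_const_def C1_const_eq[OF \<delta> h E] tv_eq lhs[unfolded v_def] rhs .
qed

end
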